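(* Each non-metrizable sequential $k^*$-metrizable locally convex space is homeomorphic to $\mathbb R^\infty$ or $\mathbb R^\infty\times Q$.
   Context: All topological spaces are Hausdorff; locally convex spaces are real; "map" means continuous function. $\mathbb R^\infty=\varinjlim\mathbb R^n$ is the strict inductive limit of the sequence of finite-dimensional Euclidean spaces $\mathbb R^1\subset\mathbb R^2\subset\dots$, and $Q=[0,1]^\omega$ is the Hilbert cube. A subset is precompact if its closure is compact. A map $f:M\to X$ is subproper if there is $Z\subset M$ with $f(Z)=X$ such that $Z\cap f^{-1}(K)$ is precompact in $M$ for every precompact $K\subset X$. A space is $k^*$-metrizable if it is the image of a metrizable space under a subproper map. A subset is sequentially closed if it contains the limits of all its sequences convergent in $X$; $X$ is sequential if each sequentially closed subset is closed. *)

theory Defs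
  imports "HOL-Analysis.Analysis" "HOL-Analysis.Finite_Function_Topology"
begin

text \<open>Topologies are values of type \<open>'a topology\<close>, so a vector space can carry several topologies
  and the topology coming from a type class instance plays no role. Being Hausdorff is a separate
  hypothesis wherever it is needed.\<close>

definition locally_convex_topology :: "'a::real_vector topology \<Rightarrow> bool" where
  "locally_convex_topology X \<longleftrightarrow>
     topspace X = UNIV \<and>
     continuous_map (prod_topology X X) X (\<lambda>(x, y). x + y) \<and>
     continuous_map (prod_topology euclideanreal X) X (\<lambda>(c, x). c *\<^sub>R x) \<and>
     neighbourhood_base_of convex X"

definition sequentially_closedin :: "'a topology \<Rightarrow> 'a set \<Rightarrow> bool" where
  "sequentially_closedin X S \<longleftrightarrow>
     S \<subseteq> topspace X \<and>
     (\<forall>\<sigma> l. (\<forall>n. \<sigma> n \<in> S) \<and> limitin X \<sigma> l sequentially \<longrightarrow> l \<in> S)"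

definition sequential_space :: "'a topology \<Rightarrow> bool" where
  "sequential_space X \<longleftrightarrow> (\<forall>S. sequentially_closedin X S \<longrightarrow> closedin X S)"

definition precompactin :: "'a topology \<Rightarrow> 'a set \<Rightarrow> bool" where
  "precompactin X K \<longleftrightarrow> K \<subseteq> topspace X \<and> compactin X (X closure_of K)"

definition subproper_map :: "'m topology \<Rightarrow> 'a topology \<Rightarrow> ('m \<Rightarrow> 'a) \<Rightarrow> bool" where
  "subproper_map M X f \<longleftrightarrow>
     continuous_map M X f \<and>
     (\<exists>Z \<subseteq> topspace M. f ` Z = topspace X \<and>
        (\<forall>K. precompactin X K \<longrightarrow> precompactin M (Z \<inter> f -` K)))"

text \<open>A definition in HOL cannot quantify over the type of points of the metrizable space, so this
  type is a parameter. As a hypothesis of a theorem in which \<open>'m\<close> is an otherwise unused type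
  variable, \<open>kstar_metrizable_space TYPE('m) X\<close> puts no restriction on the metrizable space.\<close>

definition kstar_metrizable_space :: "'m itself \<Rightarrow> 'a topology \<Rightarrow> bool" where
  "kstar_metrizable_space _ X \<longleftrightarrow>
     (\<exists>(M :: 'm topology) f. metrizable_space M \<and> subproper_map M X f)"

text \<open>The strict inductive limit of the Euclidean spaces \<open>\<real>\<^sup>n\<close> in the category of locally convex
  spaces: the vector space is the union of the \<open>\<real>\<^sup>n\<close>, i.e. the space of finitely supported
  sequences, and the topology is the finest locally convex one for which all inclusions of \<open>\<real>\<^sup>n\<close>
  are continuous. Points of \<^const>\<open>Euclidean_space\<close> \<open>n\<close> are sequences vanishing from
  index \<open>n\<close> on, so \<^const>\<open>Abs_poly_mapping\<close> restricted to them is the inclusion.\<close>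

definition R_infinity :: "(nat \<Rightarrow>\<^sub>0 real) topology" where
  "R_infinity = topology_generated_by
     {U. \<exists>T. locally_convex_topology T \<and>
             (\<forall>n\<ge>1. continuous_map (Euclidean_space n) T Abs_poly_mapping) \<and>
             openin T U}"

definition Hilbert_cube :: "(nat \<Rightarrow> real) topology" where
  "Hilbert_cube = product_topology (\<lambda>_. top_of_set {0..1}) UNIV"

text \<open>The topology of \<^const>\<open>R_infinity\<close>, a supremum of locally convex topologies, is itself
  locally convex and makes the inclusions continuous; hence it is the finest such topology.\<close>

lemma openin_R_infinityI:
  assumes "locally_convex_topology T"
    and "\<forall>n\<ge>1. continuous_map (Euclidean_space n) T Abs_poly_mapping"
    and "openin T U"
  shows "openin R_infinity U"
  unfolding R_infinity_def using assms
  by (intro topology_generated_by_Basis) blast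

lemma topspace_R_infinity [simp]: "topspace R_infinity = UNIV"
proof -
  define T :: "(nat \<Rightarrow>\<^sub>0 real) topology" where "T = topology (\<lambda>U. U = {} \<or> U = UNIV)"
  have "istopology (\<lambda>U. U = {} \<or> U = (UNIV :: (nat \<Rightarrow>\<^sub>0 real) set))"
    unfolding istopology_def by blast
  then have T: "openin T U \<longleftrightarrow> U = {} \<or> U = UNIV" for U
    by (simp add: T_def topology_inverse')
  have top: "topspace T = UNIV"
    unfolding topspace_def T by auto
  have cont: "continuous_map X T f" for X :: "'b topology" and f
    unfolding continuous_map_def top T by auto
  have "neighbourhood_base_of convex T"
    unfolding neighbourhood_base_of T by (metis convex_UNIV empty_iff subset_UNIV)
  then have "locally_convex_topology T"
    by (simp add: locally_convex_topology_def top cont)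
  then have "openin R_infinity UNIV"
    by (rule openin_R_infinityI) (auto simp: cont T)
  then show ?thesis
    using openin_subset by blast
qed

lemma continuous_map_into_R_infinity:
  assumes "\<And>T. \<lbrakk>locally_convex_topology T;
                  \<forall>n\<ge>1. continuous_map (Euclidean_space n) T Abs_poly_mapping\<rbrakk>
                 \<Longrightarrow> continuous_map X T f"
  shows "continuous_map X R_infinity f"
proof -
  have "openin X (f -` U \<inter> topspace X)"
    if "locally_convex_topology T" "openin T U"
      "\<forall>n\<ge>1. continuous_map (Euclidean_space n) T Abs_poly_mapping" for T U
    using openin_continuous_map_preimage [OF assms [OF that(1,3)] that(2)]
    by (simp add: vimage_def Int_def conj_commute)
  moreover have "f \<in> topspace X \<rightarrow> topspace R_infinity"
    by simp
  ultimately show ?thesis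
    unfolding R_infinity_def continuous_on_generated_topo_iff topology_generated_by_topspace
    by blast
qed

lemma continuous_map_inclusion_R_infinity:
  assumes "n \<ge> 1"
  shows "continuous_map (Euclidean_space n) R_infinity Abs_poly_mapping"
  using assms by (auto intro: continuous_map_into_R_infinity)

lemma locally_convex_R_infinity: "locally_convex_topology R_infinity"
proof -
  let ?P = "\<lambda>T. locally_convex_topology T \<and>
             (\<forall>n\<ge>1. continuous_map (Euclidean_space n) T Abs_poly_mapping)"
  have id: "continuous_map R_infinity T (\<lambda>x. x)" if "?P T" for T
    using that openin_R_infinityI
    by (force simp: continuous_map_def locally_convex_topology_def)
  have "continuous_map (prod_topology R_infinity R_infinity) T (\<lambda>(x, y). x + y)" if T: "?P T" for T
  proof -
    have "continuous_map (prod_topology R_infinity R_infinity) (prod_topology T T) (\<lambda>(x, y). (x, y))"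
      using id [OF T] by (subst continuous_map_prod_top) auto
    moreover have "continuous_map (prod_topology T T) T (\<lambda>(x, y). x + y)"
      using T by (simp add: locally_convex_topology_def)
    ultimately have "continuous_map (prod_topology R_infinity R_infinity) T ((\<lambda>(x, y). x + y) \<circ> (\<lambda>(x, y). (x, y)))"
      by (rule continuous_map_compose)
    then show ?thesis
      by (simp add: o_def case_prod_unfold)
  qed
  then have add: "continuous_map (prod_topology R_infinity R_infinity) R_infinity (\<lambda>(x, y). x + y)"
    by (auto intro: continuous_map_into_R_infinity)
  have "continuous_map (prod_topology euclideanreal R_infinity) T (\<lambda>(c, x). c *\<^sub>R x)"
    if T: "?P T" for T
  proof -
    have "continuous_map (prod_topology euclideanreal R_infinity) (prod_topology euclideanreal T)
            (\<lambda>(x, y). (x, y))"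
      using id [OF T] by (subst continuous_map_prod_top) auto
    moreover have "continuous_map (prod_topology euclideanreal T) T (\<lambda>(c, x). c *\<^sub>R x)"
      using T by (simp add: locally_convex_topology_def)
    ultimately have "continuous_map (prod_topology euclideanreal R_infinity) T ((\<lambda>(x, y). x *\<^sub>R y) \<circ> (\<lambda>(x, y). (x, y)))"
      by (rule continuous_map_compose)
    then show ?thesis
      by (simp add: o_def case_prod_unfold)
  qed
  then have scale: "continuous_map (prod_topology euclideanreal R_infinity) R_infinity (\<lambda>(c, x). c *\<^sub>R x)"
    by (auto intro: continuous_map_into_R_infinity)
  have "\<forall>x\<in>W. \<exists>U V. openin R_infinity U \<and> convex V \<and> x \<in> U \<and> U \<subseteq> V \<and> V \<subseteq> W"
    if "openin R_infinity W" for W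
  proof -
    have "generate_topology_on {U. \<exists>T. ?P T \<and> openin T U} W"
      using that by (simp add: R_infinity_def openin_topology_generated_by_iff conj_assoc)
    then show ?thesis
    proof (induction rule: generate_topology_on.induct)
      case Empty
      then show ?case by simp
    next
      case (Int A B)
      show ?case
      proof
        fix x assume x: "x \<in> A \<inter> B"
        then obtain U V U' V' where "openin R_infinity U" "convex V" "x \<in> U" "U \<subseteq> V" "V \<subseteq> A"
          "openin R_infinity U'" "convex V'" "x \<in> U'" "U' \<subseteq> V'" "V' \<subseteq> B"
          using Int.IH by (metis IntD1 IntD2)
        then have "openin R_infinity (U \<inter> U') \<and> convex (V \<inter> V') \<and> x \<in> U \<inter> U' \<and>
            U \<inter> U' \<subseteq> V \<inter> V' \<and> V \<inter> V' \<subseteq> A \<inter> B"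
          by (auto intro: convex_Int)
        then show "\<exists>U V. openin R_infinity U \<and> convex V \<and> x \<in> U \<and> U \<subseteq> V \<and> V \<subseteq> A \<inter> B"
          by blast
      qed
    next
      case (UN K)
      show ?case
      proof
        fix x assume "x \<in> \<Union>K"
        then obtain k where "k \<in> K" "x \<in> k" by blast
        with UN.IH obtain U V where "openin R_infinity U" "convex V" "x \<in> U" "U \<subseteq> V" "V \<subseteq> k"
          by meson
        with \<open>k \<in> K\<close> show "\<exists>U V. openin R_infinity U \<and> convex V \<and> x \<in> U \<and> U \<subseteq> V \<and> V \<subseteq> \<Union>K"
          by blast
      qed
    next
      case (Basis s)
      then obtain T where T: "?P T" "openin T s" by blast
      show ?case
      proof
        fix x assume "x \<in> s"
        then obtain U V where UV: "openin T U" "convex V" "x \<in> U" "U \<subseteq> V" "V \<subseteq> s"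
          using T unfolding locally_convex_topology_def neighbourhood_base_of by meson
        have "openin R_infinity U"
          using T UV(1) by (auto intro: openin_R_infinityI)
        with UV show "\<exists>U V. openin R_infinity U \<and> convex V \<and> x \<in> U \<and> U \<subseteq> V \<and> V \<subseteq> s"
          by blast
      qed
    qed
  qed
  then have "neighbourhood_base_of convex R_infinity"
    unfolding neighbourhood_base_of by blast
  with add scale show ?thesis
    by (simp add: locally_convex_topology_def)
qed

end

theory Submission
  imports Defs "HOL-Library.Countable_Set_Type"
begin

text \<open>
  Let \<open>f : M \<rightarrow> X\<close> be subproper, witnessed by \<open>Z\<close>. If \<open>X\<close> contains no Frechet-Urysohn fan at \<open>0\<close>, the
  images of the neighbourhoods of \<open>f\<^sup>-\<^sup>1(0) \<inter> closure Z\<close> form a countable base at \<open>0\<close>, and \<open>X\<close> is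
  metrizable. Otherwise, since a sequential space cannot contain both this fan and a metric fan,
  \<open>closure Z\<close> is locally compact; it splits into \<open>\<sigma>\<close>-compact classes, and if uncountably many classes
  mattered, a chain of length \<open>\<omega>\<^sub>1\<close> of \<open>\<sigma>\<close>-compact subspaces would give null sequences
  \<open>x\<^sub>\<alpha>\<close> such that the sums \<open>x\<^sub>\<alpha>(k) + x\<^sub>\<beta>(k)\<close>, with \<open>k = e\<^sub>\<beta>(\<alpha>)\<close> for injections
  \<open>e\<^sub>\<beta> : \<beta> \<rightarrow> \<omega>\<close>, form a sequentially closed set having \<open>0\<close> in its closure. So \<open>X\<close> is the
  inductive limit of an increasing sequence of compact metrizable sets.

  If these are all finite-dimensional, a Hamel basis identifies \<open>X\<close> with \<open>\<real>\<^sup>\<infinity>\<close>. Otherwise an embedding of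
  a closed subset \<open>B\<close> of a compact metrizable space \<open>C\<close> into \<open>X\<close> extends to an embedding of \<open>C\<close>: take a
  Dugundji extension with values of countable linear dimension off \<open>B\<close>, push it off the image of \<open>B\<close>
  along a null sequence that leaves a large compact convex set, and add a small perturbation
  \<open>\<Sum>\<^sub>j 2\<^sup>-\<^sup>j c\<^sub>j(a) e\<^sub>j\<close>, with \<open>(e\<^sub>j)\<close> independent of all the vectors used, whose coefficients encode the
  point \<open>a\<close> and its distance to \<open>B\<close>. The space \<open>\<real>\<^sup>\<infinity> \<times> Q\<close> has the same extension property, and a
  back-and-forth argument along the two sequences of compact sets gives the homeomorphism.
\<close>

section \<open>Locally convex topologies\<close>

text \<open>Two facts stand in for metrizability and completeness. The compact pieces separate 0
  from all other points by countably many neighbourhoods, which gives a continuous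
  translation-invariant metric \<open>D\<close>; it need not induce the topology of X, but it does
  so on every compact set. And bounded sets lie in compact sets: otherwise points outside n times
  the n-th compact set, divided by n, form a null sequence contained in none of the pieces. Hence
  absolutely convex hulls of compact sets and series with geometric coefficients stay in compact
  sets.

  The obstacle in extending an embedding is to keep new points off the image of B. A null sequence
  outside a compact set is not enough, because consecutive weights of the extension overlap; whole
  segments must avoid the set, and a choice of signs achieves that. Injectivity off B rests on
  linear independence. Countable dimension of the values leaves room for independent vectors, and
  every coefficient is repeated infinitely often because a membership in a span involves only
  finitely many vectors.\<close>

definition znhd :: "'a::real_vector topology \<Rightarrow> 'a set \<Rightarrow> bool" where
  "znhd X V \<longleftrightarrow> (\<exists>U. openin X U \<and> 0 \<in> U \<and> U \<subseteq> V)"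

text \<open>Absolutely convex sets. Stability under scalars of modulus at most 1 follows from these
  three conditions (\<open>abscon_scale\<close>).\<close>

definition abscon :: "'a::real_vector set \<Rightarrow> bool" where
  "abscon V \<longleftrightarrow> convex V \<and> 0 \<in> V \<and> (\<forall>x\<in>V. - x \<in> V)"

lemma abscon_scale:
  assumes "abscon V" "x \<in> V" "\<bar>c\<bar> \<le> 1"
  shows "c *\<^sub>R x \<in> V"
proof -
  have V: "convex V" "0 \<in> V" "- x \<in> V"
    using assms by (auto simp: abscon_def)
  have "t *\<^sub>R y \<in> V" if "0 \<le> t" "t \<le> 1" "y \<in> V" for t y
    using convexD[OF V(1) that(3) V(2), of t "1 - t"] that by simp
  from this[of "\<bar>c\<bar>" x] this[of "\<bar>c\<bar>" "- x"] V assms show ?thesis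
    by (cases "c \<ge> 0") auto
qed

lemma abscon_minus: "abscon V \<Longrightarrow> x \<in> V \<Longrightarrow> - x \<in> V"
  by (simp add: abscon_def)

lemma abscon_0: "abscon V \<Longrightarrow> 0 \<in> V"
  by (simp add: abscon_def)

lemma abscon_convex: "abscon V \<Longrightarrow> convex V"
  by (simp add: abscon_def)

lemma abscon_combine:
  assumes "abscon V" "x \<in> V" "y \<in> V" "\<bar>a\<bar> + \<bar>b\<bar> \<le> 1"
  shows "a *\<^sub>R x + b *\<^sub>R y \<in> V"
proof (cases "\<bar>a\<bar> + \<bar>b\<bar> = 0")
  case True
  then have "a = 0" "b = 0" by auto
  then show ?thesis using assms by (simp add: abscon_0)
next
  case False
  define s where "s = \<bar>a\<bar> + \<bar>b\<bar>"
  have s: "s > 0" "s \<le> 1" using False assms by (auto simp: s_def)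
  have "(sgn a) *\<^sub>R x \<in> V" "(sgn b) *\<^sub>R y \<in> V"
    using assms by (auto intro!: abscon_scale simp: abs_sgn_eq)
  then have "(\<bar>a\<bar>/s) *\<^sub>R (sgn a *\<^sub>R x) + (\<bar>b\<bar>/s) *\<^sub>R (sgn b *\<^sub>R y) \<in> V"
    using s by (intro convexD[OF abscon_convex[OF assms(1)]]) (auto simp: s_def add_divide_distrib[symmetric])
  then have "s *\<^sub>R ((\<bar>a\<bar>/s) *\<^sub>R (sgn a *\<^sub>R x) + (\<bar>b\<bar>/s) *\<^sub>R (sgn b *\<^sub>R y)) \<in> V"
    using s by (intro abscon_scale[OF assms(1)]) auto
  then show ?thesis
    using s by (simp add: scaleR_add_right mult_sgn_abs abs_mult_sgn)
qed

lemma abscon_sum: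
  assumes "abscon V" "finite I" "\<And>i. i \<in> I \<Longrightarrow> v i \<in> V" "(\<Sum>i\<in>I. \<bar>c i\<bar>) \<le> 1"
  shows "(\<Sum>i\<in>I. c i *\<^sub>R v i) \<in> V"
proof (cases "(\<Sum>i\<in>I. \<bar>c i\<bar>) = 0")
  case True
  then have "\<forall>i\<in>I. c i = 0"
    using assms(2) by (simp add: sum_nonneg_eq_0_iff)
  then show ?thesis using assms by (simp add: abscon_0)
next
  case False
  define s where "s = (\<Sum>i\<in>I. \<bar>c i\<bar>)"
  have s: "s > 0" "s \<le> 1"
    using False assms(4) by (auto simp: s_def less_le sum_nonneg)
  have "(\<Sum>i\<in>I. (\<bar>c i\<bar> / s) *\<^sub>R (sgn (c i) *\<^sub>R v i)) \<in> V"
  proof (rule convex_sum[OF assms(2) abscon_convex[OF assms(1)]])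
    show "(\<Sum>i\<in>I. \<bar>c i\<bar> / s) = 1"
      using s by (simp add: sum_divide_distrib[symmetric] s_def[symmetric])
  qed (use s assms in \<open>auto intro!: abscon_scale simp: abs_sgn_eq\<close>)
  then have "s *\<^sub>R (\<Sum>i\<in>I. (\<bar>c i\<bar> / s) *\<^sub>R (sgn (c i) *\<^sub>R v i)) \<in> V"
    using s by (intro abscon_scale[OF assms(1)]) auto
  then show ?thesis
    using s by (simp add: scaleR_sum_right mult_sgn_abs abs_mult_sgn)
qed

lemma abscon_scaled: "abscon V \<Longrightarrow> abscon ((*\<^sub>R) c ` V)"
  unfolding abscon_def by (auto simp: convex_scaling image_iff) (metis scaleR_minus_right)

lemma abscon_Int: "abscon V \<Longrightarrow> abscon W \<Longrightarrow> abscon (V \<inter> W)"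
  unfolding abscon_def by (auto intro: convex_Int)

section \<open>Neighbourhoods of 0, limits and closures in a Hausdorff locally convex space\<close>

locale lcs =
  fixes X :: "'a::real_vector topology"
  assumes lc: "locally_convex_topology X" and haus: "Hausdorff_space X"
begin

lemma top [simp]: "topspace X = UNIV"
  using lc by (simp add: locally_convex_topology_def)

lemma cont_add:
  assumes "continuous_map Y X f" "continuous_map Y X g"
  shows "continuous_map Y X (\<lambda>y. f y + g y)"
proof -
  have "continuous_map Y (prod_topology X X) (\<lambda>y. (f y, g y))"
    using assms by (simp add: continuous_map_pairwise o_def)
  moreover have "continuous_map (prod_topology X X) X (\<lambda>(x, y). x + y)"
    using lc by (simp add: locally_convex_topology_def)
  ultimately have "continuous_map Y X ((\<lambda>(x, y). x + y) \<circ> (\<lambda>y. (f y, g y)))"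
    by (rule continuous_map_compose)
  then show ?thesis by (simp add: o_def)
qed

lemma cont_scale:
  assumes "continuous_map Y euclideanreal c" "continuous_map Y X g"
  shows "continuous_map Y X (\<lambda>y. c y *\<^sub>R g y)"
proof -
  have "continuous_map Y (prod_topology euclideanreal X) (\<lambda>y. (c y, g y))"
    using assms by (simp add: continuous_map_pairwise o_def)
  moreover have "continuous_map (prod_topology euclideanreal X) X (\<lambda>(x, y). x *\<^sub>R y)"
    using lc by (simp add: locally_convex_topology_def)
  ultimately have "continuous_map Y X ((\<lambda>(x, y). x *\<^sub>R y) \<circ> (\<lambda>y. (c y, g y)))"
    by (rule continuous_map_compose)
  then show ?thesis by (simp add: o_def)
qed

lemma cont_scale_const: "continuous_map Y X g \<Longrightarrow> continuous_map Y X (\<lambda>y. c *\<^sub>R g y)"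
  by (rule cont_scale) auto

lemma cont_minus: "continuous_map Y X g \<Longrightarrow> continuous_map Y X (\<lambda>y. - g y)"
  using cont_scale_const[of Y g "-1"] by simp

lemma cont_diff:
  assumes "continuous_map Y X f" "continuous_map Y X g"
  shows "continuous_map Y X (\<lambda>y. f y - g y)"
  using cont_add[OF assms(1) cont_minus[OF assms(2)]] by simp

lemma cont_sum:
  assumes "finite I" "\<And>i. i \<in> I \<Longrightarrow> continuous_map Y X (f i)"
  shows "continuous_map Y X (\<lambda>y. \<Sum>i\<in>I. f i y)"
  using assms
proof (induction I rule: finite_induct)
  case empty
  then show ?case by simp
next
  case (insert i I)
  then show ?case by (simp add: cont_add)
qed

lemma open_translate:
  assumes "openin X U"
  shows "openin X {x. x - a \<in> U}"
proof -
  have "continuous_map X X (\<lambda>x. x - a)"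
    by (intro cont_diff) auto
  from openin_continuous_map_preimage[OF this assms] show ?thesis by simp
qed

lemma znhd_iff_open: "openin X U \<Longrightarrow> x \<in> U \<Longrightarrow> znhd X {y. x + y \<in> U}"
  unfolding znhd_def using open_translate[of U "-x"]
  by (intro exI[of _ "{y. x + y \<in> U}"]) (simp add: add.commute)

lemma openin_iff_znhd: "openin X U \<longleftrightarrow> (\<forall>x\<in>U. znhd X {y. x + y \<in> U})"
proof
  assume R: "\<forall>x\<in>U. znhd X {y. x + y \<in> U}"
  show "openin X U"
  proof (subst openin_subopen, clarify)
    fix x assume "x \<in> U"
    with R obtain W where W: "openin X W" "0 \<in> W" "W \<subseteq> {y. x + y \<in> U}"
      unfolding znhd_def by blast
    show "\<exists>T. openin X T \<and> x \<in> T \<and> T \<subseteq> U"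
      using W open_translate[OF W(1), of x]
      by (intro exI[of _ "{z. z - x \<in> W}"]) force
  qed
qed (use znhd_iff_open in blast)

lemma znhd_mono: "znhd X V \<Longrightarrow> V \<subseteq> W \<Longrightarrow> znhd X W"
  unfolding znhd_def by blast

lemma znhd_Int: "znhd X V \<Longrightarrow> znhd X W \<Longrightarrow> znhd X (V \<inter> W)"
  unfolding znhd_def by (metis IntI Int_mono openin_Int)

lemma znhd_0: "znhd X V \<Longrightarrow> 0 \<in> V"
  unfolding znhd_def by blast

lemma znhd_UNIV: "znhd X UNIV"
  unfolding znhd_def using openin_topspace[of X] by auto

lemma znhd_scaled:
  assumes "znhd X V" "c \<noteq> 0"
  shows "znhd X ((*\<^sub>R) c ` V)"
proof -
  obtain U where U: "openin X U" "0 \<in> U" "U \<subseteq> V"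
    using assms unfolding znhd_def by blast
  have "continuous_map X X (\<lambda>x. (1/c) *\<^sub>R x)"
    by (intro cont_scale_const) auto
  from openin_continuous_map_preimage[OF this U(1)]
  have "openin X {x. (1/c) *\<^sub>R x \<in> U}" by simp
  moreover have "{x. (1/c) *\<^sub>R x \<in> U} \<subseteq> (*\<^sub>R) c ` V"
  proof
    fix x assume "x \<in> {x. (1/c) *\<^sub>R x \<in> U}"
    then have "x = c *\<^sub>R ((1/c) *\<^sub>R x)" "(1/c) *\<^sub>R x \<in> V"
      using U assms by auto
    then show "x \<in> (*\<^sub>R) c ` V" by blast
  qed
  ultimately show ?thesis
    unfolding znhd_def using U(2) by (intro exI[of _ "{x. (1/c) *\<^sub>R x \<in> U}"]) auto
qed

lemma znhd_abscon:
  assumes "znhd X W"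
  obtains V where "znhd X V" "abscon V" "V \<subseteq> W"
proof -
  obtain W' where W': "openin X W'" "0 \<in> W'" "W' \<subseteq> W"
    using assms unfolding znhd_def by blast
  have "neighbourhood_base_of convex X"
    using lc by (simp add: locally_convex_topology_def)
  then have "\<exists>U C. openin X U \<and> convex C \<and> 0 \<in> U \<and> U \<subseteq> C \<and> C \<subseteq> W'"
    unfolding neighbourhood_base_of using W'(1,2) by (elim allE[of _ W'] allE[of _ 0]) simp
  then obtain U C where UC: "openin X U" "convex C" "0 \<in> U" "U \<subseteq> C" "C \<subseteq> W'"
    by blast
  have C: "znhd X C" unfolding znhd_def using UC by blast
  define V where "V = C \<inter> (*\<^sub>R) (-1) ` C"
  have "znhd X ((*\<^sub>R) (-1) ` C)" by (rule znhd_scaled[OF C]) simp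
  then have V: "znhd X V" unfolding V_def using C by (rule znhd_Int[rotated])
  have cv: "convex V" unfolding V_def by (intro convex_Int convex_scaling UC)
  have "- x \<in> V" if "x \<in> V" for x
    using that by (auto simp: V_def image_iff)
  then have "abscon V" using cv znhd_0[OF V] by (simp add: abscon_def)
  moreover have "V \<subseteq> W" using UC W' by (auto simp: V_def)
  ultimately show thesis
    using that V by blast
qed

lemma znhd_half:
  assumes "znhd X W"
  obtains V where "znhd X V" "abscon V" "V \<subseteq> W" "\<And>x y. x \<in> V \<Longrightarrow> y \<in> V \<Longrightarrow> x + y \<in> W"
proof -
  obtain V where V: "znhd X V" "abscon V" "V \<subseteq> W"
    using znhd_abscon[OF assms] by blast
  let ?H = "(*\<^sub>R) (1/2) ` V"
  have 1: "?H \<subseteq> W"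
    using V(3) abscon_scale[OF V(2), of _ "1/2"] by auto
  have 2: "x + y \<in> W" if "x \<in> ?H" "y \<in> ?H" for x y
  proof -
    from that obtain a b where "a \<in> V" "b \<in> V" "x = (1/2) *\<^sub>R a" "y = (1/2) *\<^sub>R b" by blast
    then show ?thesis using abscon_combine[OF V(2), of a b "1/2" "1/2"] V(3) by auto
  qed
  show thesis
    by (rule that[OF znhd_scaled[OF V(1)] abscon_scaled[OF V(2)] 1 2]) auto
qed

lemma limitin_iff_znhd:
  "limitin X s l F \<longleftrightarrow> (\<forall>V. znhd X V \<longrightarrow> (\<forall>\<^sub>F n in F. s n - l \<in> V))"
proof
  assume L: "limitin X s l F"
  show "\<forall>V. znhd X V \<longrightarrow> (\<forall>\<^sub>F n in F. s n - l \<in> V)"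
  proof clarify
    fix V assume "znhd X V"
    then obtain U where U: "openin X U" "0 \<in> U" "U \<subseteq> V" unfolding znhd_def by blast
    have "\<forall>\<^sub>F n in F. s n \<in> {x. x - l \<in> U}"
      using limitinD[OF L open_translate[OF U(1), of l]] U(2) by simp
    then show "\<forall>\<^sub>F n in F. s n - l \<in> V"
      by eventually_elim (use U in auto)
  qed
next
  assume R: "\<forall>V. znhd X V \<longrightarrow> (\<forall>\<^sub>F n in F. s n - l \<in> V)"
  show "limitin X s l F"
    unfolding limitin_def
  proof (intro conjI allI impI)
    fix U assume "openin X U \<and> l \<in> U"
    then have "\<forall>\<^sub>F n in F. s n - l \<in> {y. l + y \<in> U}"
      using R znhd_iff_open by blast
    then show "\<forall>\<^sub>F n in F. s n \<in> U"
      by eventually_elim auto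
  qed simp
qed

lemma lim_add:
  assumes "limitin X s l F" "limitin X t m F"
  shows "limitin X (\<lambda>n. s n + t n) (l + m) F"
  unfolding limitin_iff_znhd
proof clarify
  fix W assume "znhd X W"
  then obtain V where V: "znhd X V" "\<And>x y. x \<in> V \<Longrightarrow> y \<in> V \<Longrightarrow> x + y \<in> W"
    using znhd_half by metis
  have "\<forall>\<^sub>F n in F. s n - l \<in> V" "\<forall>\<^sub>F n in F. t n - m \<in> V"
    using assms V(1) by (auto simp: limitin_iff_znhd)
  then show "\<forall>\<^sub>F n in F. s n + t n - (l + m) \<in> W"
  proof eventually_elim
    case (elim n)
    from V(2)[OF this] show ?case by (simp add: algebra_simps)
  qed
qed

lemma lim_scale:
  assumes "(c \<longlongrightarrow> d) F" "limitin X t m F"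
  shows "limitin X (\<lambda>n. c n *\<^sub>R t n) (d *\<^sub>R m) F"
proof -
  have "limitin (prod_topology euclideanreal X) (\<lambda>n. (c n, t n)) (d, m) F"
    using assms by (simp add: limitin_pairwise o_def)
  from continuous_map_limit[OF _ this, of X "\<lambda>(x, y). x *\<^sub>R y"]
  show ?thesis using lc by (simp add: locally_convex_topology_def o_def)
qed

lemma lim_minus: "limitin X t m F \<Longrightarrow> limitin X (\<lambda>n. - t n) (- m) F"
  using lim_scale[of "\<lambda>_. -1" "-1" F t m] by simp

lemma lim_diff:
  assumes "limitin X s l F" "limitin X t m F"
  shows "limitin X (\<lambda>n. s n - t n) (l - m) F"
  using lim_add[OF assms(1) lim_minus[OF assms(2)]] by simp

lemma lim_sum:
  assumes "finite I" "\<And>i. i \<in> I \<Longrightarrow> limitin X (s i) (l i) F"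
  shows "limitin X (\<lambda>n. \<Sum>i\<in>I. s i n) (\<Sum>i\<in>I. l i) F"
  using assms
proof (induction I rule: finite_induct)
  case empty
  then show ?case by simp
next
  case (insert i I)
  then show ?case by (simp add: lim_add)
qed

lemma lim_unique:
  assumes "limitin X s l F" "limitin X s m F" "F \<noteq> bot"
  shows "l = m"
  using limitin_Hausdorff_unique[OF assms(1,2)] assms(3) haus by simp

lemma closure_iff_znhd:
  "x \<in> X closure_of S \<longleftrightarrow> (\<forall>V. znhd X V \<longrightarrow> (\<exists>s\<in>S. s - x \<in> V))"
proof
  assume L: "x \<in> X closure_of S"
  show "\<forall>V. znhd X V \<longrightarrow> (\<exists>s\<in>S. s - x \<in> V)"
  proof clarify
    fix V assume "znhd X V"
    then obtain U where U: "openin X U" "0 \<in> U" "U \<subseteq> V" unfolding znhd_def by blast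
    have "x \<in> {y. y - x \<in> U} \<and> openin X {y. y - x \<in> U}"
      using open_translate[OF U(1), of x] U by simp
    moreover have "\<forall>T. x \<in> T \<and> openin X T \<longrightarrow> (\<exists>y. y \<in> S \<and> y \<in> T)"
      using L unfolding in_closure_of by simp
    ultimately obtain s where "s \<in> S" "s \<in> {y. y - x \<in> U}"
      by (elim allE[of _ "{y. y - x \<in> U}"]) auto
    then have "s \<in> S" "s - x \<in> U" by auto
    then show "\<exists>s\<in>S. s - x \<in> V" using U by blast
  qed
next
  assume R: "\<forall>V. znhd X V \<longrightarrow> (\<exists>s\<in>S. s - x \<in> V)"
  show "x \<in> X closure_of S"
    unfolding in_closure_of
  proof (intro conjI allI impI)
    fix U assume "x \<in> U \<and> openin X U"
    then have "znhd X {y. x + y \<in> U}" using znhd_iff_open by simp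
    with R obtain s where "s \<in> S" "s - x \<in> {y. x + y \<in> U}" by meson
    then show "\<exists>y. y \<in> S \<and> y \<in> U" by auto
  qed simp
qed

lemma abscon_closure:
  assumes "abscon V"
  shows "abscon (X closure_of V)"
  unfolding abscon_def
proof (intro conjI ballI)
  let ?C = "X closure_of V"
  show "convex ?C"
    unfolding convex_alt
  proof (intro ballI allI impI)
    fix x y :: 'a and u :: real
    assume x: "x \<in> ?C" and y: "y \<in> ?C" and u: "0 \<le> u \<and> u \<le> 1"
    show "(1 - u) *\<^sub>R x + u *\<^sub>R y \<in> ?C"
      unfolding closure_iff_znhd
    proof clarify
      fix T assume "znhd X T"
      then obtain T' where T': "znhd X T'" "abscon T'" "T' \<subseteq> T" by (rule znhd_abscon)
      obtain s t where st: "s \<in> V" "t \<in> V" "s - x \<in> T'" "t - y \<in> T'"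
        using x y T'(1) closure_iff_znhd by meson
      have "(1 - u) *\<^sub>R s + u *\<^sub>R t \<in> V"
        using abscon_convex[OF assms] st u unfolding convex_alt by blast
      moreover have "(1 - u) *\<^sub>R (s - x) + u *\<^sub>R (t - y) \<in> T'"
        using abscon_convex[OF T'(2)] st u unfolding convex_alt by blast
      then have "((1 - u) *\<^sub>R s + u *\<^sub>R t) - ((1 - u) *\<^sub>R x + u *\<^sub>R y) \<in> T"
        using T'(3) by (auto simp: algebra_simps)
      ultimately show "\<exists>s\<in>V. s - ((1 - u) *\<^sub>R x + u *\<^sub>R y) \<in> T" by blast
    qed
  qed
  show "0 \<in> ?C" using closure_of_subset[of V X] assms abscon_0 by auto
next
  fix x assume x: "x \<in> X closure_of V"
  show "- x \<in> X closure_of V"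
    unfolding closure_iff_znhd
  proof clarify
    fix T assume "znhd X T"
    then obtain T' where T': "znhd X T'" "abscon T'" "T' \<subseteq> T" by (rule znhd_abscon)
    obtain s where st: "s \<in> V" "s - x \<in> T'"
      using x T'(1) closure_iff_znhd by meson
    then have "- s \<in> V" "- (s - x) \<in> T'"
      using assms T'(2) abscon_minus by blast+
    then show "\<exists>s\<in>V. s - - x \<in> T" using T'(3) by (intro bexI[of _ "- s"]) auto
  qed
qed

text \<open>The closure of V lies in V + V, which \<open>znhd_half\<close> keeps inside W.\<close>

lemma znhd_closed:
  assumes "znhd X W"
  obtains V where "znhd X V" "abscon V" "V \<subseteq> W" "closedin X V"
proof -
  obtain V where V: "znhd X V" "abscon V" "V \<subseteq> W" "\<And>x y. x \<in> V \<Longrightarrow> y \<in> V \<Longrightarrow> x + y \<in> W"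
    using znhd_half[OF assms] by metis
  let ?C = "X closure_of V"
  have sub: "V \<subseteq> ?C" using closure_of_subset[of V X] by simp
  have "?C \<subseteq> W"
  proof
    fix x assume "x \<in> ?C"
    then obtain s where s: "s \<in> V" "s - x \<in> V" using V(1) closure_iff_znhd by blast
    then have "s + (- (s - x)) \<in> W" using V by (meson abscon_minus)
    then show "x \<in> W" by simp
  qed
  moreover have "abscon ?C" by (rule abscon_closure[OF V(2)])
  ultimately show thesis
    using that[of ?C] V(1) sub by (auto intro: znhd_mono)
qed

lemma znhd_absorb:
  assumes "znhd X V"
  obtains e where "e > 0" "\<And>c. \<bar>c\<bar> \<le> e \<Longrightarrow> c *\<^sub>R x \<in> V"
proof -
  obtain W where W: "znhd X W" "abscon W" "W \<subseteq> V" using assms by (rule znhd_abscon)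
  have "limitin X (\<lambda>n. inverse (real (Suc n)) *\<^sub>R x) (0 *\<^sub>R x) sequentially"
    by (rule lim_scale[OF LIMSEQ_inverse_real_of_nat]) simp
  then have "\<forall>\<^sub>F n in sequentially. inverse (real (Suc n)) *\<^sub>R x \<in> W"
    using W(1) by (auto simp: limitin_iff_znhd)
  then obtain n where n: "inverse (real (Suc n)) *\<^sub>R x \<in> W"
    by (auto simp: eventually_sequentially)
  show thesis
  proof (rule that[of "inverse (real (Suc n))"])
    fix c :: real assume c: "\<bar>c\<bar> \<le> inverse (real (Suc n))"
    then have "\<bar>c * real (Suc n)\<bar> \<le> 1"
      unfolding abs_mult by (simp add: field_simps del: of_nat_Suc)
    from abscon_scale[OF W(2) n this] have "c *\<^sub>R x \<in> W"
      by (simp add: field_simps del: of_nat_Suc)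
    then show "c *\<^sub>R x \<in> V" using W(3) by auto
  qed simp
qed

lemma zero_separated:
  assumes "closedin X C" "0 \<notin> C"
  obtains V where "znhd X V" "abscon V" "closedin X V" "V \<inter> C = {}"
proof -
  have "openin X (UNIV - C)"
    using openin_diff[OF openin_topspace assms(1)] by simp
  then have "znhd X (UNIV - C)"
    unfolding znhd_def using assms(2) by blast
  then obtain V where V: "znhd X V" "abscon V" "V \<subseteq> UNIV - C" "closedin X V"
    by (rule znhd_closed)
  then have "V \<inter> C = {}" by blast
  with V show thesis
    using that[of V] by blast
qed

lemma compact_closed: "compactin X K \<Longrightarrow> closedin X K"
  by (rule compactin_imp_closedin[OF haus])

lemma open_subspace_UNIV:
  assumes "subspace L" "openin X L"
  shows "L = UNIV"
proof -
  have "znhd X L"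
    unfolding znhd_def using assms subspace_0[OF assms(1)] by (intro exI[of _ L]) simp
  have "x \<in> L" for x
  proof -
    obtain e where "e > 0" "\<And>c. \<bar>c\<bar> \<le> e \<Longrightarrow> c *\<^sub>R x \<in> L"
      using znhd_absorb[OF \<open>znhd X L\<close>] by blast
    then have e: "e *\<^sub>R x \<in> L" "e \<noteq> 0" by auto
    from subspace_scale[OF assms(1) e(1), of "1/e"] e(2) show "x \<in> L" by simp
  qed
  then show ?thesis by auto
qed

lemma cont_at_iff: "continuous_map Y X f \<longleftrightarrow>
  (\<forall>y\<in>topspace Y. \<forall>V. znhd X V \<longrightarrow> (\<exists>U. openin Y U \<and> y \<in> U \<and> (\<forall>z\<in>U. f z - f y \<in> V)))"
proof (intro iffI ballI allI impI)
  fix y V assume C: "continuous_map Y X f" and y: "y \<in> topspace Y" and "znhd X V"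
  then obtain U where U: "openin X U" "0 \<in> U" "U \<subseteq> V" unfolding znhd_def by blast
  from openin_continuous_map_preimage[OF C open_translate[OF U(1), of "f y"]]
  show "\<exists>U. openin Y U \<and> y \<in> U \<and> (\<forall>z\<in>U. f z - f y \<in> V)"
    using U y by (intro exI[of _ "{z \<in> topspace Y. f z - f y \<in> U}"]) auto
next
  assume R: "\<forall>y\<in>topspace Y. \<forall>V. znhd X V \<longrightarrow> (\<exists>U. openin Y U \<and> y \<in> U \<and> (\<forall>z\<in>U. f z - f y \<in> V))"
  show "continuous_map Y X f"
    unfolding continuous_map_def
  proof (intro conjI allI impI)
    fix U assume U: "openin X U"
    show "openin Y {x \<in> topspace Y. f x \<in> U}"
    proof (subst openin_subopen, clarify)
      fix y assume y: "y \<in> topspace Y" "f y \<in> U"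
      then obtain T where T: "openin Y T" "y \<in> T" "\<forall>z\<in>T. f z - f y \<in> {v. f y + v \<in> U}"
        using R znhd_iff_open[OF U y(2)] by meson
      then show "\<exists>T. openin Y T \<and> y \<in> T \<and> T \<subseteq> {x \<in> topspace Y. f x \<in> U}"
        using openin_subset[OF T(1)] by (intro exI[of _ T]) auto
    qed
  qed simp
qed

end

section \<open>Gauges and invariant metrics\<close>

text \<open>The Minkowski gauge of V.\<close>

definition mgauge :: "'a::real_vector set \<Rightarrow> 'a \<Rightarrow> real" where
  "mgauge V x = Inf {t. t > 0 \<and> (1/t) *\<^sub>R x \<in> V}"

text \<open>The identity from K to the metric space is a continuous bijection from a compact space
  onto a Hausdorff space. So a metric with open balls yields the topology of compact sets even when
  it does not yield that of X.\<close>

lemma subtopology_compact_metric: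
  assumes d: "Metric_space UNIV d" and op: "\<And>x e. openin X {y \<in> topspace X. d x y < e}"
    and K: "compactin X K"
  shows "subtopology X K = Metric_space.mtopology K d"
proof -
  interpret U: Metric_space UNIV d by (rule d)
  interpret M: Metric_space K d by (rule U.subspace) simp
  have KX: "K \<subseteq> topspace X" using K by (rule compactin_subset_topspace)
  have "continuous_map (subtopology X K) M.mtopology id"
    unfolding continuous_map_def
  proof (intro conjI allI impI)
    fix U assume U: "openin M.mtopology U"
    have "openin (subtopology X K) U"
    proof (subst openin_subopen, clarify)
      fix x assume x: "x \<in> U"
      with U obtain r where r: "r > 0" "M.mball x r \<subseteq> U" unfolding M.openin_mtopology by blast
      have "x \<in> K" using x U M.openin_mtopology by blast
      then show "\<exists>T. openin (subtopology X K) T \<and> x \<in> T \<and> T \<subseteq> U"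
        using r KX op[of x r]
        by (intro exI[of _ "{y \<in> topspace X. d x y < r} \<inter> K"])
          (auto simp: openin_subtopology)
    qed
    moreover have "U \<subseteq> K" using U M.openin_mtopology by blast
    ultimately show "openin (subtopology X K) {x \<in> topspace (subtopology X K). id x \<in> U}"
      using KX by (simp add: Int_absorb1 Collect_conj_eq Int_absorb2)
  qed (use KX in auto)
  moreover have "compact_space (subtopology X K)"
    using K compact_space_subtopology by blast
  ultimately have "homeomorphic_map (subtopology X K) M.mtopology id"
    using KX by (intro continuous_imp_homeomorphic_map M.Hausdorff_space_mtopology) auto
  then show ?thesis by simp
qed

context lcs
begin

lemma mgauge_nonempty: "znhd X V \<Longrightarrow> {t. t > 0 \<and> (1/t) *\<^sub>R x \<in> V} \<noteq> {}"
proof -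
  assume "znhd X V"
  then obtain e where e: "e > 0" "\<And>c. \<bar>c\<bar> \<le> e \<Longrightarrow> c *\<^sub>R x \<in> V" by (rule znhd_absorb) blast
  have "1/e > 0" "(1/(1/e)) *\<^sub>R x \<in> V" using e(1) e(2)[of e] by auto
  then show ?thesis by blast
qed

lemma mgauge_bdd: "bdd_below {t::real. t > 0 \<and> (1/t) *\<^sub>R x \<in> V}"
  by (rule bdd_belowI[of _ 0]) auto

lemma mgauge_nonneg: "znhd X V \<Longrightarrow> 0 \<le> mgauge V x"
  unfolding mgauge_def by (rule cInf_greatest[OF mgauge_nonempty]) auto

lemma mgauge_le: "t > 0 \<Longrightarrow> (1/t) *\<^sub>R x \<in> V \<Longrightarrow> mgauge V x \<le> t"
  unfolding mgauge_def by (rule cInf_lower[OF _ mgauge_bdd]) auto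

lemma mgauge_less:
  assumes "znhd X V" "abscon V" "mgauge V x < t"
  shows "(1/t) *\<^sub>R x \<in> V"
proof -
  obtain s where s: "s > 0" "(1/s) *\<^sub>R x \<in> V" "s < t"
    using cInf_lessD[OF mgauge_nonempty[OF assms(1)] assms(3)[unfolded mgauge_def]] by blast
  from abscon_scale[OF assms(2) s(2), of "s/t"] s show ?thesis by simp
qed

lemma mgauge_triangle:
  assumes "znhd X V" "abscon V"
  shows "mgauge V (x + y) \<le> mgauge V x + mgauge V y"
proof (rule field_le_epsilon)
  fix e :: real assume e: "e > 0"
  define s where "s = mgauge V x + e/2"
  define t where "t = mgauge V y + e/2"
  have st: "s > 0" "t > 0" using e mgauge_nonneg[OF assms(1)] by (auto simp: s_def t_def add_nonneg_pos)
  have "(1/s) *\<^sub>R x \<in> V" "(1/t) *\<^sub>R y \<in> V"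
    using e by (auto intro!: mgauge_less[OF assms] simp: s_def t_def)
  then have "(s/(s+t)) *\<^sub>R ((1/s) *\<^sub>R x) + (t/(s+t)) *\<^sub>R ((1/t) *\<^sub>R y) \<in> V"
    by (rule abscon_combine[OF assms(2)]) (use st in \<open>simp add: add_divide_distrib[symmetric]\<close>)
  then have "(1/(s+t)) *\<^sub>R (x + y) \<in> V"
    using st by (simp add: scaleR_add_right)
  then have "mgauge V (x + y) \<le> s + t" using st by (intro mgauge_le) auto
  then show "mgauge V (x + y) \<le> mgauge V x + mgauge V y + e" by (simp add: s_def t_def)
qed

lemma mgauge_minus:
  assumes "abscon V"
  shows "mgauge V (- x) = mgauge V x"
proof -
  have "(1/t) *\<^sub>R (- x) \<in> V \<longleftrightarrow> (1/t) *\<^sub>R x \<in> V" for t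
    using abscon_minus[OF assms, of "(1/t) *\<^sub>R x"] abscon_minus[OF assms, of "(1/t) *\<^sub>R (- x)"] by auto
  then show ?thesis by (simp add: mgauge_def)
qed

lemma mgauge_0:
  assumes "abscon V" "znhd X V"
  shows "mgauge V 0 = 0"
proof (rule antisym)
  show "mgauge V 0 \<le> 0"
    by (rule field_le_epsilon) (use mgauge_le[of _ 0 V] abscon_0[OF assms(1)] in auto)
qed (rule mgauge_nonneg[OF assms(2)])

lemma znhd_finite_INT:
  assumes "\<And>m. m < (n::nat) \<Longrightarrow> znhd X (W m)"
  shows "znhd X (\<Inter>m<n. W m)"
  using assms
proof (induction n)
  case 0
  then show ?case by (simp add: znhd_UNIV)
next
  case (Suc n)
  then show ?case by (simp add: lessThan_Suc znhd_Int)
qed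

text \<open>D is the supremum of the gauges of the W m, the m-th one capped at
  \<open>(1/2)^m\<close>. The caps keep D finite and make \<open>D x < e\<close> depend on finitely
  many gauges only, so D-balls are neighbourhoods. The last conclusion recovers the topology when
  the W m form a base at 0; in general D is only a continuous metric.\<close>

lemma invariant_metric:
  fixes W :: "nat \<Rightarrow> 'a set"
  assumes W: "\<And>m. znhd X (W m)" "\<And>m. abscon (W m)" and I: "(\<Inter>m. W m) \<subseteq> {0}"
  obtains D where "D 0 = (0::real)" "\<And>x. D x = 0 \<Longrightarrow> x = 0" "\<And>x. 0 \<le> D x" "\<And>x. D (- x) = D x"
    "\<And>x y. D (x + y) \<le> D x + D y" "\<And>e. e > 0 \<Longrightarrow> znhd X {x. D x < e}"
    "\<And>m. \<exists>e>0. \<forall>x. D x < e \<longrightarrow> x \<in> W m"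
proof -
  define g where "g m x = min ((1/2)^m) (mgauge (W m) x)" for m x
  define D where "D x = (SUP m. g m x)" for x
  have g0: "0 \<le> g m x" for m x using mgauge_nonneg[OF W(1)] by (simp add: g_def)
  have "g m x \<le> 1" for m x by (simp add: g_def min.coboundedI1 power_le_one)
  then have bd: "bdd_above (range (\<lambda>m. g m x))" for x by (intro bdd_aboveI[of _ 1]) auto
  have up: "g m x \<le> D x" for m x unfolding D_def by (rule cSUP_upper[OF _ bd]) simp
  have D0: "0 \<le> D x" for x using g0[of 0 x] up[of 0 x] by linarith
  have lo: "D x \<le> c" if "\<And>m. g m x \<le> c" for x c
    unfolding D_def by (rule cSUP_least) (use that in auto)
  have inW: "x \<in> W m" if "D x < (1/2)^m" for x m
  proof -
    have "g m x < (1/2)^m" using up[of m x] that by linarith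
    then have "mgauge (W m) x < (1/2)^m" unfolding g_def by linarith
    also have "(1/2::real)^m \<le> 1" by (simp add: power_le_one)
    finally have "mgauge (W m) x < 1" .
    from mgauge_less[OF W(1,2) this] show ?thesis by simp
  qed
  show thesis
  proof (rule that[of D])
    show "D 0 = 0" using lo[of 0 0] D0[of 0] mgauge_0[OF W(2,1)] by (force simp: g_def)
    show "x = 0" if "D x = 0" for x
    proof -
      have "x \<in> W m" for m using inW[of x m] that by simp
      then show ?thesis using I by blast
    qed
    show "0 \<le> D x" for x by (rule D0)
    show "D (- x) = D x" for x by (simp add: D_def g_def mgauge_minus[OF W(2)])
    show "D (x + y) \<le> D x + D y" for x y
    proof (rule lo)
      fix m
      have "g m (x + y) \<le> g m x + g m y"
        using mgauge_triangle[OF W, of m x y] mgauge_nonneg[OF W(1), of m x] mgauge_nonneg[OF W(1), of m y] zero_le_power[of "1/2::real" m]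
        unfolding g_def by linarith
      then show "g m (x + y) \<le> D x + D y" using up[of m x] up[of m y] by linarith
    qed
    show "znhd X {x. D x < e}" if "e > 0" for e
    proof -
      have "0 < e/2" using that by simp
      then obtain N where N: "(1/2::real)^N < e/2" using real_arch_pow_inv[of "e/2" "1/2"] by auto
      have "znhd X (\<Inter>m<N. (*\<^sub>R) (e/2) ` W m)"
        using that by (intro znhd_finite_INT znhd_scaled W) auto
      moreover have "D x < e" if x: "x \<in> (\<Inter>m<N. (*\<^sub>R) (e/2) ` W m)" for x
      proof -
        have "g m x \<le> e/2" for m
        proof (cases "m < N")
          case True
          then obtain y where "y \<in> W m" "x = (e/2) *\<^sub>R y" using x by blast
          then have "mgauge (W m) x \<le> e/2" using \<open>e > 0\<close> by (intro mgauge_le) auto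
          then show ?thesis by (simp add: g_def)
        next
          case False
          then have "(1/2::real)^m \<le> (1/2)^N" by (intro power_decreasing) auto
          then show ?thesis using N unfolding g_def by linarith
        qed
        then have "D x \<le> e/2" by (rule lo)
        then show ?thesis using \<open>e > 0\<close> by simp
      qed
      ultimately show ?thesis by (auto intro: znhd_mono)
    qed
    show "\<exists>e>0. \<forall>x. D x < e \<longrightarrow> x \<in> W m" for m
      using inW by (intro exI[of _ "(1/2)^m"]) auto
  qed
qed

lemma norm_metric:
  assumes "D 0 = (0::real)" "\<And>x. D x = 0 \<Longrightarrow> x = 0" "\<And>x. 0 \<le> D x" "\<And>x::'a. D (- x) = D x"
    "\<And>x y. D (x + y) \<le> D x + D y"
  shows "Metric_space UNIV (\<lambda>x y. D (x - y))"
proof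
  fix x y z :: 'a
  show "0 \<le> D (x - y)" by fact
  show "D (x - y) = D (y - x)" using assms(4)[of "x - y"] by simp
  show "(D (x - y) = 0) = (x = y)" using assms(1) assms(2)[of "x - y"] by auto
  show "D (x - z) \<le> D (x - y) + D (y - z)" using assms(5)[of "x - y" "y - z"] by simp
qed

text \<open>By the last conclusion of \<open>invariant_metric\<close> every N m contains a D-ball,
  so here the D-topology is as fine as X.\<close>

lemma first_countable_imp_metrizable:
  fixes N :: "nat \<Rightarrow> 'a set"
  assumes N: "\<And>m. znhd X (N m)" and base: "\<And>V. znhd X V \<Longrightarrow> \<exists>m. N m \<subseteq> V"
  shows "metrizable_space X"
proof -
  have "\<exists>W. znhd X W \<and> abscon W \<and> W \<subseteq> N m" for m
    using znhd_abscon[OF N[of m]] by metis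
  then obtain W where W: "\<And>m. znhd X (W m)" "\<And>m. abscon (W m)" "\<And>m. W m \<subseteq> N m" by metis
  have "(\<Inter>m. W m) \<subseteq> {0}"
  proof
    fix x assume x: "x \<in> (\<Inter>m. W m)"
    show "x \<in> {0}"
    proof (rule ccontr)
      assume "x \<notin> {0}"
      moreover have "closedin X {x}" by (rule compact_closed) simp
      ultimately obtain V where "znhd X V" "V \<inter> {x} = {}" using zero_separated[of "{x}"] by auto
      then show False using base x W(3) by blast
    qed
  qed
  with W(1,2) obtain D where D: "D 0 = (0::real)" "\<And>x. D x = 0 \<Longrightarrow> x = 0" "\<And>x. 0 \<le> D x" "\<And>x. D (- x) = D x"
    "\<And>x y. D (x + y) \<le> D x + D y" "\<And>e. e > 0 \<Longrightarrow> znhd X {x. D x < e}"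
    "\<And>m. \<exists>e>0. \<forall>x. D x < e \<longrightarrow> x \<in> W m"
    by (rule invariant_metric) blast
  interpret M: Metric_space UNIV "\<lambda>x y. D (x - y)" by (rule norm_metric) (use D in auto)
  have "openin X U \<longleftrightarrow> openin M.mtopology U" for U
    unfolding openin_iff_znhd M.openin_mtopology
  proof (intro iffI conjI allI impI ballI)
    fix x assume L: "\<forall>x\<in>U. znhd X {y. x + y \<in> U}" and "x \<in> U"
    then have "znhd X {y. x + y \<in> U}" by blast
    then obtain m where m: "N m \<subseteq> {y. x + y \<in> U}" using base by blast
    obtain e where e: "e > 0" "\<forall>x. D x < e \<longrightarrow> x \<in> W m" using D(7) by blast
    have "M.mball x e \<subseteq> U"
    proof
      fix y assume "y \<in> M.mball x e"
      then have "D (x - y) < e" by simp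
      then have "D (y - x) < e" using D(4)[of "x - y"] by simp
      then have "y - x \<in> N m" using e W(3) by blast
      then have "x + (y - x) \<in> U" using m by blast
      then show "y \<in> U" by simp
    qed
    then show "\<exists>r>0. M.mball x r \<subseteq> U" using e(1) by blast
  next
    fix x assume R: "U \<subseteq> UNIV \<and> (\<forall>x. x \<in> U \<longrightarrow> (\<exists>r>0. M.mball x r \<subseteq> U))" and "x \<in> U"
    then obtain r where r: "r > 0" "M.mball x r \<subseteq> U" by blast
    have "{y. D y < r} \<subseteq> {y. x + y \<in> U}"
    proof clarify
      fix y assume "D y < r"
      then have "x + y \<in> M.mball x r" using D(4)[of y] by simp
      then show "x + y \<in> U" using r by blast
    qed
    then show "znhd X {y. x + y \<in> U}" using D(6)[OF r(1)] by (rule znhd_mono[rotated])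
  qed simp
  then have "X = M.mtopology" by (simp add: topology_eq)
  then show ?thesis using M.metrizable_space_mtopology by simp
qed

section \<open>Compact sets in locally convex spaces\<close>

lemma compact_bounded:
  assumes K: "compactin X K" and V: "znhd X V"
  obtains t where "t \<ge> 1" "\<And>s. s \<ge> t \<Longrightarrow> K \<subseteq> (*\<^sub>R) s ` V"
proof -
  obtain V' where V': "znhd X V'" "abscon V'" "V' \<subseteq> V" using V by (rule znhd_abscon)
  obtain U where U: "openin X U" "0 \<in> U" "U \<subseteq> V'" using V'(1) unfolding znhd_def by blast
  define O' where "O' n = {x. (1/real (Suc n)) *\<^sub>R x \<in> U}" for n
  have O: "openin X (O' n)" for n
  proof -
    have "continuous_map X X (\<lambda>x. (1/real (Suc n)) *\<^sub>R x)"
      by (intro cont_scale_const) auto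
    from openin_continuous_map_preimage[OF this U(1)] show ?thesis by (simp add: O'_def)
  qed
  have "x \<in> (\<Union>n. O' n)" for x
  proof -
    have "limitin X (\<lambda>n. inverse (real (Suc n)) *\<^sub>R x) (0 *\<^sub>R x) sequentially"
      by (rule lim_scale[OF LIMSEQ_inverse_real_of_nat]) simp
    then have "\<forall>\<^sub>F n in sequentially. inverse (real (Suc n)) *\<^sub>R x \<in> U"
      using U by (auto simp: limitin_def)
    then obtain n where n: "inverse (real (Suc n)) *\<^sub>R x \<in> U"
      by (auto simp: eventually_sequentially)
    then show ?thesis by (auto simp: O'_def inverse_eq_divide)
  qed
  then have "\<exists>F. finite F \<and> F \<subseteq> range O' \<and> K \<subseteq> \<Union>F"
    using K O unfolding compactin_def by (elim conjE allE[of _ "range O'"]) blast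
  then obtain F where F: "finite F" "F \<subseteq> range O'" "K \<subseteq> \<Union>F" by blast
  from finite_subset_image[OF F(1,2)] obtain I where I: "finite I" "F = O' ` I" by blast
  define N where "N = Max (insert 0 I)"
  show thesis
  proof (rule that[of "real (Suc N)"])
    fix s assume s: "s \<ge> real (Suc N)"
    show "K \<subseteq> (*\<^sub>R) s ` V"
    proof
      fix x assume "x \<in> K"
      then obtain n where n: "n \<in> I" "x \<in> O' n" using F I by blast
      then have "n \<le> N" using I(1) by (simp add: N_def)
      have 1: "(1/real (Suc n)) *\<^sub>R x \<in> V'" using n U by (auto simp: O'_def)
      have ns: "real (Suc n) \<le> s" "0 < s" using s \<open>n \<le> N\<close> by auto
      have "(real (Suc n) / s) *\<^sub>R ((1/real (Suc n)) *\<^sub>R x) \<in> V'"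
        by (rule abscon_scale[OF V'(2) 1]) (use ns in auto)
      then have "(1/s) *\<^sub>R x \<in> V" using V'(3) by (auto simp del: of_nat_Suc)
      then show "x \<in> (*\<^sub>R) s ` V" using ns by (intro image_eqI[of _ _ "(1/s) *\<^sub>R x"]) auto
    qed
  qed simp
qed

text \<open>A compact neighbourhood is bounded, so its multiples by 1/(m+1) form a countable base at
  0.\<close>

lemma compact_nhd_metrizable:
  assumes L: "compactin X L" "znhd X L"
  shows "metrizable_space X"
proof (rule first_countable_imp_metrizable)
  show "znhd X ((*\<^sub>R) (1/real (Suc m)) ` L)" for m
    by (rule znhd_scaled[OF L(2)]) simp
  fix V assume "znhd X V"
  from compact_bounded[OF L(1) this] obtain t where t: "t \<ge> 1" "\<And>s. s \<ge> t \<Longrightarrow> L \<subseteq> (*\<^sub>R) s ` V" by blast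
  obtain m where m: "t \<le> real m" using real_arch_simple by blast
  then have "L \<subseteq> (*\<^sub>R) (real (Suc m)) ` V" by (intro t) simp
  then have "(*\<^sub>R) (1/real (Suc m)) ` L \<subseteq> V" by (auto simp del: of_nat_Suc)
  then show "\<exists>m. (*\<^sub>R) (1/real (Suc m)) ` L \<subseteq> V" by blast
qed

lemma compact_image2:
  assumes "compactin Y K" "compactin X L" "continuous_map (prod_topology Y X) X (\<lambda>p. f (fst p) (snd p))"
  shows "compactin X {f x y |x y. x \<in> K \<and> y \<in> L}"
proof -
  have "compactin (prod_topology Y X) (K \<times> L)" using assms by (simp add: compactin_Times)
  from image_compactin[OF this assms(3)]
  have "compactin X ((\<lambda>p. f (fst p) (snd p)) ` (K \<times> L))" .
  moreover have "(\<lambda>p. f (fst p) (snd p)) ` (K \<times> L) = {f x y |x y. x \<in> K \<and> y \<in> L}" by force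
  ultimately show ?thesis by simp
qed

lemma compact_plus:
  "compactin X K \<Longrightarrow> compactin X L \<Longrightarrow> compactin X {x + y |x y. x \<in> K \<and> y \<in> L}"
  by (rule compact_image2) (auto intro!: cont_add continuous_map_fst continuous_map_snd)

lemma compact_minus:
  "compactin X K \<Longrightarrow> compactin X L \<Longrightarrow> compactin X {x - y |x y. x \<in> K \<and> y \<in> L}"
  by (rule compact_image2) (auto intro!: cont_diff continuous_map_fst continuous_map_snd)

lemma compact_scaleset:
  "compactin X L \<Longrightarrow> compactin X {c *\<^sub>R y |c y. c \<in> {a..b::real} \<and> y \<in> L}"
  by (rule compact_image2[where Y=euclideanreal]) (auto intro!: cont_scale continuous_map_fst continuous_map_snd)

lemma compact_scaled: "compactin X K \<Longrightarrow> compactin X ((*\<^sub>R) c ` K)"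
  by (rule image_compactin) (auto intro: cont_scale_const)

lemma compact_lim_seq:
  assumes "limitin X s l sequentially"
  shows "compactin X (insert l (range s))"
  by (rule compactin_sequence_with_limit[OF assms]) auto

end

section \<open>Back and forth between towers of compact sets\<close>

text \<open>A k-omega decomposition of a Hausdorff space.\<close>

definition tower :: "'a topology \<Rightarrow> (nat \<Rightarrow> 'a set) \<Rightarrow> bool" where
  "tower X K \<longleftrightarrow> Hausdorff_space X \<and> incseq K \<and> (\<forall>n. compactin X (K n)) \<and> (\<Union>n. K n) = topspace X \<and>
     (\<forall>C. C \<subseteq> topspace X \<and> (\<forall>n. closedin X (C \<inter> K n)) \<longrightarrow> closedin X C)"

text \<open>On a compact set a continuous injection into a Hausdorff space is an embedding, so the
  inverse is not mentioned. B is nonempty because the constructions measure distances to B.\<close>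

definition embeddings_extend :: "'b topology \<Rightarrow> 'a topology \<Rightarrow> bool" where
  "embeddings_extend Y X \<longleftrightarrow> (\<forall>B C g. compactin Y C \<and> closedin Y B \<and> B \<subseteq> C \<and> B \<noteq> {} \<and>
      continuous_map (subtopology Y B) X g \<and> inj_on g B \<longrightarrow>
      (\<exists>h. continuous_map (subtopology Y C) X h \<and> inj_on h C \<and> (\<forall>b\<in>B. h b = g b)))"

text \<open>This allows the two spaces to exchange roles during the back-and-forth.\<close>

lemma compact_inverse:
  assumes C: "compactin X C" and h: "continuous_map (subtopology X C) Y h" "inj_on h C"
    and Y: "Hausdorff_space Y"
  shows "compactin Y (h ` C)" "continuous_map (subtopology Y (h ` C)) X (inv_into C h)"
proof -
  have CX: "C \<subseteq> topspace X" using C by (rule compactin_subset_topspace)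
  have tC: "topspace (subtopology X C) = C" using CX by auto
  have cC: "compactin (subtopology X C) C" using C by (simp add: compactin_subtopology)
  show 1: "compactin Y (h ` C)" by (rule image_compactin[OF cC h(1)])
  then have tD: "topspace (subtopology Y (h ` C)) = h ` C"
    using compactin_subset_topspace by fastforce
  have "homeomorphic_map (subtopology X C) (subtopology Y (h ` C)) h"
  proof (rule continuous_imp_homeomorphic_map)
    show "compact_space (subtopology X C)" using C compact_space_subtopology by blast
    show "Hausdorff_space (subtopology Y (h ` C))" by (rule Hausdorff_space_subtopology[OF Y])
    show "continuous_map (subtopology X C) (subtopology Y (h ` C)) h"
      by (rule continuous_map_into_subtopology[OF h(1)]) (use tC in auto)
  qed (use tC tD h(2) in auto)
  then obtain g where g: "homeomorphic_maps (subtopology X C) (subtopology Y (h ` C)) h g"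
    using homeomorphic_map_maps by blast
  then have "continuous_map (subtopology Y (h ` C)) X g"
    unfolding homeomorphic_maps_def using continuous_map_in_subtopology by blast
  moreover have "g y = inv_into C h y" if "y \<in> h ` C" for y
    using that g h(2) tC unfolding homeomorphic_maps_def by auto
  ultimately show "continuous_map (subtopology Y (h ` C)) X (inv_into C h)"
    using tD by (auto intro: continuous_map_eq)
qed

text \<open>A state is a compact set of X with an embedding into Y. One step extends the embedding
  over K n, extends the inverse of the result over L n, and inverts again. The union of the stages
  is a bijection, and the two towers turn continuity and closedness on compact pieces into global
  ones.\<close>

theorem back_and_forth:
  assumes X: "tower X K" and Y: "tower Y L"
    and eXY: "embeddings_extend X Y" and eYX: "embeddings_extend Y X"
    and ne: "topspace X \<noteq> {}" "topspace Y \<noteq> {}"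
  shows "X homeomorphic_space Y"
proof -
  have hX: "Hausdorff_space X" and hY: "Hausdorff_space Y" using X Y by (auto simp: tower_def)
  have KX: "compactin X (K n)" and LY: "compactin Y (L n)" for n using X Y by (auto simp: tower_def)
  define good where "good s \<longleftrightarrow> compactin X (fst s) \<and> fst s \<noteq> {} \<and>
     continuous_map (subtopology X (fst s)) Y (snd s) \<and> inj_on (snd s) (fst s)" for s :: "'a set \<times> ('a \<Rightarrow> 'b)"
  define nxt where "nxt n s s' \<longleftrightarrow> fst s \<union> K n \<subseteq> fst s' \<and> L n \<subseteq> snd s' ` fst s' \<and>
     (\<forall>x\<in>fst s. snd s' x = snd s x)" for n and s s' :: "'a set \<times> ('a \<Rightarrow> 'b)"
  \<comment> \<open>A one-point state, since \<open>embeddings_extend\<close> does not apply to the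
    empty set.\<close>
  have start: "\<exists>s. good s"
  proof -
    obtain x y where "x \<in> topspace X" "y \<in> topspace Y" using ne by blast
    then have "good ({x}, \<lambda>_. y)" by (simp add: good_def)
    then show ?thesis by blast
  qed
  have step: "\<exists>s'. good s' \<and> nxt n s s'" if s: "good s" for n s
  proof -
    obtain C h where sC: "s = (C, h)" by (cases s)
    have C: "compactin X C" "C \<noteq> {}" "continuous_map (subtopology X C) Y h" "inj_on h C"
      using s by (auto simp: good_def sC)
    define C1 where "C1 = C \<union> K n"
    have C1: "compactin X C1" unfolding C1_def using C(1) KX by (rule compactin_Un)
    have "closedin X C" using compactin_imp_closedin[OF hX C(1)] .
    with eXY C C1 obtain h1 where h1: "continuous_map (subtopology X C1) Y h1" "inj_on h1 C1"
      "\<forall>x\<in>C. h1 x = h x"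
      unfolding embeddings_extend_def C1_def by (metis Un_upper1)
    note D1 = compact_inverse[OF C1 h1(1,2) hY]
    define D2 where "D2 = h1 ` C1 \<union> L n"
    have D2: "compactin Y D2" unfolding D2_def using D1(1) LY by (rule compactin_Un)
    have "closedin Y (h1 ` C1)" using compactin_imp_closedin[OF hY D1(1)] .
    moreover have "h1 ` C1 \<noteq> {}" using C(2) by (auto simp: C1_def)
    moreover have "inj_on (inv_into C1 h1) (h1 ` C1)" by (rule inj_on_inv_into) simp
    ultimately obtain g where g: "continuous_map (subtopology Y D2) X g" "inj_on g D2"
      "\<forall>y\<in>h1 ` C1. g y = inv_into C1 h1 y"
      using eYX D1 D2 unfolding embeddings_extend_def D2_def by (metis Un_upper1)
    note E = compact_inverse[OF D2 g(1,2) hX]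
    have sub: "C1 \<subseteq> g ` D2"
    proof
      fix x assume "x \<in> C1"
      then have "x = g (h1 x)" "h1 x \<in> D2" using g(3) h1(2) by (auto simp: D2_def)
      then show "x \<in> g ` D2" by blast
    qed
    have ext: "inv_into D2 g x = h x" if "x \<in> C" for x
    proof -
      have "x = g (h1 x)" "h1 x \<in> D2" using that g(3) h1(2) by (auto simp: D2_def C1_def)
      then have "inv_into D2 g x = h1 x" using g(2) by (metis inv_into_f_f)
      then show ?thesis using h1(3) that by simp
    qed
    have "good (g ` D2, inv_into D2 g)"
      unfolding good_def using E sub C(2) C1_def inj_on_inv_into[of "g ` D2" g D2] by auto
    moreover have "nxt n s (g ` D2, inv_into D2 g)"
      unfolding nxt_def sC using sub ext g(2) by (auto simp: C1_def D2_def image_image)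
    ultimately show ?thesis by blast
  qed
  obtain S where S: "\<And>n. good (S n)" "\<And>n. nxt n (S n) (S (Suc n))"
    using dependent_nat_choice[of "\<lambda>_ s. good s" "\<lambda>n s s'. nxt n s s'"] start step by metis
  define C where "C n = fst (S n)" for n
  define h where "h n = snd (S n)" for n
  have C: "compactin X (C n)" "continuous_map (subtopology X (C n)) Y (h n)" "inj_on (h n) (C n)" for n
    using S(1)[of n] by (auto simp: good_def C_def h_def)
  have CS: "C n \<subseteq> C (Suc n)" "K n \<subseteq> C (Suc n)" "L n \<subseteq> h (Suc n) ` C (Suc n)"
    "\<And>x. x \<in> C n \<Longrightarrow> h (Suc n) x = h n x" for n
    using S(2)[of n] by (auto simp: nxt_def C_def h_def)
  have mono: "C n \<subseteq> C m" if "n \<le> m" for n m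
    using that by (rule lift_Suc_mono_le[of C, OF CS(1)])
  have heq: "h m x = h n x" if "n \<le> m" "x \<in> C n" for n m x
    using that(1)
  proof (induction m rule: dec_induct)
    case (step m)
    then have "x \<in> C m" using mono that(2) by blast
    then show ?case using CS(4) step by simp
  qed simp
  have CX: "C n \<subseteq> topspace X" for n using C(1) by (rule compactin_subset_topspace)
  have tC: "topspace (subtopology X (C n)) = C n" for n using CX by auto
  have cov: "(\<Union>n. C n) = topspace X"
  proof
    show "topspace X \<subseteq> (\<Union>n. C n)" using CS(2) X unfolding tower_def by blast
  qed (use CX in blast)
  define H where "H x = h (LEAST n. x \<in> C n) x" for x
  have H: "H x = h n x" if "x \<in> C n" for n x
    unfolding H_def using heq[OF Least_le[of "\<lambda>n. x \<in> C n"], of n] that LeastI[of "\<lambda>n. x \<in> C n"] by simp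
  have HY: "h n ` C n \<subseteq> topspace Y" for n
    using continuous_map_image_subset_topspace[OF C(2)] tC by simp
  have inj: "inj_on H (topspace X)"
  proof (rule inj_onI)
    fix x y assume "x \<in> topspace X" "y \<in> topspace X" and eq: "H x = H y"
    then obtain n m where nm: "x \<in> C n" "y \<in> C m" using cov by blast
    then have "x \<in> C (max n m)" "y \<in> C (max n m)" using mono[of n "max n m"] mono[of m "max n m"] by auto
    then show "x = y" using eq H C(3) by (metis inj_onD)
  qed
  have img: "H ` topspace X = topspace Y"
  proof
    show "H ` topspace X \<subseteq> topspace Y"
      unfolding cov[symmetric] using HY H by fastforce
    show "topspace Y \<subseteq> H ` topspace X"
    proof
      fix y assume "y \<in> topspace Y"
      then obtain n where "y \<in> L n" using Y unfolding tower_def by blast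
      then obtain x where x: "x \<in> C (Suc n)" "y = h (Suc n) x" using CS(3) by blast
      then show "y \<in> H ` topspace X"
        using H[OF x(1)] CX[of "Suc n"] by (intro image_eqI[of _ _ x]) auto
    qed
  qed
  have cont: "continuous_map X Y H"
    unfolding continuous_map_closedin
  proof (intro conjI allI impI ballI)
    fix D assume D: "closedin Y D"
    let ?P = "{x \<in> topspace X. H x \<in> D}"
    have "closedin X (?P \<inter> K n)" for n
    proof -
      have "closedin (subtopology X (C (Suc n))) {x \<in> C (Suc n). h (Suc n) x \<in> D}"
        using closedin_continuous_map_preimage[OF C(2) D, of "Suc n"] unfolding tC .
      then have "closedin X {x \<in> C (Suc n). h (Suc n) x \<in> D}"
        by (rule closedin_trans_full) (rule compactin_imp_closedin[OF hX C(1)])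
      moreover have "closedin X (K n)" by (rule compactin_imp_closedin[OF hX KX])
      moreover have "?P \<inter> K n = {x \<in> C (Suc n). h (Suc n) x \<in> D} \<inter> K n"
        using CS(2)[of n] CX[of "Suc n"] H[of _ "Suc n"] by force
      ultimately show ?thesis by auto
    qed
    then show "closedin X ?P" using X unfolding tower_def by auto
  qed (use img in auto)
  have "closed_map X Y H"
    unfolding closed_map_def
  proof (intro allI impI)
    fix P assume P: "closedin X P"
    have "closedin Y (H ` P \<inter> L n)" for n
    proof -
      have "compactin X (P \<inter> C (Suc n))" using P C(1) by (rule closed_Int_compactin)
      then have "compactin (subtopology X (C (Suc n))) (P \<inter> C (Suc n))"
        by (simp add: compactin_subtopology)
      from image_compactin[OF this C(2)]
      have "closedin Y (h (Suc n) ` (P \<inter> C (Suc n)))" by (rule compactin_imp_closedin[OF hY])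
      moreover have "closedin Y (L n)" by (rule compactin_imp_closedin[OF hY LY])
      moreover have "H ` P \<inter> L n = h (Suc n) ` (P \<inter> C (Suc n)) \<inter> L n"
      proof (intro equalityI subsetI)
        fix y assume y: "y \<in> H ` P \<inter> L n"
        then obtain x x' where x: "x \<in> P" "y = H x" "x' \<in> C (Suc n)" "y = h (Suc n) x'"
          using CS(3) by blast
        moreover have "x \<in> topspace X" "x' \<in> topspace X" using x closedin_subset[OF P] CX by blast+
        ultimately have "x = x'" using inj H by (metis inj_onD)
        then show "y \<in> h (Suc n) ` (P \<inter> C (Suc n)) \<inter> L n" using x y by blast
      qed (use H in force)
      ultimately show ?thesis by auto
    qed
    moreover have "H ` P \<subseteq> topspace Y" using img closedin_subset[OF P] by blast
    ultimately show "closedin Y (H ` P)" using Y unfolding tower_def by blast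
  qed
  then have "homeomorphic_map X Y H"
    using cont img inj by (intro bijective_closed_imp_homeomorphic_map)
  then show ?thesis by (rule homeomorphic_map_imp_homeomorphic_space)
qed

section \<open>Fans in sequential locally convex spaces\<close>

text \<open>If no value recurs infinitely often, each value is exceeded at a later index. This is
  the case distinction for limits of indexed families: an index escapes, or it may be assumed
  constant.\<close>

lemma nat_seq_subseq:
  fixes n :: "nat \<Rightarrow> nat"
  obtains r :: "nat \<Rightarrow> nat" where "strict_mono r" "strict_mono (n \<circ> r)"
  | r :: "nat \<Rightarrow> nat" and c where "strict_mono r" "\<And>k. n (r k) = c"
proof (cases "\<exists>c. infinite {k. n k = c}")
  case True
  then obtain c where c: "infinite {k. n k = c}" by blast
  show thesis
  proof (rule that(2))
    show "strict_mono (enumerate {k. n k = c})" using c by (rule strict_mono_enumerate)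
    show "n (enumerate {k. n k = c} k) = c" for k using enumerate_in_set[OF c, of k] by simp
  qed
next
  case False
  have ex: "\<exists>k>i. n k > n i" for i
  proof -
    have "finite (\<Union>c\<le>n i. {k. n k = c})" using False by simp
    then have "finite ((\<Union>c\<le>n i. {k. n k = c}) \<union> {..i})" by simp
    then obtain k where "k \<notin> (\<Union>c\<le>n i. {k. n k = c}) \<union> {..i}"
      using ex_new_if_finite[OF infinite_UNIV_nat] by blast
    then show ?thesis by (auto simp: not_le intro!: exI[of _ k])
  qed
  then obtain nx where nx: "\<And>i. nx i > i \<and> n (nx i) > n i" by metis
  define r where "r k = (nx ^^ k) 0" for k
  have "strict_mono r" "strict_mono (n \<circ> r)"
    using nx by (auto simp: strict_mono_Suc_iff r_def)
  then show thesis by (rule that(1))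
qed

context lcs
begin

text \<open>The Frechet-Urysohn fan with vertex 0 in sequential form: by the second clause a
  convergent sequence of points of the fan uses only finitely many rows.\<close>

definition fan :: "(nat \<Rightarrow> nat \<Rightarrow> 'a) \<Rightarrow> bool" where
  "fan x \<longleftrightarrow> (\<forall>n. limitin X (x n) 0 sequentially) \<and>
     (\<forall>r m l. strict_mono r \<longrightarrow> \<not> limitin X (\<lambda>k. x (r k) (m k)) l sequentially)"

text \<open>The metric fan with vertex 0 in sequential form, the standard witness that local
  compactness fails at the vertex.\<close>

definition metric_fan :: "(nat \<Rightarrow> nat \<Rightarrow> 'a) \<Rightarrow> bool" where
  "metric_fan y \<longleftrightarrow> (\<forall>V. znhd X V \<longrightarrow> (\<exists>N. \<forall>n\<ge>N. \<forall>m. y n m \<in> V)) \<and>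
     (\<forall>n r l. strict_mono r \<longrightarrow> \<not> limitin X (\<lambda>k. y n (r k)) l sequentially)"

lemma fanD: "fan x \<Longrightarrow> strict_mono r \<Longrightarrow> \<not> limitin X (\<lambda>k. x (r k) (m k)) l sequentially"
  by (simp add: fan_def)

text \<open>The nonzero sums x n m + y n m form a sequentially closed set with 0 in its closure.
  Along a convergent sequence of sums, if n escapes then the y-parts tend to 0 and the x-parts would
  converge, against \<open>fan\<close>; if n is constant and m escapes then the x-parts tend to 0
  and row n of y would have a convergent subsequence, against \<open>metric_fan\<close>.\<close>

lemma fan_metric_fan_incompatible:
  assumes seq: "sequential_space X" and x: "fan x" and y: "metric_fan y"
  shows False
proof -
  define P where "P = {x n m + y n m |n m. x n m + y n m \<noteq> 0}"
  have "sequentially_closedin X P"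
    unfolding sequentially_closedin_def
  proof (intro conjI allI impI, simp)
    fix \<sigma> l assume A: "(\<forall>n. \<sigma> n \<in> P) \<and> limitin X \<sigma> l sequentially"
    then have "\<forall>k. \<exists>n m. \<sigma> k = x n m + y n m" unfolding P_def by blast
    then obtain n m where nm: "\<And>k. \<sigma> k = x (n k) (m k) + y (n k) (m k)" by metis
    have lim: "limitin X (\<lambda>k. \<sigma> (r k)) l sequentially" if "strict_mono r" for r
      using limitin_subsequence[OF that, of X \<sigma> l] A by (simp add: o_def)
    show "l \<in> P"
    proof (rule nat_seq_subseq[of n])
      fix r :: "nat \<Rightarrow> nat" assume r: "strict_mono r" "strict_mono (n \<circ> r)"
      have "limitin X (\<lambda>k. y (n (r k)) (m (r k))) 0 sequentially"
        unfolding limitin_iff_znhd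
      proof clarify
        fix V assume "znhd X V"
        then obtain N where N: "\<forall>n\<ge>N. \<forall>m. y n m \<in> V" using y unfolding metric_fan_def by blast
        have "n (r k) \<ge> N" if "k \<ge> N" for k
          using strict_mono_imp_increasing[OF r(2), of k] that by simp
        then show "\<forall>\<^sub>F k in sequentially. y (n (r k)) (m (r k)) - 0 \<in> V"
          using N unfolding eventually_sequentially by auto
      qed
      from lim_diff[OF lim[OF r(1)] this]
      have "limitin X (\<lambda>k. x ((n \<circ> r) k) (m (r k))) l sequentially" by (simp add: nm)
      moreover have "\<not> limitin X (\<lambda>k. x ((n \<circ> r) k) ((m \<circ> r) k)) l sequentially"
        by (rule fanD[OF x r(2)])
      ultimately show ?thesis by simp
    next
      fix r :: "nat \<Rightarrow> nat" and c assume r: "strict_mono r" "\<And>k. n (r k) = c"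
      show ?thesis
      proof (rule nat_seq_subseq[of "m \<circ> r"])
        fix q :: "nat \<Rightarrow> nat" assume q: "strict_mono q" "strict_mono ((m \<circ> r) \<circ> q)"
        have "limitin X (x c) 0 sequentially" using x by (simp add: fan_def)
        from limitin_subsequence[OF q(2) this]
        have 1: "limitin X (\<lambda>k. x c (m (r (q k)))) 0 sequentially" by (simp add: o_def)
        have "strict_mono (\<lambda>k. r (q k))" using r(1) q(1) by (simp add: strict_mono_def)
        from lim_diff[OF lim[OF this] 1]
        have "limitin X (\<lambda>k. y c ((m \<circ> r \<circ> q) k)) l sequentially" by (simp add: nm r(2))
        then show ?thesis using y q(2) unfolding metric_fan_def by blast
      next
        fix q :: "nat \<Rightarrow> nat" and d assume q: "strict_mono q" "\<And>k. (m \<circ> r) (q k) = d"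
        have "strict_mono (\<lambda>k. r (q k))" using r(1) q(1) by (simp add: strict_mono_def)
        from lim[OF this] have "limitin X (\<lambda>k. x c d + y c d) l sequentially"
          using q(2) by (simp add: nm r(2))
        moreover have "limitin X (\<lambda>k. x c d + y c d) (x c d + y c d) sequentially" by simp
        ultimately have "l = x c d + y c d" by (rule lim_unique) simp
        then have "l = \<sigma> (r (q 0))" using q(2)[of 0] by (simp add: nm r(2))
        then show ?thesis using A by simp
      qed
    qed
  qed
  then have "closedin X P" using seq by (simp add: sequential_space_def)
  then have "X closure_of P = P" by (simp add: closure_of_closedin)
  moreover have "0 \<in> X closure_of P"
    unfolding closure_iff_znhd
  proof clarify
    fix V assume "znhd X V"
    then obtain W where W: "znhd X W" "\<And>a b. a \<in> W \<Longrightarrow> b \<in> W \<Longrightarrow> a + b \<in> V"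
      using znhd_half by metis
    obtain N where N: "\<forall>n\<ge>N. \<forall>m. y n m \<in> W" using y W(1) unfolding metric_fan_def by blast
    have xN: "limitin X (x N) 0 sequentially" using x by (simp add: fan_def)
    then have "\<forall>\<^sub>F m in sequentially. x N m \<in> W"
      using W(1) by (auto simp: limitin_iff_znhd)
    then obtain m0 where m0: "\<And>m. m \<ge> m0 \<Longrightarrow> x N m \<in> W" by (auto simp: eventually_sequentially)
    \<comment> \<open>Zero was removed from P, so cancellation must be excluded: if y N m = - x N m
      for all large m, row N of y would converge.\<close>
    have "\<exists>m\<ge>m0. x N m + y N m \<noteq> 0"
    proof (rule ccontr)
      assume "\<not> ?thesis"
      then have "y N m = - x N m" if "m \<ge> m0" for m using that by (metis add_eq_0_iff)
      then have "\<forall>\<^sub>F m in sequentially. - x N m = y N m"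
        unfolding eventually_sequentially by (intro exI[of _ m0]) simp
      then have "limitin X (y N) (- 0) sequentially"
        by (rule limitin_transform_eventually) (rule lim_minus[OF xN])
      moreover have "strict_mono (\<lambda>k::nat. k)" by (simp add: strict_mono_def)
      ultimately show False using y unfolding metric_fan_def by blast
    qed
    then obtain m where "m \<ge> m0" "x N m + y N m \<noteq> 0" by blast
    then show "\<exists>s\<in>P. s - 0 \<in> V"
      using W(2)[OF m0, of m "y N m"] N by (intro bexI[of _ "x N m + y N m"]) (auto simp: P_def)
  qed
  ultimately show False by (simp add: P_def)
qed

end

section \<open>Lifting convergent sequences through a subproper map\<close>

locale kstar = lcs X + Metric_space M rho
  for X :: "'a::real_vector topology" and M :: "'m set" and rho +
  fixes f :: "'m \<Rightarrow> 'a" and Z :: "'m set"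
  assumes cont: "continuous_map mtopology X f"
    and ZM: "Z \<subseteq> M" and surj: "f ` Z = UNIV"
    and pre: "\<And>K. precompactin X K \<Longrightarrow> precompactin mtopology (Z \<inter> f -` K)"
    and seqsp: "sequential_space X"
begin

text \<open>Relative compactness in the metric space M, in sequential form: the limits may lie
  outside T.\<close>

definition relc :: "'m set \<Rightarrow> bool" where
  "relc T \<longleftrightarrow> T \<subseteq> M \<and> (\<forall>\<sigma> :: nat \<Rightarrow> 'm. range \<sigma> \<subseteq> T \<longrightarrow> (\<exists>(r :: nat \<Rightarrow> nat) l. strict_mono r \<and> limitin mtopology (\<sigma> \<circ> r) l sequentially))"

lemma relcD:
  assumes "relc T" "\<And>n. \<sigma> n \<in> T"
  obtains r l where "strict_mono (r :: nat \<Rightarrow> nat)" "limitin mtopology (\<sigma> \<circ> r) l sequentially"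
  using assms unfolding relc_def by blast

lemma relc_mono: "relc T \<Longrightarrow> S \<subseteq> T \<Longrightarrow> relc S"
  unfolding relc_def by blast

lemma relc_closure:
  assumes "relc T"
  shows "compactin mtopology (mtopology closure_of T)"
  unfolding compactin_sequentially
proof (intro conjI allI impI)
  show "mtopology closure_of T \<subseteq> M" using closure_of_subset_topspace by fastforce
  fix \<sigma> :: "nat \<Rightarrow> 'm" assume s: "range \<sigma> \<subseteq> mtopology closure_of T"
  then have sM: "\<sigma> n \<in> M" for n using metric_closure_of by auto
  have "\<exists>t\<in>T. rho (\<sigma> n) t < inverse (real (Suc n))" for n
  proof -
    have "\<sigma> n \<in> mtopology closure_of T" using s by blast
    moreover have "0 < inverse (real (Suc n))" by simp
    ultimately have "\<exists>t\<in>T. t \<in> mball (\<sigma> n) (inverse (real (Suc n)))" unfolding metric_closure_of by blast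
    then show ?thesis by (auto simp del: of_nat_Suc)
  qed
  then obtain t where t: "\<And>n. t n \<in> T" "\<And>n. rho (\<sigma> n) (t n) < inverse (real (Suc n))" by metis
  have tM: "t n \<in> M" for n using t(1) assms by (auto simp: relc_def)
  obtain r l where r: "strict_mono r" "limitin mtopology (t \<circ> r) l sequentially"
    by (rule relcD[of T t, OF assms t(1)])
  have lM: "l \<in> M" using limitin_topspace[OF r(2)] by simp
  have l1: "(\<lambda>k. rho (t (r k)) l) \<longlonglongrightarrow> 0" using r(2) unfolding limitin_metric_dist_null by simp
  have l2: "(\<lambda>k. inverse (real (Suc (r k)))) \<longlonglongrightarrow> 0"
    using LIMSEQ_subseq_LIMSEQ[OF LIMSEQ_inverse_real_of_nat r(1)] by (simp add: o_def)
  have "(\<lambda>k. rho (\<sigma> (r k)) l) \<longlonglongrightarrow> 0"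
  proof (rule tendsto_sandwich[OF _ _ tendsto_const tendsto_add[OF l2 l1, simplified]])
    show "\<forall>\<^sub>F k in sequentially. rho (\<sigma> (r k)) l \<le> inverse (1 + real (r k)) + rho (t (r k)) l"
    proof (rule always_eventually, rule allI)
      fix k show "rho (\<sigma> (r k)) l \<le> inverse (1 + real (r k)) + rho (t (r k)) l"
        using triangle[OF sM tM lM, of "r k" "r k"] t(2)[of "r k"] by simp
    qed
  qed simp
  then have lim: "limitin mtopology (\<sigma> \<circ> r) l sequentially"
    unfolding limitin_metric_dist_null using lM sM by (simp add: o_def)
  moreover have "l \<in> mtopology closure_of T"
    by (rule limitin_closedin[OF lim]) (use s in \<open>auto intro!: always_eventually\<close>)
  ultimately show "\<exists>l r. l \<in> mtopology closure_of T \<and> strict_mono r \<and> limitin mtopology (\<sigma> \<circ> r) l sequentially"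
    using r(1) by blast
qed

lemma relc_Un:
  assumes "relc S" "relc T"
  shows "relc (S \<union> T)"
proof -
  let ?C = "mtopology closure_of S \<union> mtopology closure_of T"
  have SM: "S \<subseteq> M" "T \<subseteq> M" using assms by (auto simp: relc_def)
  have "compactin mtopology ?C" by (intro compactin_Un relc_closure assms)
  then have "relc ?C" unfolding compactin_sequentially relc_def by blast
  moreover have "S \<union> T \<subseteq> ?C" using closure_of_subset[of S mtopology] closure_of_subset[of T mtopology] SM by auto
  ultimately show ?thesis by (rule relc_mono)
qed

lemma relc_preimage:
  assumes "compactin X K"
  shows "relc (Z \<inter> f -` K)"
proof -
  have "precompactin X K"
    using assms compact_closed[OF assms] by (simp add: precompactin_def closure_of_closedin)
  then have "precompactin mtopology (Z \<inter> f -` K)" by (rule pre)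
  then have c: "compactin mtopology (mtopology closure_of (Z \<inter> f -` K))" by (simp add: precompactin_def)
  then have "relc (mtopology closure_of (Z \<inter> f -` K))" unfolding compactin_sequentially relc_def by blast
  moreover have "Z \<inter> f -` K \<subseteq> mtopology closure_of (Z \<inter> f -` K)"
    by (rule closure_of_subset) (use ZM in auto)
  ultimately show ?thesis by (rule relc_mono)
qed

text \<open>A convergent sequence together with its limit is compact, so subproperness makes its
  preimages in Z relatively compact; continuity of f identifies the image of any limit
  point.\<close>

lemma lift_convergent:
  assumes "\<And>n. z n \<in> Z" "limitin X (\<lambda>n. f (z n)) l sequentially"
  obtains r c where "strict_mono (r :: nat \<Rightarrow> nat)" "limitin mtopology (z \<circ> r) c sequentially"
    "f c = l" "c \<in> mtopology closure_of Z"
proof -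
  have "z n \<in> Z \<inter> f -` insert l (range (\<lambda>n. f (z n)))" for n using assms(1) by auto
  then obtain r c where r: "strict_mono r" "limitin mtopology (z \<circ> r) c sequentially"
    by (rule relcD[OF relc_preimage[OF compact_lim_seq[OF assms(2)]], of z])
  have "limitin X (f \<circ> (z \<circ> r)) (f c) sequentially" by (rule continuous_map_limit[OF cont r(2)])
  moreover have "limitin X (f \<circ> (z \<circ> r)) l sequentially"
    using limitin_subsequence[OF r(1) assms(2)] by (simp add: o_def)
  ultimately have "f c = l" by (rule lim_unique) simp
  moreover have "c \<in> mtopology closure_of Z"
    by (rule limitin_closedin[OF r(2)])
      (use assms(1) closure_of_subset[of Z mtopology] ZM in \<open>auto intro!: always_eventually\<close>)
  ultimately show thesis using that r by blast
qed

lemma near_limit: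
  assumes "limitin mtopology w c sequentially" "\<And>k. z k \<in> M" "e \<longlonglongrightarrow> 0" "\<And>k. rho (z k) (w k) \<le> e k"
  shows "limitin mtopology z c sequentially"
proof -
  have c: "c \<in> M" "\<forall>\<^sub>F k in sequentially. w k \<in> M" "(\<lambda>k. rho (w k) c) \<longlonglongrightarrow> 0"
    using assms(1) unfolding limitin_metric_dist_null by auto
  have "(\<lambda>k. rho (z k) c) \<longlonglongrightarrow> 0"
  proof (rule tendsto_sandwich[OF _ _ tendsto_const tendsto_add[OF assms(3) c(3), simplified]])
    show "\<forall>\<^sub>F k in sequentially. rho (z k) c \<le> e k + rho (w k) c"
      using c(2)
    proof eventually_elim
      case (elim k)
      show ?case using triangle[OF assms(2) elim c(1), of k] assms(4)[of k] by simp
    qed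
  qed simp
  then show ?thesis unfolding limitin_metric_dist_null using c(1) assms(2) by simp
qed

lemma lim_rho:
  assumes "limitin mtopology w c F" "e > 0"
  shows "\<forall>\<^sub>F k in F. rho (w k) c < e"
proof -
  have "\<forall>\<^sub>F k in F. w k \<in> M \<and> rho (w k) c < e"
    using assms unfolding limitin_metric by blast
  then show ?thesis by eventually_elim simp
qed

text \<open>Without a fan the zero set Z0 of f in the closure of Z is relatively compact: points of
  Z0 are approximated by rows in Z, whose images are null sequences, and a convergent diagonal
  sequence of images lifts back to M.\<close>

lemma no_fan_imp_metrizable:
  assumes nofan: "\<nexists>x. fan x"
  shows "metrizable_space X"
proof -
  define Z0 where "Z0 = {z \<in> mtopology closure_of Z. f z = 0}"
  have Z0M: "Z0 \<subseteq> M" using closure_of_subset_topspace[of mtopology Z] by (auto simp: Z0_def)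
  have seqc: "\<exists>r c. strict_mono r \<and> limitin mtopology (z \<circ> r) c sequentially" if z: "\<And>n. z n \<in> Z0" for z :: "nat \<Rightarrow> 'm"
  proof -
    have zM: "z n \<in> M" for n using z Z0M by blast
    \<comment> \<open>The radius tends to 0 in m, so row n converges to z n, and in n uniformly in
      m, so a diagonal sequence has the same limits as z along the same indices.\<close>
    have "\<exists>w\<in>Z. rho (z n) w < inverse (real (Suc (n + m)))" for n m
    proof -
      have "z n \<in> mtopology closure_of Z" using z by (simp add: Z0_def)
      moreover have "0 < inverse (real (Suc (n + m)))" by simp
      ultimately have "\<exists>t\<in>Z. t \<in> mball (z n) (inverse (real (Suc (n + m))))" unfolding metric_closure_of by blast
      then show ?thesis by (auto simp del: of_nat_Suc)
    qed
    then obtain w where w: "\<And>n m. w n m \<in> Z" "\<And>n m. rho (z n) (w n m) < inverse (real (Suc (n + m)))" by metis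
    have wM: "w n m \<in> M" for n m using w(1) ZM by blast
    have "limitin X (\<lambda>m. f (w n m)) 0 sequentially" for n
    proof -
      have "limitin mtopology (w n) (z n) sequentially"
      proof (rule near_limit[where w="\<lambda>_. z n"])
        show "(\<lambda>m. inverse (real (Suc (m + n)))) \<longlonglongrightarrow> 0"
          using LIMSEQ_ignore_initial_segment[OF LIMSEQ_inverse_real_of_nat, of n] by simp
        show "rho (w n k) (z n) \<le> inverse (real (Suc (k + n)))" for k
          using w(2)[of n k] commute[of "w n k" "z n"] by (simp add: add.commute)
      qed (use zM wM in auto)
      from continuous_map_limit[OF cont this] show ?thesis using z[of n] by (simp add: Z0_def o_def)
    qed
    moreover have "\<not> fan (\<lambda>n m. f (w n m))" using nofan by blast
    ultimately obtain r m l where r: "strict_mono r" "limitin X (\<lambda>k. f (w (r k) (m k))) l sequentially"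
      by (auto simp: fan_def)
    obtain q c where q: "strict_mono q" "limitin mtopology ((\<lambda>k. w (r k) (m k)) \<circ> q) c sequentially"
      by (rule lift_convergent[OF w(1) r(2)])
    have rq: "strict_mono (r \<circ> q)" using r(1) q(1) by (rule strict_mono_o)
    have "limitin mtopology (z \<circ> (r \<circ> q)) c sequentially"
    proof (rule near_limit[OF q(2)])
      show "(z \<circ> (r \<circ> q)) k \<in> M" for k using zM by simp
      show "(\<lambda>k. inverse (real (Suc k))) \<longlonglongrightarrow> 0" by (rule LIMSEQ_inverse_real_of_nat)
      show "rho ((z \<circ> (r \<circ> q)) k) (((\<lambda>k. w (r k) (m k)) \<circ> q) k) \<le> inverse (real (Suc k))" for k
      proof -
        have "k \<le> r (q k) + m (q k)" using strict_mono_imp_increasing[OF rq, of k] by simp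
        then have "inverse (real (Suc (r (q k) + m (q k)))) \<le> inverse (real (Suc k))"
          by (intro le_imp_inverse_le) auto
        then show ?thesis using w(2)[of "r (q k)" "m (q k)"] unfolding o_def by linarith
      qed
    qed
    then show ?thesis using rq by blast
  qed
  \<comment> \<open>The candidate base at 0. Compactness of the closure of Z0 makes these sets
    small, and lifting makes them absorb null sequences, but this does not yet make them
    neighbourhoods.\<close>
  define N where "N n = f ` {z \<in> Z. \<exists>w\<in>Z0. rho z w < inverse (real (Suc n))}" for n
  have small: "\<exists>n. \<forall>m\<ge>n. N m \<subseteq> V" if V: "znhd X V" for V
  proof (rule ccontr)
    assume "\<not> ?thesis"
    then have "\<forall>n. \<exists>z. z \<in> Z \<and> (\<exists>w\<in>Z0. rho z w < inverse (real (Suc n))) \<and> f z \<notin> V"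
    proof (intro allI)
      fix n
      assume "\<not> (\<exists>n. \<forall>m\<ge>n. N m \<subseteq> V)"
      then obtain m where m: "m \<ge> n" "\<not> N m \<subseteq> V" by blast
      then obtain z w where z: "z \<in> Z" "w \<in> Z0" "rho z w < inverse (real (Suc m))" "f z \<notin> V"
        unfolding N_def by blast
      moreover have "inverse (real (Suc m)) \<le> inverse (real (Suc n))" using m(1) by (intro le_imp_inverse_le) auto
      ultimately show "\<exists>z. z \<in> Z \<and> (\<exists>w\<in>Z0. rho z w < inverse (real (Suc n))) \<and> f z \<notin> V"
        by (meson less_le_trans)
    qed
    then obtain z w where z: "\<And>n. z n \<in> Z" "\<And>n. w n \<in> Z0" "\<And>n. rho (z n) (w n) < inverse (real (Suc n))"
      "\<And>n. f (z n) \<notin> V" by metis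
    obtain r c where r: "strict_mono r" "limitin mtopology (w \<circ> r) c sequentially" using seqc[of w, OF z(2)] by blast
    have "limitin X (f \<circ> (w \<circ> r)) (f c) sequentially" by (rule continuous_map_limit[OF cont r(2)])
    moreover have "f \<circ> (w \<circ> r) = (\<lambda>_. 0)" using z(2) by (auto simp: Z0_def)
    ultimately have "limitin X (\<lambda>_::nat. 0) (f c) sequentially" by simp
    moreover have "limitin X (\<lambda>_::nat. 0) 0 sequentially" by simp
    ultimately have fc: "f c = 0" by (rule lim_unique) simp
    have "limitin mtopology (z \<circ> r) c sequentially"
    proof (rule near_limit[OF r(2)])
      show "(z \<circ> r) k \<in> M" for k using z(1) ZM by auto
      show "(\<lambda>k. inverse (real (Suc (r k)))) \<longlonglongrightarrow> 0"
        using LIMSEQ_subseq_LIMSEQ[OF LIMSEQ_inverse_real_of_nat r(1)] by (simp add: o_def)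
      show "rho ((z \<circ> r) k) ((w \<circ> r) k) \<le> inverse (real (Suc (r k)))" for k using z(3)[of "r k"] by simp
    qed
    from continuous_map_limit[OF cont this] have "limitin X (\<lambda>k. f (z (r k))) 0 sequentially"
      by (simp add: fc o_def)
    then have "\<forall>\<^sub>F k in sequentially. f (z (r k)) \<in> V" using V by (auto simp: limitin_iff_znhd)
    then show False using z(4) by (auto simp: eventually_sequentially)
  qed
  have absorb: "\<forall>\<^sub>F k in sequentially. x k \<in> N n" if x: "limitin X x 0 sequentially" for x n
  proof (rule ccontr)
    assume "\<not> ?thesis"
    then have "infinite {k. x k \<notin> N n}"
      unfolding eventually_sequentially infinite_nat_iff_unbounded_le by blast
    define q where "q = enumerate {k. x k \<notin> N n}"
    have q: "strict_mono q" "\<And>k. x (q k) \<notin> N n"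
      unfolding q_def using strict_mono_enumerate[OF \<open>infinite {k. x k \<notin> N n}\<close>]
        enumerate_in_set[OF \<open>infinite {k. x k \<notin> N n}\<close>] by auto
    have "\<forall>k. \<exists>z\<in>Z. f z = x (q k)" using surj by (metis UNIV_I imageE)
    then obtain z where z: "\<And>k. z k \<in> Z" "\<And>k. f (z k) = x (q k)" by metis
    have "limitin X (\<lambda>k. f (z k)) 0 sequentially"
      using limitin_subsequence[OF q(1) x] by (simp add: z(2) o_def)
    with z(1) obtain r c where r: "strict_mono r" "limitin mtopology (z \<circ> r) c sequentially"
      "f c = 0" "c \<in> mtopology closure_of Z" by (rule lift_convergent) blast
    then have "c \<in> Z0" by (simp add: Z0_def)
    have "\<forall>\<^sub>F k in sequentially. rho ((z \<circ> r) k) c < inverse (real (Suc n))"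
      by (rule lim_rho[OF r(2)]) simp
    then obtain k where "rho (z (r k)) c < inverse (real (Suc n))" by (auto simp: eventually_sequentially)
    then have "f (z (r k)) \<in> N n" using z(1) \<open>c \<in> Z0\<close> by (auto simp: N_def)
    then show False using q(2) z(2) by simp
  qed
  \<comment> \<open>The one-step sequential closure. The sets N n permit a diagonal choice, so it is
    closed and X is a Frechet-Urysohn space. Were N n no neighbourhood of 0, a null sequence would
    therefore avoid it, against \<open>absorb\<close>.\<close>
  define scl where "scl S = {l. \<exists>\<sigma>. (\<forall>n::nat. \<sigma> n \<in> S) \<and> limitin X \<sigma> l sequentially}" for S :: "'a set"
  have closed: "closedin X (scl S)" for S
  proof -
    have "sequentially_closedin X (scl S)"
      unfolding sequentially_closedin_def
    proof (intro conjI allI impI, simp)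
      fix l L assume A: "(\<forall>n. l n \<in> scl S) \<and> limitin X l L sequentially"
      then have "\<forall>n. \<exists>\<sigma>. (\<forall>m. \<sigma> m \<in> S) \<and> limitin X \<sigma> (l n) sequentially" by (simp add: scl_def)
      then obtain \<sigma> where s: "\<And>n m. \<sigma> n m \<in> S" "\<And>n. limitin X (\<sigma> n) (l n) sequentially" by metis
      have "\<exists>m. \<sigma> n m - l n \<in> N n" for n
      proof -
        have "limitin X (\<lambda>m. \<sigma> n m - l n) (l n - l n) sequentially" by (rule lim_diff[OF s(2)]) simp
        then have "limitin X (\<lambda>m. \<sigma> n m - l n) 0 sequentially" by simp
        from absorb[OF this, of n] show ?thesis by (auto simp: eventually_sequentially)
      qed
      then obtain m where m: "\<And>n. \<sigma> n (m n) - l n \<in> N n" by metis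
      have "limitin X (\<lambda>n. \<sigma> n (m n) - l n) 0 sequentially"
        unfolding limitin_iff_znhd
      proof clarify
        fix V assume "znhd X V"
        then obtain n0 where "\<forall>n\<ge>n0. N n \<subseteq> V" using small by blast
        then show "\<forall>\<^sub>F n in sequentially. \<sigma> n (m n) - l n - 0 \<in> V"
          unfolding eventually_sequentially using m by auto
      qed
      from lim_add[OF this conjunct2[OF A]] have "limitin X (\<lambda>n. \<sigma> n (m n)) L sequentially" by simp
      then show "L \<in> scl S" unfolding scl_def using s(1) by (intro CollectI exI[of _ "\<lambda>n. \<sigma> n (m n)"]) simp
    qed
    then show ?thesis using seqsp by (simp add: sequential_space_def)
  qed
  have "znhd X (N n)" for n
  proof (rule ccontr)
    assume n: "\<not> znhd X (N n)"
    have "0 \<in> X closure_of (- N n)"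
      unfolding closure_iff_znhd
    proof (intro allI impI)
      fix V assume "znhd X V"
      then have "\<not> V \<subseteq> N n" using n znhd_mono by blast
      then show "\<exists>s\<in>- N n. s - 0 \<in> V" by auto
    qed
    moreover have "- N n \<subseteq> scl (- N n)"
    proof
      fix x assume "x \<in> - N n"
      then show "x \<in> scl (- N n)" unfolding scl_def by (intro CollectI exI[of _ "\<lambda>_. x"]) simp
    qed
    ultimately have "0 \<in> scl (- N n)" using closure_of_minimal[OF _ closed] by blast
    then obtain \<sigma> where s: "\<And>k::nat. \<sigma> k \<in> - N n" "limitin X \<sigma> 0 sequentially" unfolding scl_def by blast
    from absorb[OF s(2), of n] s(1) show False by (auto simp: eventually_sequentially)
  qed
  then show ?thesis
    by (rule first_countable_imp_metrizable[of N]) (use small in blast)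
qed

end

section \<open>The locally compact case\<close>

text \<open>An element is determined by the number of its predecessors in S. It is applied
  contrapositively: an uncountable S has an element with infinitely many predecessors in S.\<close>

lemma infinite_finite_initial_segments_countable:
  assumes wo: "Well_order r" and S: "S \<subseteq> Field r"
    and fin: "\<And>i. i \<in> S \<Longrightarrow> finite (S \<inter> underS r i)"
  shows "countable S"
proof (rule countableI)
  have lin: "trans r" "antisym r" "total_on (Field r) r" "refl_on (Field r) r"
    using wo unfolding order_on_defs by auto
  show "inj_on (\<lambda>i. card (S \<inter> underS r i)) S"
  proof (rule inj_onI, rule ccontr)
    fix i j assume ij: "i \<in> S" "j \<in> S" "card (S \<inter> underS r i) = card (S \<inter> underS r j)" "i \<noteq> j"
    have less: "card (S \<inter> underS r a) < card (S \<inter> underS r b)" if "a \<in> S" "b \<in> S" "(a, b) \<in> r" "a \<noteq> b" for a b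
    proof (rule psubset_card_mono[OF fin[OF that(2)]])
      have "underS r a \<subseteq> underS r b" using that lin(1,2) unfolding underS_def trans_def antisym_def by blast
      moreover have "a \<in> underS r b" "a \<notin> underS r a" using that by (auto simp: underS_def)
      ultimately show "S \<inter> underS r a \<subset> S \<inter> underS r b" using that(1) by blast
    qed
    have "(i, j) \<in> r \<or> (j, i) \<in> r" using ij S lin(3) unfolding total_on_def by blast
    then show False using less[of i j] less[of j i] ij by auto
  qed
qed

section \<open>Local compactness of the closure of Z\<close>

context kstar
begin

definition bal :: "'m \<Rightarrow> nat \<Rightarrow> 'm set" where "bal z n = Z \<inter> mball z ((1/2)^n)"

lemma bal_mono:
  assumes "rho z c < (1/2)^(Suc n)" "z \<in> M" "c \<in> M"
  shows "bal z (Suc n) \<subseteq> bal c n"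
proof
  fix w assume w: "w \<in> bal z (Suc n)"
  then have "w \<in> M" "rho z w < (1/2)^(Suc n)" by (auto simp: bal_def)
  then have "rho c w < (1/2)^n" using triangle[of c z w] assms commute[of c z] by auto
  then show "w \<in> bal c n" using w \<open>c \<in> M\<close> by (auto simp: bal_def)
qed

text \<open>Local compactness of the closure of Z, expressed through balls of Z itself.\<close>

definition loc_relc :: bool where
  "loc_relc \<longleftrightarrow> (\<forall>c \<in> mtopology closure_of Z. \<exists>n. relc (bal c n))"

text \<open>If this fails at c, each ball around c contains a sequence without convergent
  subsequences. Translated by \<open>f c\<close>, the images form a metric fan, because a convergent
  subsequence of images would lift.\<close>

lemma no_metric_fan_imp_loc_relc:
  assumes "\<nexists>y. metric_fan y"
  shows loc_relc
  unfolding loc_relc_def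
proof (rule ballI, rule ccontr)
  fix c assume c: "c \<in> mtopology closure_of Z" and no: "\<nexists>n. relc (bal c n)"
  have cM: "c \<in> M" using c metric_closure_of by auto
  have "\<exists>w :: nat \<Rightarrow> 'm. (\<forall>m. w m \<in> bal c n) \<and> (\<forall>r l. strict_mono (r :: nat \<Rightarrow> nat) \<longrightarrow> \<not> limitin mtopology (w \<circ> r) l sequentially)" for n
  proof -
    have "bal c n \<subseteq> M" using ZM by (auto simp: bal_def)
    then obtain w :: "nat \<Rightarrow> 'm" where w: "range w \<subseteq> bal c n"
      "\<not> (\<exists>(r :: nat \<Rightarrow> nat) l. strict_mono r \<and> limitin mtopology (w \<circ> r) l sequentially)"
      using no unfolding relc_def by blast
    then show ?thesis by blast
  qed
  then have "\<forall>n. \<exists>w :: nat \<Rightarrow> 'm. (\<forall>m. w m \<in> bal c n) \<and> (\<forall>r l. strict_mono (r :: nat \<Rightarrow> nat) \<longrightarrow> \<not> limitin mtopology (w \<circ> r) l sequentially)"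
    by blast
  from choice[OF this] obtain w where w: "\<And>n m :: nat. w n m \<in> bal c n"
    "\<And>n r l. strict_mono (r :: nat \<Rightarrow> nat) \<Longrightarrow> \<not> limitin mtopology (w n \<circ> r) l sequentially" by blast
  have wZ: "w n m \<in> Z" for n m using w(1) by (auto simp: bal_def)
  have "metric_fan (\<lambda>n m. f (w n m) - f c)"
    unfolding metric_fan_def
  proof (intro conjI allI impI)
    fix V assume "znhd X V"
    then have "\<exists>U. openin mtopology U \<and> c \<in> U \<and> (\<forall>z\<in>U. f z - f c \<in> V)"
      using cont[unfolded cont_at_iff] cM by simp
    then obtain U where U: "openin mtopology U" "c \<in> U" "\<forall>z\<in>U. f z - f c \<in> V" by blast
    then obtain e where e: "e > 0" "mball c e \<subseteq> U" unfolding openin_mtopology by blast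
    obtain N where N: "(1/2::real)^N < e" using real_arch_pow_inv[OF e(1), of "1/2"] by auto
    show "\<exists>N. \<forall>n\<ge>N. \<forall>m. f (w n m) - f c \<in> V"
    proof (intro exI allI impI)
      fix n m assume "N \<le> n"
      then have "(1/2::real)^n \<le> (1/2)^N" by (intro power_decreasing) auto
      moreover have "rho c (w n m) < (1/2)^n" "w n m \<in> M" using w(1)[of n m] by (auto simp: bal_def)
      ultimately have "rho c (w n m) < e" "w n m \<in> M" using N by linarith+
      then have "w n m \<in> mball c e" using cM by simp
      then show "f (w n m) - f c \<in> V" using e U by blast
    qed
  next
    fix n and r :: "nat \<Rightarrow> nat" and l assume r: "strict_mono r"
    show "\<not> limitin X (\<lambda>k. f (w n (r k)) - f c) l sequentially"
    proof
      assume "limitin X (\<lambda>k. f (w n (r k)) - f c) l sequentially"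
      from lim_add[OF this, of "\<lambda>_. f c" "f c"]
      have "limitin X (\<lambda>k. f (w n (r k))) (l + f c) sequentially" by simp
      then obtain q d where q: "strict_mono (q :: nat \<Rightarrow> nat)" "limitin mtopology ((\<lambda>k. w n (r k)) \<circ> q) d sequentially"
        by (rule lift_convergent[of "\<lambda>k. w n (r k)", OF wZ])
      from w(2)[OF strict_mono_o[OF r q(1)], of n d] q(2) show False by (simp add: o_def)
    qed
  qed
  then show False using assms by blast
qed

section \<open>Splitting Z into sigma-compact classes\<close>

definition lam :: "'m \<Rightarrow> nat" where "lam z = (LEAST n. relc (bal z n))"

text \<open>The factor 1/4 keeps two steps between points with equal \<open>lam\<close> inside one
  relatively compact ball; see \<open>relc_near\<close>.\<close>

definition near :: "('m \<times> 'm) set" where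
  "near = {(z, w). z \<in> Z \<and> w \<in> Z \<and> rho z w < (1/2)^(lam z) / 4 \<and> rho z w < (1/2)^(lam w) / 4}"

lemma near_sym: "sym near"
  unfolding sym_def near_def using commute by auto

context
  assumes loc: loc_relc
begin

lemma relc_bal_lam:
  assumes "z \<in> Z"
  shows "relc (bal z (lam z))"
proof -
  have "z \<in> mtopology closure_of Z" using closure_of_subset[of Z mtopology] ZM assms by auto
  then obtain n where "relc (bal z n)" using loc unfolding loc_relc_def by blast
  then show ?thesis unfolding lam_def by (rule LeastI)
qed

text \<open>Small balls around points close to c lie in a relatively compact ball around c, so
  \<open>lam\<close> stays bounded along the sequence while the distances tend to 0.\<close>

lemma convergent_near:
  assumes z: "\<And>k. z k \<in> Z" and lim: "limitin mtopology z c sequentially"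
  obtains N k0 where "\<And>k. k \<ge> k0 \<Longrightarrow> lam (z k) \<le> N" "\<And>k. k \<ge> k0 \<Longrightarrow> (z k0, z k) \<in> near"
proof -
  have cM: "c \<in> M" using limitin_topspace[OF lim] by simp
  have zM: "z k \<in> M" for k using z ZM by blast
  have "c \<in> mtopology closure_of Z"
    by (rule limitin_closedin[OF lim])
      (use z closure_of_subset[of Z mtopology] ZM in \<open>auto intro!: always_eventually\<close>)
  then obtain n where n: "relc (bal c n)" using loc unfolding loc_relc_def by blast
  \<comment> \<open>Two such distances add up to less than \<open>(1/2)^(Suc n) / 4\<close>, the
    scale used in \<open>near\<close>.\<close>
  have "\<forall>\<^sub>F k in sequentially. rho (z k) c < (1/2)^n / 16"
    by (rule lim_rho[OF lim]) simp
  then obtain k0 where k0: "\<And>k. k \<ge> k0 \<Longrightarrow> rho (z k) c < (1/2)^n / 16" by (auto simp: eventually_sequentially)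
  have lam: "lam (z k) \<le> Suc n" if "k \<ge> k0" for k
  proof -
    have "rho (z k) c < (1/2)^(Suc n)"
      using k0[OF that] zero_less_power[of "1/2::real" n] unfolding power_Suc by linarith
    then have "relc (bal (z k) (Suc n))" using relc_mono[OF n bal_mono] zM cM by blast
    then show ?thesis unfolding lam_def by (rule Least_le)
  qed
  show thesis
  proof (rule that[of k0 "Suc n"])
    fix k assume k: "k \<ge> k0"
    have "rho (z k0) (z k) \<le> rho (z k0) c + rho (z k) c"
      using triangle[OF zM cM zM, of k0 k] commute[of "z k" c] by simp
    also have "\<dots> < (1/2)^(Suc n) / 4" using k0[of k0] k0[OF k] unfolding power_Suc by linarith
    finally have 1: "rho (z k0) (z k) < (1/2)^(Suc n) / 4" .
    have "(1/2::real)^(Suc n) \<le> (1/2)^lam (z k0)" "(1/2::real)^(Suc n) \<le> (1/2)^lam (z k)"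
      using lam[of k0] lam[OF k] by (intro power_decreasing; simp)+
    then show "(z k0, z k) \<in> near" using 1 z unfolding near_def by auto
  qed (rule lam)
qed

text \<open>Given w k near z k in T, pass to a subsequence along which z converges and its bounded
  \<open>lam\<close> is constant. Then a tail of w lies within two near-steps of one term of z,
  hence in a relatively compact ball.\<close>

lemma relc_near:
  assumes T: "relc T" "T \<subseteq> Z"
  shows "relc (near `` T)"
  unfolding relc_def
proof (intro conjI allI impI)
  show "near `` T \<subseteq> M" using ZM by (auto simp: near_def)
  fix w :: "nat \<Rightarrow> 'm" assume "range w \<subseteq> near `` T"
  then have "\<forall>k. \<exists>z. z \<in> T \<and> (z, w k) \<in> near" by blast
  from choice[OF this] obtain z where z: "\<And>k. z k \<in> T" "\<And>k. (z k, w k) \<in> near" by blast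
  obtain r c where r: "strict_mono r" "limitin mtopology (z \<circ> r) c sequentially"
    by (rule relcD[OF T(1), of z, OF z(1)])
  have zZ: "z k \<in> Z" for k using z(1) T(2) by blast
  have zr: "(z \<circ> r) k \<in> Z" for k using zZ by simp
  obtain N k1 where "\<And>k. k \<ge> k1 \<Longrightarrow> lam ((z \<circ> r) k) \<le> N"
    by (rule convergent_near[OF zr r(2)]) blast
  then have k1: "\<And>k. k \<ge> k1 \<Longrightarrow> lam (z (r k)) \<le> N" by simp
  obtain q :: "nat \<Rightarrow> nat" and d where q: "strict_mono q" "\<And>k. lam (z (r (q k))) = d"
  proof (rule nat_seq_subseq[of "\<lambda>k. lam (z (r k))"])
    fix q :: "nat \<Rightarrow> nat" assume q: "strict_mono q" "strict_mono ((\<lambda>k. lam (z (r k))) \<circ> q)"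
    define k where "k = max k1 (Suc N)"
    have "k \<le> q k" by (rule strict_mono_imp_increasing[OF q(1)])
    then have "lam (z (r (q k))) \<le> N" by (intro k1) (simp add: k_def)
    moreover have "k \<le> lam (z (r (q k)))" using strict_mono_imp_increasing[OF q(2), of k] by simp
    ultimately have False by (simp add: k_def)
    then show thesis ..
  next
    fix q :: "nat \<Rightarrow> nat" and d assume "strict_mono q" "\<And>k. lam (z (r (q k))) = d"
    then show thesis by (rule that)
  qed
  have zc: "limitin mtopology (z \<circ> r \<circ> q) c sequentially" by (rule limitin_subsequence[OF q(1) r(2)])
  have zrq: "(z \<circ> r \<circ> q) k \<in> Z" for k using zZ by simp
  obtain k0 where "\<And>k. k \<ge> k0 \<Longrightarrow> ((z \<circ> r \<circ> q) k0, (z \<circ> r \<circ> q) k) \<in> near"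
    by (rule convergent_near[OF zrq zc]) blast
  then have k0: "\<And>k. k \<ge> k0 \<Longrightarrow> (z (r (q k0)), z (r (q k))) \<in> near" by simp
  define zz where "zz = z (r (q k0))"
  have "w (r (q (k + k0))) \<in> bal zz (lam zz)" for k
  proof -
    have "(zz, z (r (q (k + k0)))) \<in> near" using k0[of "k + k0"] by (simp add: zz_def)
    moreover have "(z (r (q (k + k0))), w (r (q (k + k0)))) \<in> near" by (rule z(2))
    moreover have "lam zz = d" "lam (z (r (q (k + k0)))) = d" using q(2) by (auto simp: zz_def)
    ultimately have 1: "zz \<in> Z" "z (r (q (k + k0))) \<in> Z" "w (r (q (k + k0))) \<in> Z"
      "rho zz (z (r (q (k + k0)))) < (1/2)^d / 4" "rho (z (r (q (k + k0)))) (w (r (q (k + k0)))) < (1/2)^d / 4"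
      by (auto simp: near_def)
    then have "rho zz (w (r (q (k + k0)))) < (1/2)^d"
      using triangle[of zz "z (r (q (k + k0)))" "w (r (q (k + k0)))"] zero_less_power[of "1/2::real" d]
        subsetD[OF ZM 1(1)] subsetD[OF ZM 1(2)] subsetD[OF ZM 1(3)]
      by linarith
    then show ?thesis using 1 ZM \<open>lam zz = d\<close> by (auto simp: bal_def)
  qed
  then obtain s l where s: "strict_mono s" "limitin mtopology ((\<lambda>k. w (r (q (k + k0)))) \<circ> s) l sequentially"
    using relcD[of "bal zz (lam zz)" "\<lambda>k. w (r (q (k + k0)))", OF relc_bal_lam] zZ zz_def by metis
  have "strict_mono (\<lambda>k. r (q (s k + k0)))"
    using r(1) q(1) s(1) by (simp add: strict_mono_def)
  then show "\<exists>(r :: nat \<Rightarrow> nat) l. strict_mono r \<and> limitin mtopology (w \<circ> r) l sequentially"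
    using s(2) by (intro exI[of _ "\<lambda>k. r (q (s k + k0))"] exI[of _ l]) (simp add: o_def)
qed

definition orb :: "nat \<Rightarrow> 'm \<Rightarrow> 'm set" where "orb n z = (near ^^ n) `` {z}"

lemma orb_Suc: "orb (Suc n) z = near `` orb n z"
  by (auto simp: orb_def)

text \<open>Hence a whole class is a countable union of relatively compact sets.\<close>

lemma orb_relc:
  assumes "z \<in> Z"
  shows "relc (orb n z) \<and> orb n z \<subseteq> Z"
proof (induction n)
  case 0
  have "orb 0 z \<subseteq> bal z (lam z)" using assms ZM by (auto simp: orb_def bal_def)
  then show ?case using relc_mono[OF relc_bal_lam[OF assms]] assms by (auto simp: orb_def)
next
  case (Suc n)
  then show ?case unfolding orb_Suc using relc_near[of "orb n z"] by (auto simp: near_def)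
qed

definition sect :: "'a \<Rightarrow> 'm" where "sect = inv_into Z f"

lemma sect: "sect x \<in> Z" "f (sect x) = x"
  unfolding sect_def using surj by (simp_all add: inv_into_into f_inv_into_f)

text \<open>Points of X are classified through one chosen preimage, so that f need not be
  injective.\<close>

definition cls :: "'a \<Rightarrow> 'm set" where "cls x = near\<^sup>* `` {sect x}"

lemma cls_eqI:
  assumes "(sect x, sect y) \<in> near\<^sup>*"
  shows "cls x = cls y"
proof -
  have "(sect y, sect x) \<in> near\<^sup>*" using assms sym_rtrancl[OF near_sym] by (meson symD)
  then show ?thesis using assms unfolding cls_def by (auto intro: rtrancl_trans)
qed

lemma cls_eq_iff: "cls x = cls y \<longleftrightarrow> (\<exists>n. sect y \<in> orb n (sect x))"
proof
  assume "cls x = cls y"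
  moreover have "sect y \<in> cls y" by (auto simp: cls_def)
  ultimately show "\<exists>n. sect y \<in> orb n (sect x)"
    by (auto simp: cls_def orb_def rtrancl_power)
next
  assume "\<exists>n. sect y \<in> orb n (sect x)"
  then show "cls x = cls y" by (intro cls_eqI) (auto simp: orb_def rtrancl_power)
qed

text \<open>Infinitely many classes would give chosen preimages with a convergent subsequence, and
  its tail lies in a single class by \<open>convergent_near\<close>.\<close>

lemma finite_cls_compact:
  assumes "compactin X K"
  shows "finite (cls ` K)"
proof (rule ccontr)
  assume "infinite (cls ` K)"
  then obtain g :: "nat \<Rightarrow> 'm set" where g: "inj g" "range g \<subseteq> cls ` K"
    using infinite_countable_subset by blast
  then have "\<forall>k. \<exists>x. x \<in> K \<and> cls x = g k" by blast
  from choice[OF this] obtain x where x: "\<And>k. x k \<in> K" "\<And>k. cls (x k) = g k" by blast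
  have "sect (x k) \<in> Z \<inter> f -` K" for k using sect x(1) by simp
  then obtain r c where r: "strict_mono r" "limitin mtopology ((\<lambda>k. sect (x k)) \<circ> r) c sequentially"
    by (rule relcD[OF relc_preimage[OF assms], of "\<lambda>k. sect (x k)"])
  have sr: "((\<lambda>k. sect (x k)) \<circ> r) k \<in> Z" for k using sect by simp
  obtain k0 where "\<And>k. k \<ge> k0 \<Longrightarrow> (((\<lambda>k. sect (x k)) \<circ> r) k0, ((\<lambda>k. sect (x k)) \<circ> r) k) \<in> near"
    by (rule convergent_near[OF sr r(2)]) blast
  from this[of "Suc k0"] have "(sect (x (r k0)), sect (x (r (Suc k0)))) \<in> near" by simp
  then have "cls (x (r k0)) = cls (x (r (Suc k0)))" by (intro cls_eqI r_into_rtrancl)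
  then have "g (r k0) = g (r (Suc k0))" using x(2) by simp
  then have "r k0 = r (Suc k0)" using g(1) by (simp add: inj_eq)
  then show False using r(1) by (simp add: strict_mono_eq)
qed

text \<open>Containment in a sigma-compact set, so that the property passes to subsets.\<close>

definition sigma :: "'a set \<Rightarrow> bool" where
  "sigma S \<longleftrightarrow> (\<exists>\<C>. countable \<C> \<and> (\<forall>C\<in>\<C>. compactin X C) \<and> S \<subseteq> \<Union>\<C>)"

lemma sigmaE:
  assumes "sigma S"
  obtains \<C> where "countable \<C>" "\<forall>C\<in>\<C>. compactin X C" "S \<subseteq> \<Union>\<C>"
  using assms by (auto simp: sigma_def)

lemma sigmaI: "countable \<C> \<Longrightarrow> (\<And>C. C \<in> \<C> \<Longrightarrow> compactin X C) \<Longrightarrow> S \<subseteq> \<Union>\<C> \<Longrightarrow> sigma S"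
  by (auto simp: sigma_def)

lemma sigma_subset:
  assumes "sigma S" "T \<subseteq> S"
  shows "sigma T"
proof -
  obtain \<C> where "countable \<C>" "\<forall>C\<in>\<C>. compactin X C" "S \<subseteq> \<Union>\<C>" using assms(1) by (rule sigmaE)
  then show ?thesis using assms(2) by (intro sigmaI[of \<C>]) auto
qed

lemma sigma_compact: "compactin X C \<Longrightarrow> sigma C"
  by (rule sigmaI[of "{C}"]) auto

lemma sigma_UN:
  assumes "countable I" "\<And>i. i \<in> I \<Longrightarrow> sigma (S i)"
  shows "sigma (\<Union>i\<in>I. S i)"
proof -
  have "\<forall>i\<in>I. \<exists>\<C>. countable \<C> \<and> (\<forall>C\<in>\<C>. compactin X C) \<and> S i \<subseteq> \<Union>\<C>"
    using assms(2) by (simp add: sigma_def)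
  from bchoice[OF this] obtain \<C> where
    C: "\<forall>i\<in>I. countable (\<C> i) \<and> (\<forall>C\<in>\<C> i. compactin X C) \<and> S i \<subseteq> \<Union>(\<C> i)" ..
  show ?thesis
  proof (rule sigmaI)
    show "countable (\<Union>i\<in>I. \<C> i)" by (rule countable_UN) (use assms(1) C in simp_all)
    show "compactin X K" if "K \<in> (\<Union>i\<in>I. \<C> i)" for K using that C by auto
    show "(\<Union>i\<in>I. S i) \<subseteq> \<Union>(\<Union>i\<in>I. \<C> i)"
    proof (rule UN_least)
      fix i assume i: "i \<in> I"
      then have "S i \<subseteq> \<Union>(\<C> i)" using C by simp
      also have "\<dots> \<subseteq> \<Union>(\<Union>i\<in>I. \<C> i)" using i by (intro Union_mono UN_upper)
      finally show "S i \<subseteq> \<Union>(\<Union>i\<in>I. \<C> i)" .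
    qed
  qed
qed

lemma sigma_Un:
  assumes "sigma S" "sigma T"
  shows "sigma (S \<union> T)"
proof -
  obtain C where C: "countable C" "\<forall>K\<in>C. compactin X K" "S \<subseteq> \<Union>C" using assms(1) by (rule sigmaE)
  obtain D where D: "countable D" "\<forall>K\<in>D. compactin X K" "T \<subseteq> \<Union>D" using assms(2) by (rule sigmaE)
  show ?thesis by (rule sigmaI[of "C \<union> D"]) (use C D in auto)
qed

lemma sigma_countable:
  assumes "countable S"
  shows "sigma S"
proof -
  have "sigma (\<Union>x\<in>S. {x})" using assms by (rule sigma_UN) (simp add: sigma_compact)
  then show ?thesis by simp
qed

lemma sigma_plus:
  assumes "sigma S" "sigma T"
  shows "sigma {x + y |x y. x \<in> S \<and> y \<in> T}"
proof -
  obtain C where C: "countable C" "\<forall>K\<in>C. compactin X K" "S \<subseteq> \<Union>C" using assms(1) by (rule sigmaE)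
  obtain D where D: "countable D" "\<forall>K\<in>D. compactin X K" "T \<subseteq> \<Union>D" using assms(2) by (rule sigmaE)
  have "sigma (\<Union>p\<in>C \<times> D. {x + y |x y. x \<in> fst p \<and> y \<in> snd p})"
    by (rule sigma_UN) (use C D in \<open>auto intro!: sigma_compact compact_plus\<close>)
  then show ?thesis
  proof (rule sigma_subset, clarify)
    fix x y assume "x \<in> S" "y \<in> T"
    then obtain K L where "K \<in> C" "L \<in> D" "x \<in> K" "y \<in> L" using C(3) D(3) by blast
    then show "x + y \<in> (\<Union>p\<in>C \<times> D. {x + y |x y. x \<in> fst p \<and> y \<in> snd p})"
      by (intro UN_I[of "(K, L)"]) auto
  qed
qed

lemma sigma_scale:
  assumes "sigma S"
  shows "sigma {c *\<^sub>R x |c x. x \<in> S}"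
proof -
  obtain C where C: "countable C" "\<forall>K\<in>C. compactin X K" "S \<subseteq> \<Union>C" using assms by (rule sigmaE)
  have "sigma (\<Union>p\<in>C \<times> (UNIV :: nat set). {c *\<^sub>R x |c x. c \<in> {- real (snd p)..real (snd p)} \<and> x \<in> fst p})"
    by (rule sigma_UN) (use C in \<open>auto intro!: sigma_compact compact_scaleset simp del: atLeastAtMost_iff\<close>)
  then show ?thesis
  proof (rule sigma_subset, clarify)
    fix c x assume "x \<in> S"
    then obtain K where "K \<in> C" "x \<in> K" using C(3) by blast
    moreover obtain n where "\<bar>c\<bar> \<le> real n" using real_arch_simple by blast
    ultimately show "c *\<^sub>R x \<in> (\<Union>p\<in>C \<times> (UNIV :: nat set). {c *\<^sub>R x |c x. c \<in> {- real (snd p)..real (snd p)} \<and> x \<in> fst p})"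
      by (intro UN_I[of "(K, n)"] CollectI exI[of _ c] exI[of _ x]) auto
  qed
qed

lemma countable_cls:
  assumes "sigma S"
  shows "countable (cls ` S)"
proof -
  obtain C where C: "countable C" "\<forall>K\<in>C. compactin X K" "S \<subseteq> \<Union>C" using assms by (rule sigmaE)
  have "countable (\<Union>K\<in>C. cls ` K)"
  proof (rule countable_UN[OF C(1)])
    show "countable (cls ` K)" if "K \<in> C" for K
      using C(2) that by (intro countable_finite finite_cls_compact) simp
  qed
  moreover have "cls ` S \<subseteq> (\<Union>K\<in>C. cls ` K)" using C(3) by blast
  ultimately show ?thesis by (meson countable_subset)
qed

text \<open>A class is exhausted by the orbits of one representative, and each orbit has compact
  closure.\<close>

lemma sigma_saturate:
  assumes "countable (cls ` S)"
  shows "sigma {y. cls y \<in> cls ` S}"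
proof -
  have orb: "sigma (f ` orb n (sect x))" for n x
  proof -
    have o: "relc (orb n (sect x))" "orb n (sect x) \<subseteq> Z" using orb_relc[OF sect(1)] by blast+
    have "compactin X (f ` (mtopology closure_of (orb n (sect x))))"
      by (rule image_compactin[OF relc_closure[OF o(1)] cont])
    then have "sigma (f ` (mtopology closure_of (orb n (sect x))))" by (rule sigma_compact)
    moreover have "orb n (sect x) \<subseteq> mtopology closure_of (orb n (sect x))"
      by (rule closure_of_subset) (use o(2) ZM in auto)
    ultimately show ?thesis by (meson sigma_subset image_mono)
  qed
  define A where "A = inv_into S cls ` (cls ` S)"
  have "countable A" using assms by (simp add: A_def)
  then have "sigma (\<Union>p\<in>A \<times> UNIV. f ` orb (snd p) (sect (fst p)))"
    by (intro sigma_UN orb) auto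
  then show ?thesis
  proof (rule sigma_subset, clarify)
    fix x y assume xy: "cls y = cls x" "x \<in> S"
    define a where "a = inv_into S cls (cls x)"
    have "a \<in> A" "cls a = cls x" using xy(2) by (auto simp: A_def a_def f_inv_into_f)
    then obtain n where "sect y \<in> orb n (sect a)" using xy(1) cls_eq_iff[of a y] by auto
    then have "y \<in> f ` orb n (sect a)" using sect(2)[of y] by (metis imageI)
    then show "y \<in> (\<Union>p\<in>A \<times> UNIV. f ` orb (snd p) (sect (fst p)))"
      using \<open>a \<in> A\<close> by (intro UN_I[of "(a, n)"]) auto
  qed
qed

text \<open>Saturation makes membership in L depend on the class alone. With
  \<open>finite_cls_compact\<close> this restricts how a convergent sequence can move through a
  chain of such subspaces.\<close>

definition good :: "'a set \<Rightarrow> bool" where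
  "good L \<longleftrightarrow> subspace L \<and> sigma L \<and> (\<forall>x y. x \<in> L \<longrightarrow> cls y = cls x \<longrightarrow> y \<in> L)"

text \<open>Sums, multiples and saturation preserve \<open>sigma\<close>, so closing off under them
  countably often does as well.\<close>

lemma good_hull:
  assumes "sigma S"
  shows "\<exists>L. S \<subseteq> L \<and> good L"
proof -
  define step where "step S = {y. cls y \<in> cls ` (insert 0 S \<union> {x + y |x y. x \<in> S \<and> y \<in> S} \<union> {c *\<^sub>R x |c x. x \<in> S})}" for S
  have step_sigma: "sigma (step S)" if "sigma S" for S
    unfolding step_def insert_is_Un[of 0 S]
    by (intro sigma_saturate countable_cls sigma_Un sigma_plus sigma_scale sigma_countable that) simp
  define G where "G n = (step ^^ n) S" for n
  have GS: "G (Suc n) = step (G n)" for n by (simp add: G_def)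
  have Gsig: "sigma (G n)" for n by (induction n) (auto simp: G_def assms step_sigma)
  have sub: "G n \<subseteq> G (Suc n)" for n unfolding GS step_def by blast
  have mono: "G n \<subseteq> G m" if "n \<le> m" for n m using that by (rule lift_Suc_mono_le[of G, OF sub])
  define L where "L = (\<Union>n. G n)"
  have "subspace L"
    unfolding subspace_def
  proof (intro conjI ballI allI)
    have "0 \<in> G (Suc 0)" unfolding GS step_def by blast
    then show "0 \<in> L" unfolding L_def by blast
  next
    fix x y assume "x \<in> L" "y \<in> L"
    then obtain n m where "x \<in> G n" "y \<in> G m" by (auto simp: L_def)
    then have "x \<in> G (max n m)" "y \<in> G (max n m)" using mono[of n "max n m"] mono[of m "max n m"] by auto
    then have "x + y \<in> G (Suc (max n m))" unfolding GS step_def by blast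
    then show "x + y \<in> L" unfolding L_def by blast
  next
    fix c :: real and x assume "x \<in> L"
    then obtain n where "x \<in> G n" by (auto simp: L_def)
    then have "c *\<^sub>R x \<in> G (Suc n)" unfolding GS step_def by blast
    then show "c *\<^sub>R x \<in> L" unfolding L_def by blast
  qed
  moreover have "sigma L" unfolding L_def by (rule sigma_UN) (auto simp: Gsig)
  moreover have "y \<in> L" if xy: "x \<in> L" "cls y = cls x" for x y
  proof -
    obtain n where "x \<in> G n" using xy(1) by (auto simp: L_def)
    then have "y \<in> G (Suc n)" unfolding GS step_def using xy(2) by blast
    then show ?thesis unfolding L_def by blast
  qed
  moreover have "S \<subseteq> L" unfolding L_def G_def by (metis UN_upper UNIV_I funpow_0)
  ultimately show ?thesis unfolding good_def by blast
qed

text \<open>A proper subspace is not open, so by sequentiality some sequence outside L has its limit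
  in L; subtracting this limit keeps the terms outside L.\<close>

lemma escaping_sequence:
  assumes "good L" "L \<noteq> UNIV"
  shows "\<exists>x. (\<forall>m. x m \<notin> L) \<and> limitin X x 0 sequentially"
proof -
  have sp: "subspace L" using assms(1) by (simp add: good_def)
  then have "\<not> openin X L" using open_subspace_UNIV assms(2) by blast
  then have "\<not> closedin X (UNIV - L)" by (simp add: closedin_def Diff_Diff_Int)
  then have "\<not> sequentially_closedin X (UNIV - L)" using seqsp unfolding sequential_space_def by blast
  then obtain s l where s: "\<And>n. s n \<notin> L" "limitin X s l sequentially" "l \<in> L"
    unfolding sequentially_closedin_def by auto
  have "s n - l \<notin> L" for n
    using subspace_add[OF sp, of "s n - l" l] s(1)[of n] s(3) by auto
  moreover have "limitin X (\<lambda>n. s n - l) (l - l) sequentially" by (rule lim_diff[OF s(2)]) simp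
  ultimately show ?thesis by (intro exI[of _ "\<lambda>n. s n - l"]) simp
qed

end

end

lemma omega1:
  fixes r
  defines "r \<equiv> cardSuc natLeq"
  shows "Well_order r" "uncountable (Field r)" "\<And>i. i \<in> Field r \<Longrightarrow> countable (underS r i)"
proof -
  have co: "Card_order r" by (simp add: r_def cardSuc_Card_order natLeq_Card_order)
  show "Well_order r" using co by (simp add: card_order_on_def)
  have gr: "ordLess2 natLeq r" unfolding r_def by (rule cardSuc_greater[OF natLeq_Card_order])
  show "uncountable (Field r)"
  proof
    assume "countable (Field r)"
    then have "ordLeq3 (card_of (Field r)) natLeq" by (simp add: countable_card_le_natLeq)
    then have "ordLeq3 r natLeq"
      using card_of_Field_ordIso[OF co] ordIso_ordLeq_trans ordIso_symmetric by blast
    then show False using gr not_ordLess_ordLeq by blast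
  qed
  fix i assume "i \<in> Field r"
  then have "ordLess2 (card_of (underS r i)) r" by (rule card_of_underS[OF co])
  then have "ordLeq3 (card_of (underS r i)) natLeq"
    unfolding r_def using cardSuc_ordLeq_ordLess[OF natLeq_Card_order card_of_Card_order] by blast
  then show "countable (underS r i)" by (simp add: countable_card_le_natLeq)
qed

section \<open>A chain of length omega_1, and the resulting compact cover\<close>

context kstar
begin

context
  assumes loc: loc_relc
begin

text \<open>Otherwise every good subspace is proper, and the construction of
  \<open>escaping_sequence\<close> can be continued through all countable ordinals.\<close>

lemma sigma_UNIV: "sigma UNIV"
proof (rule ccontr)
  assume nsig: "\<not> sigma UNIV"
  define ghull where "ghull S = (SOME L. S \<subseteq> L \<and> good L)" for S
  have ghull: "S \<subseteq> ghull S \<and> good (ghull S)" if "sigma S" for S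
  proof -
    have "\<exists>L. S \<subseteq> L \<and> good L" by (rule good_hull[OF loc that])
    from someI_ex[OF this] show ?thesis unfolding ghull_def .
  qed
  define nul where "nul L = (SOME x :: nat \<Rightarrow> 'a. (\<forall>m. x m \<notin> L) \<and> limitin X x 0 sequentially)" for L
  have nul: "(\<forall>m. nul L m \<notin> L) \<and> limitin X (nul L) 0 sequentially" if "good L" for L
  proof -
    have "L \<noteq> UNIV" using that nsig by (auto simp: good_def[OF loc])
    from someI_ex[OF escaping_sequence[OF loc that this]] show ?thesis by (simp add: nul_def)
  qed
  define r where "r = cardSuc natLeq"
  have r: "Well_order r" "uncountable (Field r)" "\<And>i. i \<in> Field r \<Longrightarrow> countable (underS r i)"
    using omega1 by (auto simp: r_def)
  have lin: "trans r" "antisym r" "total_on (Field r) r"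
    using r(1) unfolding order_on_defs by auto
  have wf: "wf (r - Id)" using r(1) by (simp add: well_order_on_def)
  \<comment> \<open>Each L i swallows all earlier L j together with the null sequences chosen
    outside them. So x i misses L i and lies in every later subspace.\<close>
  define L where "L = wfrec (r - Id) (\<lambda>L i. ghull (\<Union>j\<in>underS r i. L j \<union> range (nul (L j))))"
  have L_eq: "L i = ghull (\<Union>j\<in>underS r i. L j \<union> range (nul (L j)))" for i
  proof -
    have "(\<Union>j\<in>underS r i. cut L (r - Id) i j \<union> range (nul (cut L (r - Id) i j))) =
      (\<Union>j\<in>underS r i. L j \<union> range (nul (L j)))"
      by (intro SUP_cong refl) (simp add: cut_def underS_def)
    then show ?thesis
      unfolding L_def by (subst wfrec[OF wf]) (simp add: L_def[symmetric])
  qed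
  have goodL: "good (L i) \<and> (i \<in> Field r \<longrightarrow> (\<Union>j\<in>underS r i. L j \<union> range (nul (L j))) \<subseteq> L i)"
    if "i \<in> Field r" for i
    using wf that
  proof (induction i rule: wf_induct_rule)
    case (less i)
    have "sigma (\<Union>j\<in>underS r i. L j \<union> range (nul (L j)))"
    proof (rule sigma_UN[OF loc r(3)[OF less.prems]])
      fix j assume "j \<in> underS r i"
      then have "(j, i) \<in> r - Id" "j \<in> Field r" by (auto simp: underS_def Field_def)
      then have "good (L j)" using less.IH by blast
      then show "sigma (L j \<union> range (nul (L j)))"
        using sigma_Un[OF loc _ sigma_countable[OF loc]] by (simp add: good_def[OF loc])
    qed
    from ghull[OF this] show ?case by (simp add: L_eq[symmetric])
  qed
  define x where "x i = nul (L i)" for i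
  have x: "x i m \<notin> L i" "limitin X (x i) 0 sequentially" if "i \<in> Field r" for i m
    using nul goodL[OF that] by (auto simp: x_def)
  have xL: "x j m \<in> L i" "L j \<subseteq> L i" if "i \<in> Field r" "j \<in> underS r i" for i j m
    using goodL[OF that(1)] that by (auto simp: x_def)
  have spL: "subspace (L i)" and satL: "a \<in> L i \<Longrightarrow> cls b = cls a \<Longrightarrow> b \<in> L i" if "i \<in> Field r" for i a b
    using goodL[OF that] by (auto simp: good_def[OF loc])
  have underF: "j \<in> Field r" if "j \<in> underS r i" for i j using that by (auto simp: underS_def Field_def)
  have tot: "j \<in> underS r i \<or> i \<in> underS r j" if "i \<in> Field r" "j \<in> Field r" "i \<noteq> j" for i j
    using that lin(3) by (auto simp: underS_def total_on_def)
  \<comment> \<open>A convergent sequence meets only finitely many levels of the chain.\<close>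
  have levels: "finite (range i)"
    if y: "limitin X y l sequentially" and i: "\<And>k. i k \<in> Field r" "\<And>k. y k \<notin> L (i k)"
      "\<And>k j. j \<in> Field r \<Longrightarrow> i k \<in> underS r j \<Longrightarrow> y k \<in> L j" for y :: "nat \<Rightarrow> 'a" and l i
  proof -
    have "finite (cls ` range y)"
      by (rule finite_subset[OF _ finite_cls_compact[OF loc compact_lim_seq[OF y]]]) auto
    moreover have "i k = i k'" if "cls (y k) = cls (y k')" for k k'
    proof (rule ccontr)
      assume ne: "i k \<noteq> i k'"
      have "False" if "i a \<in> underS r (i b)" "cls (y a) = cls (y b)" for a b
        using i(2)[of b] satL[OF i(1)[of b] i(3)[OF i(1) that(1)]] that(2) by simp
      then show False using tot[OF i(1) i(1) ne] that by metis
    qed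
    then have "range i \<subseteq> (\<lambda>c. i (SOME k. cls (y k) = c)) ` cls ` range y"
    proof (intro subsetI, elim rangeE)
      fix a k assume a: "a = i k"
      have "cls (y (SOME k'. cls (y k') = cls (y k))) = cls (y k)" by (rule someI) (rule refl)
      then have "a = i (SOME k'. cls (y k') = cls (y k))"
        using \<open>\<And>k k'. cls (y k) = cls (y k') \<Longrightarrow> i k = i k'\<close> a by metis
      then show "a \<in> (\<lambda>c. i (SOME k. cls (y k) = c)) ` cls ` range y" by blast
    qed
    ultimately show ?thesis by (meson finite_imageI finite_subset)
  qed
  \<comment> \<open>Injectivity sends distinct j to distinct positions, so for fixed i the terms x i
    (e i j) tend to 0 along distinct j.\<close>
  define e where "e i = to_nat_on (underS r i)" for i
  have e: "inj_on (e i) (underS r i)" if "i \<in> Field r" for i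
    unfolding e_def by (rule inj_on_to_nat_on[OF r(3)[OF that]])
  define P where "P = {x j (e i j) + x i (e i j) |i j. i \<in> Field r \<and> j \<in> underS r i}"
  have notL: "x j m + x i m \<notin> L i" if "i \<in> Field r" "j \<in> underS r i" for i j m
    using subspace_diff[OF spL[OF that(1)], of "x j m + x i m" "x j m"] x(1)[OF that(1), of m] xL(1)[OF that, of m]
    by auto
  have "sequentially_closedin X P"
    unfolding sequentially_closedin_def
  proof (intro conjI allI impI, simp)
    fix \<sigma> l assume A: "(\<forall>n. \<sigma> n \<in> P) \<and> limitin X \<sigma> l sequentially"
    then have "\<forall>k. \<exists>i j. \<sigma> k = x j (e i j) + x i (e i j) \<and> i \<in> Field r \<and> j \<in> underS r i"
      unfolding P_def by blast
    from choice[OF this] obtain i where "\<forall>k. \<exists>j. \<sigma> k = x j (e (i k) j) + x (i k) (e (i k) j) \<and> i k \<in> Field r \<and> j \<in> underS r (i k)" ..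
    from choice[OF this] obtain j where ij: "\<And>k. \<sigma> k = x (j k) (e (i k) (j k)) + x (i k) (e (i k) (j k))"
      "\<And>k. i k \<in> Field r" "\<And>k. j k \<in> underS r (i k)" by blast
    \<comment> \<open>A sum with outer index i has level i: it is outside L i but inside every later
      L b.\<close>
    have "finite (range i)"
    proof (rule levels)
      show "limitin X \<sigma> l sequentially" using A by simp
      show "\<sigma> k \<notin> L (i k)" for k using notL[OF ij(2,3)] by (simp add: ij(1))
      show "\<sigma> k \<in> L b" if b: "b \<in> Field r" "i k \<in> underS r b" for k b
      proof -
        have "x (i k) m \<in> L b" for m by (rule xL(1)[OF b])
        moreover have "x (j k) m \<in> L b" for m using xL(1)[OF ij(2,3)] xL(2)[OF b] by blast
        ultimately show ?thesis unfolding ij(1) by (intro subspace_add[OF spL[OF b(1)]])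
      qed
    qed (rule ij)
    then obtain a where a: "infinite {k. i k = a}"
      using inf_img_fin_dom[of i UNIV] by (auto simp: vimage_def)
    define q where "q = enumerate {k. i k = a}"
    have q: "strict_mono q" "\<And>k. i (q k) = a"
      unfolding q_def using strict_mono_enumerate[OF a] enumerate_in_set[OF a] by auto
    have aF: "a \<in> Field r" using ij(2)[of "q 0"] q(2) by simp
    have ju: "j (q k) \<in> underS r a" for k using ij(3)[of "q k"] q(2) by simp
    have lim: "limitin X (\<lambda>k. \<sigma> (s k)) l sequentially" if "strict_mono s" for s
      using limitin_subsequence[OF that, of X \<sigma> l] A by (simp add: o_def)
    show "l \<in> P"
    proof (rule nat_seq_subseq[of "\<lambda>k. e a (j (q k))"])
      fix s :: "nat \<Rightarrow> nat" assume s: "strict_mono s" "strict_mono ((\<lambda>k. e a (j (q k))) \<circ> s)"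
      have "strict_mono (\<lambda>k. q (s k))" using q(1) s(1) by (simp add: strict_mono_def)
      from lim[OF this] have 1: "limitin X (\<lambda>k. \<sigma> (q (s k))) l sequentially" .
      from limitin_subsequence[OF s(2) x(2)[OF aF]]
      have "limitin X (\<lambda>k. x a (e a (j (q (s k))))) 0 sequentially" by (simp add: o_def)
      from lim_diff[OF 1 this]
      have 2: "limitin X (\<lambda>k. x (j (q (s k))) (e a (j (q (s k))))) l sequentially" by (simp add: ij(1) q(2))
      \<comment> \<open>After removal of the null part, the remaining x j has level j, so only
        finitely many j occur; but their codes e a j are strictly increasing.\<close>
      have "finite (range (\<lambda>k. j (q (s k))))"
        by (rule levels[OF 2]) (use underF[OF ju] x(1) xL(1) in auto)
      moreover have "inj (\<lambda>k. e a (j (q (s k))))"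
        using strict_mono_imp_inj_on[OF s(2)] by (simp add: o_def)
      then have "inj (\<lambda>k. j (q (s k)))" by (auto simp: inj_on_def)
      ultimately show ?thesis using finite_imageD infinite_UNIV_nat by blast
    next
      fix s :: "nat \<Rightarrow> nat" and d assume s: "strict_mono s" "\<And>k. e a (j (q (s k))) = d"
      have jc: "j (q (s k)) = j (q (s 0))" for k
        using inj_onD[OF e[OF aF], of "j (q (s k))" "j (q (s 0))"] s(2) ju by simp
      have const: "\<sigma> (q (s k)) = \<sigma> (q (s 0))" for k
        unfolding ij(1) q(2) by (simp only: jc[of k])
      have "strict_mono (\<lambda>k. q (s k))" using q(1) s(1) by (simp add: strict_mono_def)
      from lim[OF this] have "limitin X (\<lambda>k::nat. \<sigma> (q (s 0))) l sequentially" by (subst (asm) const)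
      moreover have "limitin X (\<lambda>k::nat. \<sigma> (q (s 0))) (\<sigma> (q (s 0))) sequentially" by simp
      ultimately have "l = \<sigma> (q (s 0))" by (rule lim_unique) simp
      then show ?thesis using A by simp
    qed
  qed
  then have "closedin X P" using seqsp by (simp add: sequential_space_def)
  then have "X closure_of P = P" by (simp add: closure_of_closedin)
  moreover have "0 \<in> X closure_of P"
    unfolding closure_iff_znhd
  proof clarify
    fix V assume "znhd X V"
    then obtain W where W: "znhd X W" "\<And>a b. a \<in> W \<Longrightarrow> b \<in> W \<Longrightarrow> a + b \<in> V"
      using znhd_half by metis
    define \<phi> where "\<phi> i = (LEAST m0. \<forall>m\<ge>m0. x i m \<in> W)" for i
    have \<phi>: "x i m \<in> W" if "i \<in> Field r" "m \<ge> \<phi> i" for i m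
    proof -
      have "\<forall>\<^sub>F m in sequentially. x i m \<in> W"
        using x(2)[OF that(1)] W(1) by (auto simp: limitin_iff_znhd)
      then have "\<exists>m0. \<forall>m\<ge>m0. x i m \<in> W" by (simp add: eventually_sequentially)
      then have "\<forall>m\<ge>\<phi> i. x i m \<in> W" unfolding \<phi>_def by (rule LeastI_ex)
      then show ?thesis using that(2) by blast
    qed
    \<comment> \<open>One threshold k serves uncountably many indices. Some i among them has
      infinitely many predecessors j of this kind, and the injection e i sends one of these beyond
      k.\<close>
    have "\<exists>k. uncountable {i \<in> Field r. \<phi> i = k}"
    proof (rule ccontr)
      assume "\<not> ?thesis"
      then have "countable (\<Union>k. {i \<in> Field r. \<phi> i = k})" by (intro countable_UN) auto
      moreover have "(\<Union>k. {i \<in> Field r. \<phi> i = k}) = Field r" by auto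
      ultimately show False using r(2) by simp
    qed
    then obtain k where k: "uncountable {i \<in> Field r. \<phi> i = k}" ..
    define S where "S = {i \<in> Field r. \<phi> i = k}"
    have "\<exists>i\<in>S. infinite (S \<inter> underS r i)"
      using infinite_finite_initial_segments_countable[OF r(1), of S] k by (auto simp: S_def)
    then obtain i where i: "i \<in> S" "infinite (S \<inter> underS r i)" by blast
    have iF: "i \<in> Field r" using i by (simp add: S_def)
    have "infinite (e i ` (S \<inter> underS r i))"
      using i(2) finite_imageD[OF _ inj_on_subset[OF e[OF iF]]] by blast
    then obtain m where "m \<in> e i ` (S \<inter> underS r i)" "m \<ge> k"
      unfolding infinite_nat_iff_unbounded_le by blast
    then obtain j where j: "j \<in> S" "j \<in> underS r i" "e i j \<ge> k" by blast
    have "x j (e i j) \<in> W" "x i (e i j) \<in> W"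
      using \<phi> j i(1) by (auto simp: S_def)
    then have "x j (e i j) + x i (e i j) \<in> V" by (rule W(2))
    moreover have "x j (e i j) + x i (e i j) \<in> P" using iF j(2) by (auto simp: P_def)
    ultimately show "\<exists>s\<in>P. s - 0 \<in> V" by auto
  qed
  ultimately have "0 \<in> P" by simp
  then obtain i j where "i \<in> Field r" "j \<in> underS r i" "x j (e i j) + x i (e i j) = 0"
    unfolding P_def by auto
  then show False using notL[of i j "e i j"] subspace_0[OF spL[of i]] by auto
qed

text \<open>C n is the closure of the orbits up to length n of the first n+1 class representatives.
  The lift of a convergent sequence has a tail near a single term, hence inside one piece; this is
  why closedness can be tested on the pieces.\<close>

theorem kw_tower:
  obtains C :: "nat \<Rightarrow> 'm set" where "\<And>n. compactin mtopology (C n)" "tower X (\<lambda>n. f ` C n)"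
proof -
  have "countable (cls ` (UNIV :: 'a set))" by (rule countable_cls[OF loc sigma_UNIV])
  then have rng: "range (from_nat_into (cls ` UNIV)) = cls ` UNIV" by (intro range_from_nat_into) auto
  define a where "a i = inv cls (from_nat_into (cls ` UNIV) i)" for i
  have cls_a: "cls (a i) = from_nat_into (cls ` UNIV) i" for i
    unfolding a_def by (rule f_inv_into_f) (use rng in blast)
  have a: "\<exists>i. cls (a i) = cls x" for x
  proof -
    have "cls x \<in> range (from_nat_into (cls ` UNIV))" using rng by blast
    then show ?thesis using cls_a by (metis rangeE)
  qed
  define T where "T n = (\<Union>i\<le>n. \<Union>m\<le>n. orb m (sect (a i)))" for n
  have TZ: "T n \<subseteq> Z" for n using orb_relc[OF loc sect(1)[OF loc]] by (auto simp: T_def)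
  have fin: "relc (\<Union>i\<in>I. S i)" if "finite I" "\<And>i. i \<in> I \<Longrightarrow> relc (S i)" for I :: "nat set" and S
    using that by (induction I rule: finite_induct) (auto simp: relc_Un relc_def[of "{}"])
  have Trel: "relc (T n)" for n
    unfolding T_def by (intro fin) (use orb_relc[OF loc sect(1)[OF loc]] in auto)
  have Tmono: "T n \<subseteq> T m" if "n \<le> m" for n m
    unfolding T_def using that by (intro UN_mono) auto
  define C where "C n = mtopology closure_of T n" for n
  have C: "compactin mtopology (C n)" for n unfolding C_def by (rule relc_closure[OF Trel])
  have TC: "T n \<subseteq> C n" for n
    unfolding C_def by (rule closure_of_subset) (use TZ ZM in auto)
  have comp: "compactin X (f ` C n)" for n by (rule image_compactin[OF C cont])
  have inT: "sect x \<in> T (max i m)" if "sect x \<in> orb m (sect (a i))" for x i m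
    using that unfolding T_def by (intro UN_I[of i] UN_I[of m]) auto
  have "tower X (\<lambda>n. f ` C n)"
    unfolding tower_def
  proof (intro conjI allI impI)
    show "Hausdorff_space X" by (rule haus)
    show "incseq (\<lambda>n. f ` C n)"
      unfolding incseq_def C_def by (intro allI impI image_mono closure_of_mono Tmono)
    show "compactin X (f ` C n)" for n by (rule comp)
    show "(\<Union>n. f ` C n) = topspace X"
    proof -
      have "x \<in> (\<Union>n. f ` C n)" for x
      proof -
        obtain i where "cls (a i) = cls x" using a by blast
        then obtain m where "sect x \<in> orb m (sect (a i))" using cls_eq_iff[OF loc] by blast
        then have "sect x \<in> C (max i m)" using inT TC by blast
        then show ?thesis using sect(2)[OF loc, of x] by (metis UN_I UNIV_I imageI)
      qed
      then show ?thesis by auto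
    qed
    fix D assume D: "D \<subseteq> topspace X \<and> (\<forall>n. closedin X (D \<inter> f ` C n))"
    have "sequentially_closedin X D"
      unfolding sequentially_closedin_def
    proof (intro conjI allI impI)
      show "D \<subseteq> topspace X" using D by simp
      fix \<sigma> l assume A: "(\<forall>n. \<sigma> n \<in> D) \<and> limitin X \<sigma> l sequentially"
      have "limitin X (\<lambda>n. f (sect (\<sigma> n))) l sequentially" using A sect(2)[OF loc] by simp
      then obtain q c where q: "strict_mono (q :: nat \<Rightarrow> nat)" "limitin mtopology ((\<lambda>n. sect (\<sigma> n)) \<circ> q) c sequentially"
        by (rule lift_convergent[of "\<lambda>n. sect (\<sigma> n)", OF sect(1)[OF loc]])
      have sZ: "((\<lambda>n. sect (\<sigma> n)) \<circ> q) k \<in> Z" for k using sect(1)[OF loc] by simp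
      obtain k0 where "\<And>k. k \<ge> k0 \<Longrightarrow> (((\<lambda>n. sect (\<sigma> n)) \<circ> q) k0, ((\<lambda>n. sect (\<sigma> n)) \<circ> q) k) \<in> near"
        by (rule convergent_near[OF loc sZ q(2)]) blast
      then have k0: "\<And>k. k \<ge> k0 \<Longrightarrow> (sect (\<sigma> (q k0)), sect (\<sigma> (q k))) \<in> near" by simp
      obtain i where "cls (a i) = cls (\<sigma> (q k0))" using a by blast
      then obtain m where m: "sect (\<sigma> (q k0)) \<in> orb m (sect (a i))" using cls_eq_iff[OF loc] by blast
      \<comment> \<open>One more near-step leads from the term at k0 to every later term.\<close>
      define N where "N = max i (Suc m)"
      have inN: "\<sigma> (q k) \<in> D \<inter> f ` C N" if "k \<ge> k0" for k
      proof -
        have "sect (\<sigma> (q k)) \<in> orb (Suc m) (sect (a i))"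
          unfolding orb_Suc[OF loc] using m k0[OF that] by blast
        then have "sect (\<sigma> (q k)) \<in> C N" unfolding N_def using inT TC by blast
        then show ?thesis using A sect(2)[OF loc, of "\<sigma> (q k)"] by (metis IntI imageI)
      qed
      have "limitin X (\<lambda>k. \<sigma> (q k)) l sequentially"
        using limitin_subsequence[OF q(1), of X \<sigma> l] A by (simp add: o_def)
      moreover have "closedin X (D \<inter> f ` C N)" using D by blast
      moreover have "\<forall>\<^sub>F k in sequentially. \<sigma> (q k) \<in> D \<inter> f ` C N"
        unfolding eventually_sequentially using inN by blast
      ultimately have "l \<in> D \<inter> f ` C N" by (rule limitin_closedin) simp
      then show "l \<in> D" by simp
    qed
    then show "closedin X D" using seqsp by (simp add: sequential_space_def)
  qed
  with C show thesis by (rule that)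
qed

text \<open>D n k is the part of C n at distance at least 1/(k+1) from the zeros of f in C n. Its
  image is compact and misses 0, and every nonzero point of X lies in one of these countably many
  images.\<close>

lemma zero_separating:
  fixes C :: "nat \<Rightarrow> 'm set"
  assumes C: "\<And>n. compactin mtopology (C n)" and cov: "(\<Union>n. f ` C n) = UNIV"
  obtains W :: "nat \<Rightarrow> 'a set" where "\<And>m. znhd X (W m)" "\<And>m. abscon (W m)" "(\<Inter>m. W m) \<subseteq> {0}"
proof -
  define D where "D n k = C n - (\<Union>z\<in>{z \<in> C n. f z = 0}. mball z (inverse (real (Suc k))))" for n k
  have CM: "C n \<subseteq> M" for n using compactin_subset_topspace[OF C] by simp
  have Dc: "compactin X (f ` D n k)" for n k
  proof (rule image_compactin[OF _ cont])
    have "closedin mtopology (M - (\<Union>z\<in>{z \<in> C n. f z = 0}. mball z (inverse (real (Suc k)))))"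
      by (intro closedin_diff openin_Union) (auto simp: closedin_def[of _ M])
    from closed_Int_compactin[OF this C[of n]]
    have "compactin mtopology ((M - (\<Union>z\<in>{z \<in> C n. f z = 0}. mball z (inverse (real (Suc k))))) \<inter> C n)" .
    moreover have "(M - (\<Union>z\<in>{z \<in> C n. f z = 0}. mball z (inverse (real (Suc k))))) \<inter> C n = D n k"
      using CM[of n] by (auto simp: D_def)
    ultimately show "compactin mtopology (D n k)" by simp
  qed
  have D0: "0 \<notin> f ` D n k" for n k using CM by (force simp: D_def)
  have "\<exists>W. znhd X W \<and> abscon W \<and> W \<inter> f ` D n k = {}" for n k
    using zero_separated[OF compact_closed[OF Dc] D0, of n k] by metis
  then have "\<forall>p. \<exists>W. znhd X W \<and> abscon W \<and> W \<inter> f ` D (fst p) (snd p) = {}" by blast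
  from choice[OF this] obtain W where W: "\<And>p. znhd X (W p)" "\<And>p. abscon (W p)"
    "\<And>p. W p \<inter> f ` D (fst p) (snd p) = {}" by blast
  show thesis
  proof (rule that[of "\<lambda>m. W (prod_decode m)"])
    show "(\<Inter>m. W (prod_decode m)) \<subseteq> {0}"
    proof (rule subsetI, rule ccontr)
      fix x assume x: "x \<in> (\<Inter>m. W (prod_decode m))" and "x \<notin> {0}"
      then have x0: "x \<noteq> 0" by simp
      have inW: "x \<in> W p" for p
      proof -
        have "x \<in> W (prod_decode (prod_encode p))" using x by blast
        then show ?thesis by simp
      qed
      obtain n c where c: "c \<in> C n" "x = f c" using cov by blast
      have "openin X (UNIV - {0})"
        using openin_diff[OF openin_topspace[of X] compact_closed[of "{0}"]] by simp
      from openin_continuous_map_preimage[OF cont this]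
      have "openin mtopology {z \<in> M. f z \<noteq> 0}" by simp
      then obtain e where e: "e > 0" "mball c e \<subseteq> {z \<in> M. f z \<noteq> 0}"
        unfolding openin_mtopology using c x0 CM by blast
      obtain k where k: "inverse (real (Suc k)) < e" using reals_Archimedean[OF e(1)] by blast
      have "c \<in> D n k"
      proof (rule ccontr)
        assume "c \<notin> D n k"
        then obtain z where z: "z \<in> C n" "f z = 0" "c \<in> mball z (inverse (real (Suc k)))"
          using c(1) by (auto simp: D_def simp del: in_mball of_nat_Suc)
        then have "z \<in> mball c e" using k commute[of z c] by (auto simp del: of_nat_Suc)
        then show False using e(2) z(2) by blast
      qed
      then show False using W(3)[of "(n, k)"] inW[of "(n, k)"] c(2) by auto
    qed
  qed (use W in auto)
qed

end

end

section \<open>Locally convex spaces that are inductive limits of compact sets\<close>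

text \<open>From here on only the tower and the metric D are used; the subproper map is
  discarded.\<close>

lemma (in lcs) kstar_tower:
  assumes seq: "sequential_space X" and k: "kstar_metrizable_space TYPE('m) X"
    and nm: "\<not> metrizable_space X"
  obtains K D where "tower X K" "D 0 = (0::real)" "\<And>x. D x = 0 \<Longrightarrow> x = 0" "\<And>x. 0 \<le> D x" "\<And>x. D (- x) = D x"
    "\<And>x y. D (x + y) \<le> D x + D y" "\<And>e. e > 0 \<Longrightarrow> znhd X {x. D x < e}"
proof -
  obtain T :: "'m topology" and f where T: "metrizable_space T" "subproper_map T X f"
    using k unfolding kstar_metrizable_space_def by blast
  obtain M rho where M: "Metric_space M rho" "T = Metric_space.mtopology M rho"
    using T(1) unfolding metrizable_space_def by blast
  interpret Metric_space M rho by (rule M(1))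
  obtain Z where Z: "Z \<subseteq> M" "f ` Z = UNIV"
    "\<And>K. precompactin X K \<Longrightarrow> precompactin mtopology (Z \<inter> f -` K)"
    and cont: "continuous_map mtopology X f"
    using T(2) unfolding subproper_map_def M(2) by auto
  interpret kstar X M rho f Z
    by unfold_locales (use cont Z seq in auto)
  have "\<exists>x. fan x" using no_fan_imp_metrizable nm by blast
  then have "\<nexists>y. metric_fan y" using fan_metric_fan_incompatible[OF seq] by blast
  then have loc: loc_relc by (rule no_metric_fan_imp_loc_relc)
  obtain C where C: "\<And>n. compactin mtopology (C n)" "tower X (\<lambda>n. f ` C n)"
    by (rule kw_tower[OF loc]) blast
  have "(\<Union>n. f ` C n) = UNIV" using C(2) by (simp add: tower_def)
  with C(1) obtain W :: "nat \<Rightarrow> 'a set" where "\<And>m. znhd X (W m)" "\<And>m. abscon (W m)" "(\<Inter>m. W m) \<subseteq> {0}"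
    by (rule zero_separating[OF loc]) blast
  then obtain D where "D 0 = (0::real)" "\<And>x. D x = 0 \<Longrightarrow> x = 0" "\<And>x. 0 \<le> D x" "\<And>x. D (- x) = D x"
    "\<And>x y. D (x + y) \<le> D x + D y" "\<And>e. e > 0 \<Longrightarrow> znhd X {x. D x < e}"
    by (rule invariant_metric) blast
  with C(2) show thesis by (rule that)
qed

text \<open>Otherwise choose x n in C outside K n. Every subset of the range meets each K m in a
  finite set and is therefore closed, so the range is an infinite subset of C without accumulation
  points.\<close>

lemma tower_compact:
  assumes tw: "tower X K" and C: "compactin X C"
  obtains n where "C \<subseteq> K n"
proof (rule ccontr)
  assume no: "\<not> thesis"
  have "\<forall>n. \<exists>x. x \<in> C \<and> x \<notin> K n" using no that by blast
  from choice[OF this] obtain x where x: "\<And>n. x n \<in> C" "\<And>n. x n \<notin> K n" by blast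
  have hX: "Hausdorff_space X" and inc: "incseq K" using tw by (auto simp: tower_def)
  have CX: "C \<subseteq> topspace X" using C by (rule compactin_subset_topspace)
  have fin: "finite (range x \<inter> K n)" for n
  proof (rule finite_subset)
    show "range x \<inter> K n \<subseteq> x ` {..<n}"
    proof clarify
      fix m assume "x m \<in> K n"
      then have "m < n" using x(2)[of m] inc unfolding incseq_def by (metis not_le subsetD)
      then show "x m \<in> x ` {..<n}" by blast
    qed
  qed simp
  have closed: "closedin X T" if "T \<subseteq> range x" for T
  proof -
    have "closedin X (T \<inter> K n)" for n
    proof (rule compactin_imp_closedin[OF hX], rule finite_imp_compactin)
      show "T \<inter> K n \<subseteq> topspace X" using that x(1) CX by blast
      show "finite (T \<inter> K n)" using fin[of n] that by (meson finite_subset inf_mono order_refl)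
    qed
    moreover have "T \<subseteq> topspace X" using that x(1) CX by blast
    ultimately show ?thesis using tw unfolding tower_def by blast
  qed
  have "infinite (range x)"
  proof
    assume "finite (range x)"
    then obtain x0 where "infinite {n. x n = x0}"
      using inf_img_fin_dom[of x UNIV] by (auto simp: vimage_def)
    then obtain n0 where "x n0 = x0" by (metis (mono_tags, lifting) Collect_empty_eq finite.emptyI)
    have "x0 \<in> topspace X" using \<open>x n0 = x0\<close> x(1) CX by blast
    then obtain m where m: "x0 \<in> K m" using tw unfolding tower_def by blast
    obtain n where "n \<ge> m" "x n = x0"
      using \<open>infinite {n. x n = x0}\<close> unfolding infinite_nat_iff_unbounded_le by blast
    then show False using x(2)[of n] m inc unfolding incseq_def by blast
  qed
  then have "C \<inter> X derived_set_of range x \<noteq> {}"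
    by (intro compactin_imp_Bolzano_Weierstrass[OF C]) (use x(1) in auto)
  then obtain a where a: "a \<in> X derived_set_of range x" by blast
  have "closedin X (range x - {a})" by (rule closed) blast
  then have "openin X (topspace X - (range x - {a}))" by blast
  moreover have "a \<in> topspace X" using a by (simp add: in_derived_set_of)
  moreover have "\<forall>T. a \<in> T \<and> openin X T \<longrightarrow> (\<exists>y. y \<noteq> a \<and> y \<in> range x \<and> y \<in> T)"
    using a unfolding in_derived_set_of by simp
  ultimately have "\<exists>y. y \<noteq> a \<and> y \<in> range x \<and> y \<in> topspace X - (range x - {a})"
    by (elim allE[of _ "topspace X - (range x - {a})"]) simp
  then show False by blast
qed

section \<open>Non-metrizable spaces with a tower and a continuous invariant metric\<close>

locale kw = lcs X for X :: "'a::real_vector topology" +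
  fixes K :: "nat \<Rightarrow> 'a set" and D :: "'a \<Rightarrow> real"
  assumes tw: "tower X K" and D: "D 0 = 0" "\<And>x. D x = 0 \<Longrightarrow> x = 0" "\<And>x. 0 \<le> D x" "\<And>x. D (- x) = D x"
    "\<And>x y. D (x + y) \<le> D x + D y" "\<And>e. e > 0 \<Longrightarrow> znhd X {x. D x < e}"
    and seqsp: "sequential_space X" and nm: "\<not> metrizable_space X"
begin

lemma metric: "Metric_space UNIV (\<lambda>x y. D (x - y))"
  by (rule norm_metric) (use D in auto)

lemma open_ball: "openin X {y. D (x - y) < e}"
  unfolding openin_iff_znhd
proof
  fix y assume y: "y \<in> {y. D (x - y) < e}"
  then have "znhd X {z. D z < e - D (x - y)}" by (intro D) simp
  then show "znhd X {z. y + z \<in> {y. D (x - y) < e}}"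
  proof (rule znhd_mono, clarify)
    fix z assume "D z < e - D (x - y)"
    then show "D (x - (y + z)) < e" using D(5)[of "x - y" "- z"] D(4)[of z] by (simp add: algebra_simps)
  qed
qed

lemma compact_metric:
  assumes "compactin X C"
  shows "subtopology X C = Metric_space.mtopology C (\<lambda>x y. D (x - y))"
  by (rule subtopology_compact_metric[OF metric _ assms]) (use open_ball in simp)

lemma compact_seq:
  assumes C: "compactin X C" and x: "\<And>n::nat. x n \<in> C"
  obtains r l where "strict_mono (r :: nat \<Rightarrow> nat)" "l \<in> C" "limitin X (x \<circ> r) l sequentially"
proof -
  interpret U: Metric_space UNIV "\<lambda>x y. D (x - y)" by (rule metric)
  interpret M: Metric_space C "\<lambda>x y. D (x - y)" by (rule U.subspace) simp
  have "compactin M.mtopology C"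
    using C by (simp add: compact_metric[OF C, symmetric] compactin_subtopology)
  then obtain l r where r: "l \<in> C" "strict_mono (r :: nat \<Rightarrow> nat)" "limitin M.mtopology (x \<circ> r) l sequentially"
    unfolding M.compactin_sequentially using x by (metis image_subset_iff)
  then have "limitin X (x \<circ> r) l sequentially"
    by (simp add: compact_metric[OF C, symmetric] limitin_subtopology)
  with r show thesis using that by blast
qed

lemma compact_metric_limit:
  assumes C: "compactin X C" and x: "\<And>n::nat. x n \<in> C" "l \<in> C" and lim: "(\<lambda>n. D (x n - l)) \<longlonglongrightarrow> 0"
  shows "limitin X x l sequentially"
proof -
  interpret U: Metric_space UNIV "\<lambda>x y. D (x - y)" by (rule metric)
  interpret M: Metric_space C "\<lambda>x y. D (x - y)" by (rule U.subspace) simp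
  have "limitin M.mtopology x l sequentially"
    unfolding M.limitin_metric_dist_null using x lim by simp
  then show ?thesis by (simp add: compact_metric[OF C, symmetric] limitin_subtopology)
qed

lemma compact_in_K:
  assumes "compactin X C"
  obtains n where "C \<subseteq> K n"
  using tower_compact[OF tw assms] by blast

lemma K_compact: "compactin X (K n)"
  using tw by (simp add: tower_def)

text \<open>If x n in S avoids (n+1) K n for all n, then x n / (n+1) is a null sequence by
  boundedness. It lies in some K N, which contradicts the choice of x N.\<close>

lemma bounded_precompact:
  assumes S: "\<And>V. znhd X V \<Longrightarrow> abscon V \<Longrightarrow> \<exists>t>0. S \<subseteq> (*\<^sub>R) t ` V"
  obtains C where "compactin X C" "S \<subseteq> C"
proof (rule ccontr)
  assume no: "\<not> thesis"
  have "\<forall>n. \<exists>x. x \<in> S \<and> x \<notin> (*\<^sub>R) (real (Suc n)) ` K n"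
    using no that[OF compact_scaled[OF K_compact]] by blast
  from choice[OF this] obtain x where x: "\<And>n. x n \<in> S" "\<And>n. x n \<notin> (*\<^sub>R) (real (Suc n)) ` K n" by blast
  define y where "y n = (1/real (Suc n)) *\<^sub>R x n" for n
  have "limitin X y 0 sequentially"
    unfolding limitin_iff_znhd
  proof clarify
    fix V assume "znhd X V"
    then obtain V' where V': "znhd X V'" "abscon V'" "V' \<subseteq> V" by (rule znhd_abscon)
    obtain t where t: "t > 0" "S \<subseteq> (*\<^sub>R) t ` V'" using S[OF V'(1,2)] by blast
    obtain N where N: "t \<le> real N" using real_arch_simple by blast
    have "y n - 0 \<in> V" if "n \<ge> N" for n
    proof -
      obtain v where v: "v \<in> V'" "x n = t *\<^sub>R v" using t(2) x(1)[of n] by blast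
      have "t \<le> real (Suc n)" using N that by simp
      then have "(t / real (Suc n)) *\<^sub>R v \<in> V'" using t(1) by (intro abscon_scale[OF V'(2) v(1)]) simp
      then show ?thesis using v(2) V'(3) by (auto simp: y_def)
    qed
    then show "\<forall>\<^sub>F n in sequentially. y n - 0 \<in> V" unfolding eventually_sequentially by blast
  qed
  from compact_lim_seq[OF this] obtain N where "insert 0 (range y) \<subseteq> K N" by (rule compact_in_K)
  then have "y N \<in> K N" by blast
  moreover have "x N = real (Suc N) *\<^sub>R y N" by (simp add: y_def del: of_nat_Suc)
  ultimately show False using x(2)[of N] by blast
qed

text \<open>The absolutely convex hull of a bounded set is bounded, so
  \<open>bounded_precompact\<close> applies in place of completeness.\<close>

lemma compact_abscon_hull:
  assumes C: "compactin X C"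
  obtains L where "compactin X L" "abscon L" "C \<subseteq> L"
proof -
  define S where "S = convex hull (insert 0 C \<union> (*\<^sub>R) (-1) ` insert 0 C)"
  have "(*\<^sub>R) (-1) ` S = S"
    unfolding S_def convex_hull_scaling[symmetric]
    by (simp add: image_Un image_image Un_commute)
  then have "- x \<in> S" if "x \<in> S" for x using that by (metis imageI scaleR_minus1_left)
  moreover have "0 \<in> S" unfolding S_def by (rule hull_inc) simp
  ultimately have aS: "abscon S" unfolding abscon_def S_def by (simp add: convex_convex_hull)
  have "\<exists>t>0. S \<subseteq> (*\<^sub>R) t ` V" if V: "znhd X V" "abscon V" for V
  proof -
    obtain t where t: "t \<ge> 1" "\<And>s. s \<ge> t \<Longrightarrow> C \<subseteq> (*\<^sub>R) s ` V" using compact_bounded[OF C V(1)] by blast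
    have a: "abscon ((*\<^sub>R) t ` V)" by (rule abscon_scaled[OF V(2)])
    have C0: "insert 0 C \<subseteq> (*\<^sub>R) t ` V" using t(2)[of t] abscon_0[OF a] by simp
    have "(-1) *\<^sub>R x \<in> (*\<^sub>R) t ` V" if "x \<in> insert 0 C" for x
      using abscon_minus[OF a subsetD[OF C0 that]] by simp
    with C0 have "insert 0 C \<union> (*\<^sub>R) (-1) ` insert 0 C \<subseteq> (*\<^sub>R) t ` V" by blast
    then have "S \<subseteq> (*\<^sub>R) t ` V" unfolding S_def by (rule hull_minimal) (rule abscon_convex[OF a])
    then show ?thesis using t(1) by (intro exI[of _ t]) simp
  qed
  from bounded_precompact[OF this] obtain B where B: "compactin X B" "S \<subseteq> B" by blast
  have "X closure_of S \<subseteq> B" using B compact_closed by (simp add: closure_of_minimal)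
  then have "compactin X (X closure_of S)" using B(1) closed_compactin closedin_closure_of by blast
  moreover have "C \<subseteq> X closure_of S"
    using closure_of_subset[of S X] hull_subset[of "insert 0 C \<union> (*\<^sub>R) (-1) ` insert 0 C" convex] by (auto simp: S_def)
  ultimately show thesis using that[of "X closure_of S"] abscon_closure[OF aS] by blast
qed

text \<open>If all null sequences met L, the span V of L would be open, because a sequence outside V
  with limit l in V becomes a null sequence outside L after subtracting l. So L would be absorbing,
  and it would even be a compact neighbourhood of 0, making X metrizable.\<close>

lemma null_sequence_outside:
  assumes L: "compactin X L" "abscon L"
  obtains p where "\<And>n::nat. p n \<notin> L" "limitin X p 0 sequentially"
proof (rule ccontr)
  note obt = that
  assume nt: "\<not> thesis"
  have no: "False" if "\<And>n::nat. p n \<notin> L" "limitin X p 0 sequentially" for p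
    using obt[OF that] nt by blast
  define V where "V = (\<Union>t. (*\<^sub>R) t ` L)"
  have LV: "L \<subseteq> V" unfolding V_def by (intro subsetI UN_I[of 1]) auto
  have V: "subspace V"
    unfolding subspace_def
  proof (intro conjI ballI allI)
    show "0 \<in> V" using LV abscon_0[OF L(2)] by blast
    fix x y assume "x \<in> V" "y \<in> V"
    then obtain s a t b where st: "a \<in> L" "b \<in> L" "x = s *\<^sub>R a" "y = t *\<^sub>R b" by (auto simp: V_def)
    define u where "u = \<bar>s\<bar> + \<bar>t\<bar> + 1"
    have "u > 0" "\<bar>s / u\<bar> + \<bar>t / u\<bar> \<le> 1" by (auto simp: u_def abs_divide add_divide_distrib[symmetric])
    then have "(s / u) *\<^sub>R a + (t / u) *\<^sub>R b \<in> L" using st by (intro abscon_combine[OF L(2)]) auto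
    moreover have "x + y = u *\<^sub>R ((s / u) *\<^sub>R a + (t / u) *\<^sub>R b)"
      using \<open>u > 0\<close> st by (simp add: scaleR_add_right)
    ultimately show "x + y \<in> V" unfolding V_def by blast
  next
    fix c x assume "x \<in> V"
    then show "c *\<^sub>R x \<in> V" unfolding V_def by (auto simp: image_iff) (metis scaleR_scaleR)
  qed
  have "sequentially_closedin X (UNIV - V)"
    unfolding sequentially_closedin_def
  proof (intro conjI allI impI, simp)
    fix \<sigma> l assume A: "(\<forall>n. \<sigma> n \<in> UNIV - V) \<and> limitin X \<sigma> l sequentially"
    show "l \<in> UNIV - V"
    proof (rule ccontr)
      assume "l \<notin> UNIV - V"
      then have l: "l \<in> V" by simp
      have "\<sigma> n - l \<notin> L" for n
      proof
        assume "\<sigma> n - l \<in> L"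
        then have "(\<sigma> n - l) + l \<in> V" using LV l by (intro subspace_add[OF V]) auto
        then show False using A by simp
      qed
      moreover have "limitin X (\<lambda>n. \<sigma> n - l) (l - l) sequentially" by (rule lim_diff) (use A in auto)
      ultimately show False using no[of "\<lambda>n. \<sigma> n - l"] by simp
    qed
  qed
  then have "closedin X (UNIV - V)" using seqsp by (simp add: sequential_space_def)
  then have "openin X V" by (simp add: closedin_def Diff_Diff_Int)
  then have VU: "V = UNIV" using open_subspace_UNIV[OF V] by blast
  \<comment> \<open>Counterexamples would be D-null in the compact set 2L, where D-convergence is
    convergence in X, and so would be a null sequence outside L.\<close>
  have "\<exists>e>0. \<forall>x. D x < e \<longrightarrow> x \<in> (*\<^sub>R) 2 ` L \<longrightarrow> x \<in> L"
  proof (rule ccontr)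
    assume "\<not> ?thesis"
    then have "\<forall>n. \<exists>x. D x < inverse (real (Suc n)) \<and> x \<in> (*\<^sub>R) 2 ` L \<and> x \<notin> L"
      by (metis inverse_positive_iff_positive of_nat_0_less_iff zero_less_Suc)
    from choice[OF this] obtain x where x: "\<And>n. D (x n) < inverse (real (Suc n))" "\<And>n. x n \<in> (*\<^sub>R) 2 ` L" "\<And>n. x n \<notin> L"
      by blast
    have "(\<lambda>n. D (x n - 0)) \<longlonglongrightarrow> 0"
    proof (rule tendsto_sandwich[OF _ _ tendsto_const LIMSEQ_inverse_real_of_nat])
      show "\<forall>\<^sub>F n in sequentially. D (x n - 0) \<le> inverse (real (Suc n))"
        using x(1) less_imp_le by (intro always_eventually allI) fastforce
    qed (use D(3) in simp)
    from compact_metric_limit[OF compact_scaled[OF L(1)] x(2) abscon_0[OF abscon_scaled[OF L(2)]] this]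
    have "limitin X x 0 sequentially" .
    then show False using no[of x] x(3) by blast
  qed
  then obtain e where e: "e > 0" "\<And>x. D x < e \<Longrightarrow> x \<in> (*\<^sub>R) 2 ` L \<Longrightarrow> x \<in> L" by blast
  obtain U where U: "znhd X U" "abscon U" "U \<subseteq> {x. D x < e}" using D(6)[OF e(1)] by (rule znhd_abscon)
  have pw: "x \<in> L" if "x \<in> U" "x \<in> (*\<^sub>R) (2^n) ` L" for n x
    using that
  proof (induction n arbitrary: x)
    case 0
    then show ?case by simp
  next
    case (Suc n)
    have "(1/2) *\<^sub>R x \<in> U" by (rule abscon_scale[OF U(2) Suc.prems(1)]) simp
    moreover have "(1/2) *\<^sub>R x \<in> (*\<^sub>R) (2^n) ` L" using Suc.prems(2) by auto
    ultimately have "(1/2) *\<^sub>R x \<in> L" by (rule Suc.IH)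
    then have "2 *\<^sub>R ((1/2) *\<^sub>R x) \<in> (*\<^sub>R) 2 ` L" by (rule imageI)
    then show ?case using e(2)[of x] U(3) Suc.prems(1) by auto
  qed
  have "U \<subseteq> L"
  proof
    fix x assume x: "x \<in> U"
    have "x \<in> V" using VU by simp
    then obtain t a where a: "a \<in> L" "x = t *\<^sub>R a" by (auto simp: V_def)
    obtain n where n: "\<bar>t\<bar> < 2^n" using real_arch_pow[of 2 "\<bar>t\<bar>"] by auto
    have "(t / 2^n) *\<^sub>R a \<in> L" using n by (intro abscon_scale[OF L(2) a(1)]) simp
    moreover have "x = (2^n) *\<^sub>R ((t / 2^n) *\<^sub>R a)" using a(2) by simp
    ultimately have "x \<in> (*\<^sub>R) (2^n) ` L" by blast
    then show "x \<in> L" by (rule pw[OF x])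
  qed
  then have "znhd X L" using U(1) znhd_mono by blast
  then show False using compact_nhd_metrizable[OF L(1)] nm by blast
qed

end

text \<open>If the segments from p to q and from p to -q both met L, solving for p and q in terms of
  the two points of L would put p or q into 3L.\<close>

lemma segment_avoids:
  assumes L: "abscon L" and p: "p \<notin> (*\<^sub>R) 3 ` L" and q: "q \<notin> (*\<^sub>R) 3 ` L"
  shows "\<exists>\<sigma>\<in>{1, - 1 :: real}. \<forall>s\<in>{0..1}. (1 - s) *\<^sub>R p + (s * \<sigma>) *\<^sub>R q \<notin> L"
proof (rule ccontr)
  assume no: "\<not> ?thesis"
  obtain s where s: "0 \<le> s" "s \<le> 1" "(1 - s) *\<^sub>R p + s *\<^sub>R q \<in> L" using no by force
  obtain t where t: "0 \<le> t" "t \<le> 1" "(1 - t) *\<^sub>R p - t *\<^sub>R q \<in> L" using no by force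
  \<comment> \<open>Up to sign the determinant of the linear system for p and q; the two equations
    for \<open>k *\<^sub>R p\<close> and \<open>k *\<^sub>R q\<close> below are Cramer's
    rule.\<close>
  define k where "k = (1 - s) * t + s * (1 - t)"
  have key: "3 * k < w" if comb: "k *\<^sub>R r = \<alpha> *\<^sub>R ((1 - s) *\<^sub>R p + s *\<^sub>R q) + \<beta> *\<^sub>R ((1 - t) *\<^sub>R p - t *\<^sub>R q)"
    and w: "\<bar>\<alpha>\<bar> + \<bar>\<beta>\<bar> = w" and r: "r \<notin> (*\<^sub>R) 3 ` L" and kp: "k > 0" for r \<alpha> \<beta> w
  proof (rule ccontr)
    assume "\<not> 3 * k < w"
    then have "\<bar>\<alpha> / (3*k)\<bar> + \<bar>\<beta> / (3*k)\<bar> \<le> 1"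
      using w kp by (simp add: add_divide_distrib[symmetric])
    then have "(\<alpha> / (3*k)) *\<^sub>R ((1 - s) *\<^sub>R p + s *\<^sub>R q) + (\<beta> / (3*k)) *\<^sub>R ((1 - t) *\<^sub>R p - t *\<^sub>R q) \<in> L"
      by (rule abscon_combine[OF L s(3) t(3)])
    moreover have "(\<alpha> / (3*k)) *\<^sub>R ((1 - s) *\<^sub>R p + s *\<^sub>R q) + (\<beta> / (3*k)) *\<^sub>R ((1 - t) *\<^sub>R p - t *\<^sub>R q)
        = (1/(3*k)) *\<^sub>R (k *\<^sub>R r)"
      unfolding comb scaleR_add_right scaleR_scaleR by simp
    ultimately have "(1/3) *\<^sub>R r \<in> L" using kp by simp
    then have "3 *\<^sub>R ((1/3) *\<^sub>R r) \<in> (*\<^sub>R) 3 ` L" by (rule imageI)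
    then show False using r by simp
  qed
  have lin: "c *\<^sub>R (a1 *\<^sub>R p + a2 *\<^sub>R q) + d *\<^sub>R (b1 *\<^sub>R p - b2 *\<^sub>R q) =
      (c * a1 + d * b1) *\<^sub>R p + (c * a2 - d * b2) *\<^sub>R q" for a1 a2 b1 b2 c d :: real
    by (simp add: algebra_simps)
  have "t *\<^sub>R ((1 - s) *\<^sub>R p + s *\<^sub>R q) + s *\<^sub>R ((1 - t) *\<^sub>R p - t *\<^sub>R q) =
      (t * (1 - s) + s * (1 - t)) *\<^sub>R p + (t * s - s * t) *\<^sub>R q"
    by (rule lin)
  then have 1: "k *\<^sub>R p = t *\<^sub>R ((1 - s) *\<^sub>R p + s *\<^sub>R q) + s *\<^sub>R ((1 - t) *\<^sub>R p - t *\<^sub>R q)"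
    by (simp add: k_def mult.commute)
  have "(1 - t) *\<^sub>R ((1 - s) *\<^sub>R p + s *\<^sub>R q) + (- (1 - s)) *\<^sub>R ((1 - t) *\<^sub>R p - t *\<^sub>R q) =
      ((1 - t) * (1 - s) + (- (1 - s)) * (1 - t)) *\<^sub>R p + ((1 - t) * s - (- (1 - s)) * t) *\<^sub>R q"
    by (rule lin)
  moreover have "(1 - t) * (1 - s) + (- (1 - s)) * (1 - t) = 0" "(1 - t) * s - (- (1 - s)) * t = k"
    by (simp_all add: k_def algebra_simps)
  ultimately have 2: "k *\<^sub>R q = (1 - t) *\<^sub>R ((1 - s) *\<^sub>R p + s *\<^sub>R q) + (- (1 - s)) *\<^sub>R ((1 - t) *\<^sub>R p - t *\<^sub>R q)"
    by (simp only: scaleR_zero_left add_0)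
  \<comment> \<open>Since k = s + t - 2st, this is 4st at most the square of s + t. It gives k at
    least half the smaller of s + t and 2 - (s + t), against 3k being below both.\<close>
  have sq: "k \<ge> (s + t) * (2 - (s + t)) / 2"
  proof -
    have "k = s + t - 2 * (s * t)" by (simp add: k_def algebra_simps)
    moreover have "(s + t) * (2 - (s + t)) / 2 = s + t - (s * s + 2 * (s * t) + t * t) / 2"
      by (simp add: field_simps)
    moreover have "0 \<le> s * s - 2 * (s * t) + t * t"
      using zero_le_square[of "s - t"] by (simp add: algebra_simps)
    ultimately show ?thesis by simp
  qed
  show False
  proof (cases "k = 0")
    case True
    have "(1 - s) * t \<ge> 0" "s * (1 - t) \<ge> 0" using s t by auto
    then have z: "(1 - s) * t = 0" "s * (1 - t) = 0" using True unfolding k_def by linarith+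
    have sub: "L \<subseteq> (*\<^sub>R) 3 ` L"
    proof
      fix x assume "x \<in> L"
      then have "(1/3) *\<^sub>R x \<in> L" by (rule abscon_scale[OF L]) simp
      then have "3 *\<^sub>R ((1/3) *\<^sub>R x) \<in> (*\<^sub>R) 3 ` L" by (rule imageI)
      then show "x \<in> (*\<^sub>R) 3 ` L" by simp
    qed
    from z have "s = 0 \<and> t = 0 \<or> s = 1 \<and> t = 1" by auto
    then show False using s t p q sub abscon_minus[OF L t(3)] by auto
  next
    case False
    have "(1 - s) * t \<ge> 0" "s * (1 - t) \<ge> 0" using s t by auto
    then have kp: "k > 0" using False by (auto simp: k_def)
    have b1: "3 * k < t + s" by (rule key[OF 1 _ p kp]) (use s t in auto)
    have b2: "3 * k < 2 - (s + t)" by (rule key[OF 2 _ q kp]) (use s t in auto)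
    show False
    proof (cases "s + t \<le> 1")
      case True
      then have "(s + t) * 1 \<le> (s + t) * (2 - (s + t))" using s t by (intro mult_left_mono) auto
      then have "(s + t) / 2 \<le> (s + t) * (2 - (s + t)) / 2" by (simp only: mult_1_right divide_right_mono zero_le_numeral)
      then have "(s + t) / 2 \<le> k" using sq by (rule order_trans)
      then show False using b1 s(1) t(1) by argo
    next
      case False
      then have "1 * (2 - (s + t)) \<le> (s + t) * (2 - (s + t))" using s t by (intro mult_right_mono) auto
      then have "(2 - (s + t)) / 2 \<le> (s + t) * (2 - (s + t)) / 2" by (simp only: mult_1_left divide_right_mono zero_le_numeral)
      then have "(2 - (s + t)) / 2 \<le> k" using sq by (rule order_trans)
      then show False using b2 s(2) t(2) by argo
    qed
  qed
qed

context kw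
begin

text \<open>\<open>segment_avoids\<close> fixes the sign of each point relative to its predecessor;
  partial products of these signs make all choices consistent, as L is symmetric.\<close>

lemma null_path_outside:
  assumes L: "compactin X L" "abscon L"
  obtains P where "limitin X P 0 sequentially"
    "\<And>n s. 0 \<le> s \<Longrightarrow> s \<le> 1 \<Longrightarrow> (1 - s) *\<^sub>R P n + s *\<^sub>R P (Suc n) \<notin> L"
proof -
  obtain p where p: "\<And>n::nat. p n \<notin> (*\<^sub>R) 3 ` L" "limitin X p 0 sequentially"
    using null_sequence_outside[OF compact_scaled[OF L(1)] abscon_scaled[OF L(2)], of 3] by blast
  have "\<forall>n. \<exists>\<sigma>. \<sigma> \<in> {1, - 1 :: real} \<and> (\<forall>s\<in>{0..1}. (1 - s) *\<^sub>R p n + (s * \<sigma>) *\<^sub>R p (Suc n) \<notin> L)"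
    using segment_avoids[OF L(2) p(1) p(1)] by blast
  from choice[OF this] obtain \<sigma> where \<sigma>: "\<And>n. \<sigma> n \<in> {1, - 1 :: real}"
    "\<And>n s. s \<in> {0..1} \<Longrightarrow> (1 - s) *\<^sub>R p n + (s * \<sigma> n) *\<^sub>R p (Suc n) \<notin> L" by blast
  define \<epsilon> where "\<epsilon> n = (\<Prod>i<n. \<sigma> i)" for n
  have eps: "\<epsilon> n = 1 \<or> \<epsilon> n = - 1" for n
  proof (induction n)
    case (Suc n)
    then show ?case using \<sigma>(1)[of n] by (auto simp: \<epsilon>_def)
  qed (simp add: \<epsilon>_def)
  have epsS: "\<epsilon> (Suc n) = \<epsilon> n * \<sigma> n" for n by (simp add: \<epsilon>_def)
  show thesis
  proof (rule that[of "\<lambda>n. \<epsilon> n *\<^sub>R p n"])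
    show "limitin X (\<lambda>n. \<epsilon> n *\<^sub>R p n) 0 sequentially"
      unfolding limitin_iff_znhd
    proof clarify
      fix V assume "znhd X V"
      then obtain V' where V': "znhd X V'" "abscon V'" "V' \<subseteq> V" by (rule znhd_abscon)
      have "\<forall>\<^sub>F n in sequentially. p n - 0 \<in> V'" using p(2) V'(1) unfolding limitin_iff_znhd by blast
      then show "\<forall>\<^sub>F n in sequentially. \<epsilon> n *\<^sub>R p n - 0 \<in> V"
      proof eventually_elim
        case (elim n)
        then show ?case using eps[of n] V'(3) abscon_minus[OF V'(2), of "p n"] by auto
      qed
    qed
  next
    fix n and s :: real assume s: "0 \<le> s" "s \<le> 1"
    have eq: "(1 - s) *\<^sub>R (\<epsilon> n *\<^sub>R p n) + s *\<^sub>R (\<epsilon> (Suc n) *\<^sub>R p (Suc n)) =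
      \<epsilon> n *\<^sub>R ((1 - s) *\<^sub>R p n + (s * \<sigma> n) *\<^sub>R p (Suc n))"
      by (simp add: epsS scaleR_add_right mult_ac)
    have n: "(1 - s) *\<^sub>R p n + (s * \<sigma> n) *\<^sub>R p (Suc n) \<notin> L" using \<sigma>(2) s by simp
    have "v \<in> L" if "\<epsilon> n *\<^sub>R v \<in> L" for v
      using that eps[of n] abscon_minus[OF L(2), of "- v"] by auto
    then show "(1 - s) *\<^sub>R (\<epsilon> n *\<^sub>R p n) + s *\<^sub>R (\<epsilon> (Suc n) *\<^sub>R p (Suc n)) \<notin> L"
      unfolding eq using n by blast
  qed
qed

end

section \<open>Finite-dimensional boxes and spans\<close>

context lcs
begin

definition box :: "'a set \<Rightarrow> 'a set" where
  "box J = {(\<Sum>b\<in>J. v b *\<^sub>R b) |v. \<forall>b\<in>J. \<bar>v b\<bar> \<le> (1::real)}"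

lemma compact_box:
  assumes "finite J"
  shows "compactin X (box J)"
  using assms
proof (induction J rule: finite_induct)
  case empty
  have "box {} = {0}" by (auto simp: box_def)
  then show ?case by simp
next
  case (insert b J)
  have "compactin X {x + y |x y. x \<in> {c *\<^sub>R y |c y. c \<in> {-1..1::real} \<and> y \<in> {b}} \<and> y \<in> box J}"
    by (intro compact_plus compact_scaleset insert.IH) simp
  moreover have "{x + y |x y. x \<in> {c *\<^sub>R y |c y. c \<in> {-1..1::real} \<and> y \<in> {b}} \<and> y \<in> box J} = box (insert b J)"
  proof (intro equalityI subsetI)
    fix z assume "z \<in> {x + y |x y. x \<in> {c *\<^sub>R y |c y. c \<in> {-1..1::real} \<and> y \<in> {b}} \<and> y \<in> box J}"
    then obtain c v where cv: "c \<in> {-1..1}" "\<forall>b\<in>J. \<bar>v b\<bar> \<le> 1" "z = c *\<^sub>R b + (\<Sum>b\<in>J. v b *\<^sub>R b)"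
      by (auto simp: box_def)
    have "(\<Sum>b\<in>J. v b *\<^sub>R b) = (\<Sum>a\<in>J. (v(b := c)) a *\<^sub>R a)"
      using insert.hyps by (intro sum.cong) auto
    then have "z = (\<Sum>a\<in>insert b J. (v(b := c)) a *\<^sub>R a)" using insert.hyps cv(3) by simp
    moreover have "\<forall>a\<in>insert b J. \<bar>(v(b := c)) a\<bar> \<le> 1" using cv(1,2) by auto
    ultimately show "z \<in> box (insert b J)" unfolding box_def by blast
  next
    fix z assume "z \<in> box (insert b J)"
    then obtain v where v: "\<forall>a\<in>insert b J. \<bar>v a\<bar> \<le> 1" "z = (\<Sum>a\<in>insert b J. v a *\<^sub>R a)"
      by (auto simp: box_def)
    have "z = v b *\<^sub>R b + (\<Sum>a\<in>J. v a *\<^sub>R a)" using v(2) insert.hyps by simp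
    moreover have "v b \<in> {-1..1}" using v(1) by auto
    moreover have "(\<Sum>a\<in>J. v a *\<^sub>R a) \<in> box J" unfolding box_def using v(1) by blast
    ultimately show "z \<in> {x + y |x y. x \<in> {c *\<^sub>R y |c y. c \<in> {-1..1::real} \<and> y \<in> {b}} \<and> y \<in> box J}" by blast
  qed
  ultimately show ?case by simp
qed

lemma box_subset_span: "box J \<subseteq> span J"
  unfolding box_def by (auto intro: span_sum span_scale span_base)

text \<open>For each basis vector b the compact set b + box (B - {b}) misses 0 by independence and
  so misses a neighbourhood. A vector in the intersection of these neighbourhoods whose largest
  coordinate, at b, exceeds 1 would land in that set after division by this coordinate.\<close>

lemma independent_coordinates_bounded:
  assumes B: "finite B" "independent B"
  obtains U where "znhd X U" "abscon U" "\<And>v. (\<Sum>b\<in>B. v b *\<^sub>R b) \<in> U \<Longrightarrow> \<forall>b\<in>B. \<bar>v b\<bar> \<le> 1"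
proof -
  have "\<exists>U. znhd X U \<and> abscon U \<and> U \<inter> {b + y |y. y \<in> box (B - {b})} = {}" if b: "b \<in> B" for b
  proof -
    have "compactin X {x + y |x y. x \<in> {b} \<and> y \<in> box (B - {b})}"
      by (intro compact_plus compact_box) (use B in auto)
    then have "closedin X {x + y |x y. x \<in> {b} \<and> y \<in> box (B - {b})}" by (rule compact_closed)
    moreover have "{x + y |x y. x \<in> {b} \<and> y \<in> box (B - {b})} = {b + y |y. y \<in> box (B - {b})}" by auto
    ultimately have c: "closedin X {b + y |y. y \<in> box (B - {b})}" by simp
    have n: "0 \<notin> {b + y |y. y \<in> box (B - {b})}"
    proof
      assume "0 \<in> {b + y |y. y \<in> box (B - {b})}"
      then obtain y where y: "y \<in> box (B - {b})" "b + y = 0" by auto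
      then have "b = - y" by (simp add: eq_neg_iff_add_eq_0)
      moreover have "- y \<in> span (B - {b})" using box_subset_span y(1) by (blast intro: span_neg)
      ultimately show False using B(2) b unfolding dependent_def by blast
    qed
    obtain V where "znhd X V" "abscon V" "V \<inter> {b + y |y. y \<in> box (B - {b})} = {}"
      by (rule zero_separated[OF c n])
    then show ?thesis by (intro exI[of _ V] conjI)
  qed
  then have "\<forall>b\<in>B. \<exists>U. znhd X U \<and> abscon U \<and> U \<inter> {b + y |y. y \<in> box (B - {b})} = {}" by blast
  from bchoice[OF this] obtain U where U: "\<forall>b\<in>B. znhd X (U b) \<and> abscon (U b) \<and> U b \<inter> {b + y |y. y \<in> box (B - {b})} = {}" ..
  have "znhd X (\<Inter>b\<in>J. U b)" if "finite J" "J \<subseteq> B" for J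
    using that U by (induction J rule: finite_induct) (auto intro: znhd_Int znhd_UNIV)
  then have "znhd X (\<Inter>b\<in>B. U b)" using B(1) by blast
  then obtain W where W: "znhd X W" "abscon W" "W \<subseteq> (\<Inter>b\<in>B. U b)" by (rule znhd_abscon)
  show thesis
  proof (rule that[OF W(1,2)])
    fix v assume v: "(\<Sum>b\<in>B. v b *\<^sub>R b) \<in> W"
    show "\<forall>b\<in>B. \<bar>v b\<bar> \<le> 1"
    proof (rule ccontr)
      assume no: "\<not> ?thesis"
      then have ne: "B \<noteq> {}" by auto
      obtain b where b: "b \<in> B" "\<And>a. a \<in> B \<Longrightarrow> \<bar>v a\<bar> \<le> \<bar>v b\<bar>"
      proof -
        have fin: "finite ((\<lambda>b. \<bar>v b\<bar>) ` B)" using B(1) by simp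
        have "Max ((\<lambda>b. \<bar>v b\<bar>) ` B) \<in> (\<lambda>b. \<bar>v b\<bar>) ` B" using fin ne by (intro Max_in) auto
        then obtain b where "b \<in> B" "\<bar>v b\<bar> = Max ((\<lambda>b. \<bar>v b\<bar>) ` B)" by auto
        then show thesis using Max_ge[OF fin] by (intro that[of b]) auto
      qed
      have vb: "\<bar>v b\<bar> > 1" using no b(2) by force
      then have b0: "v b \<noteq> 0" by auto
      have "(1 / v b) *\<^sub>R (\<Sum>b\<in>B. v b *\<^sub>R b) \<in> W"
        using vb by (intro abscon_scale[OF W(2) v]) (simp add: abs_divide)
      moreover have "(1 / v b) *\<^sub>R (\<Sum>b\<in>B. v b *\<^sub>R b) = b + (\<Sum>a\<in>B - {b}. (v a / v b) *\<^sub>R a)"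
        using vb b0 by (simp add: sum.remove[OF B(1) b(1)] scaleR_add_right scaleR_sum_right)
      moreover have "(\<Sum>a\<in>B - {b}. (v a / v b) *\<^sub>R a) \<in> box (B - {b})"
        unfolding box_def
      proof (intro CollectI exI conjI ballI)
        fix a assume "a \<in> B - {b}"
        then show "\<bar>v a / v b\<bar> \<le> 1" using b(2)[of a] vb by (simp add: abs_divide)
      qed simp
      ultimately have "b + (\<Sum>a\<in>B - {b}. (v a / v b) *\<^sub>R a) \<in> U b \<inter> {b + y |y. y \<in> box (B - {b})}"
        using W(3) b(1) by auto
      then show False using U b(1) by blast
    qed
  qed
qed

lemma in_scaled_box:
  assumes "\<forall>b\<in>B. \<bar>v b\<bar> \<le> t" "t > 0"
  shows "(\<Sum>b\<in>B. v b *\<^sub>R b) \<in> (*\<^sub>R) t ` box B"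
proof (rule image_eqI)
  show "(\<Sum>b\<in>B. v b *\<^sub>R b) = t *\<^sub>R (\<Sum>b\<in>B. (v b / t) *\<^sub>R b)"
    using assms(2) by (simp add: scaleR_sum_right)
  show "(\<Sum>b\<in>B. (v b / t) *\<^sub>R b) \<in> box B"
    unfolding box_def using assms by (intro CollectI exI[of _ "\<lambda>b. v b / t"]) (simp add: abs_divide)
qed

text \<open>Points of the span close to a given x have uniformly bounded coordinates, so x is in the
  closure of a compact multiple of the box.\<close>

lemma closed_span:
  assumes F: "finite F"
  shows "closedin X (span F)"
proof -
  obtain B where B: "B \<subseteq> F" "independent B" "F \<subseteq> span B" by (rule maximal_independent_subset)
  have fB: "finite B" using B(1) F finite_subset by blast
  have spanB: "span F = span B" using B by (metis span_eq span_mono span_superset subset_trans)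
  obtain U where U: "znhd X U" "abscon U" "\<And>v. (\<Sum>b\<in>B. v b *\<^sub>R b) \<in> U \<Longrightarrow> \<forall>b\<in>B. \<bar>v b\<bar> \<le> 1"
    using independent_coordinates_bounded[OF fB B(2)] by blast
  obtain W where W: "znhd X W" "abscon W" "W \<subseteq> U" "\<And>x y. x \<in> W \<Longrightarrow> y \<in> W \<Longrightarrow> x + y \<in> U"
    using U(1) by (rule znhd_half) blast
  have "X closure_of (span B) \<subseteq> span B"
  proof
    fix x assume x: "x \<in> X closure_of (span B)"
    obtain e where e: "e > 0" "\<And>c. \<bar>c\<bar> \<le> e \<Longrightarrow> c *\<^sub>R x \<in> W" using znhd_absorb[OF W(1)] by blast
    define t where "t = 1/e"
    have t: "t > 0" using e by (simp add: t_def)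
    have ex: "(1/t) *\<^sub>R x \<in> W" using e(2)[of e] e(1) by (simp add: t_def)
    have "x \<in> X closure_of ((*\<^sub>R) t ` box B)"
      unfolding closure_iff_znhd
    proof clarify
      fix V assume V: "znhd X V"
      have "znhd X (V \<inter> (*\<^sub>R) t ` W)" using V W(1) t by (intro znhd_Int znhd_scaled) auto
      then obtain s where s: "s \<in> span B" "s - x \<in> V" "s - x \<in> (*\<^sub>R) t ` W"
        using x unfolding closure_iff_znhd by blast
      obtain v where v: "s = (\<Sum>b\<in>B. v b *\<^sub>R b)" using s(1) span_finite[OF fB] by auto
      obtain w where w: "w \<in> W" "s - x = t *\<^sub>R w" using s(3) by blast
      have "(1/t) *\<^sub>R s = (1/t) *\<^sub>R x + (1/t) *\<^sub>R (s - x)" by (simp add: scaleR_diff_right)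
      also have "\<dots> = (1/t) *\<^sub>R x + w" using w(2) t by simp
      finally have "(1/t) *\<^sub>R s \<in> U" using W(4)[OF ex w(1)] by simp
      moreover have "(1/t) *\<^sub>R s = (\<Sum>b\<in>B. (v b / t) *\<^sub>R b)" by (simp add: v scaleR_sum_right)
      ultimately have "\<forall>b\<in>B. \<bar>v b / t\<bar> \<le> 1" using U(3)[of "\<lambda>b. v b / t"] by simp
      then have "s \<in> (*\<^sub>R) t ` box B" unfolding v using t by (intro in_scaled_box) (auto simp: abs_divide field_simps)
      then show "\<exists>s\<in>(*\<^sub>R) t ` box B. s - x \<in> V" using s(2) by blast
    qed
    moreover have "closedin X ((*\<^sub>R) t ` box B)" by (intro compact_closed compact_scaled compact_box fB)
    ultimately have "x \<in> (*\<^sub>R) t ` box B" by (simp add: closure_of_closedin)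
    then show "x \<in> span B" using box_subset_span span_scale by blast
  qed
  then show ?thesis unfolding spanB
    by (metis closure_of_subset_eq subset_UNIV top)
qed

end

lemma sum_half_powers:
  assumes "m \<le> n"
  shows "(\<Sum>j=m..<n. (1/2::real)^j) = 2 * (1/2)^m - 2 * (1/2)^n"
  using assms by (induction n rule: dec_induct) auto

section \<open>Series over a quantitatively independent null sequence\<close>

context kw
begin

text \<open>e j keeps a distance, measured by U j, from the span of all earlier e and of v 0, ..., v
  j, while later e i are so small that tails after e j remain in U j and cannot cancel it.\<close>

lemma independent_null_sequence:
  fixes v :: "nat \<Rightarrow> 'a"
  assumes Kp: "abscon Kp" and inf: "\<And>F. finite F \<Longrightarrow> \<not> Kp \<subseteq> span F"
  obtains e U where "\<And>j::nat. e j \<in> Kp" "\<And>j. closedin X (U j)" "\<And>j. abscon (U j)"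
    "\<And>i j. j < i \<Longrightarrow> (2^(i - j)) *\<^sub>R e i \<in> U j"
    "\<And>j g. g \<in> span (v ` {..j} \<union> e ` {..<j}) \<Longrightarrow> e j - g \<notin> U j"
proof -
  define okU where "okU T \<longleftrightarrow> znhd X T \<and> abscon T \<and> closedin X T" for T
  have step: "\<exists>e U. e \<in> Kp \<and> e \<in> T \<and> okU U \<and> (\<forall>g\<in>span H. e - g \<notin> U)" if H: "finite H" and T: "okU T" for H T
  proof -
    obtain e0 where e0: "e0 \<in> Kp" "e0 \<notin> span H" using inf[OF H] by blast
    obtain \<eta> where \<eta>: "\<eta> > 0" "\<And>c. \<bar>c\<bar> \<le> \<eta> \<Longrightarrow> c *\<^sub>R e0 \<in> T" using T znhd_absorb unfolding okU_def by blast
    define \<tau> where "\<tau> = min 1 \<eta>"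
    have \<tau>: "\<tau> > 0" "\<tau> \<le> 1" "\<tau> \<le> \<eta>" using \<eta>(1) by (auto simp: \<tau>_def)
    define e where "e = \<tau> *\<^sub>R e0"
    have "e \<in> Kp" unfolding e_def using \<tau> by (intro abscon_scale[OF Kp e0(1)]) simp
    moreover have "e \<in> T" unfolding e_def using \<tau> by (intro \<eta>(2)) simp
    moreover have "e \<notin> span H"
    proof
      assume "e \<in> span H"
      then have "(1/\<tau>) *\<^sub>R e \<in> span H" by (rule span_scale)
      then show False using e0(2) \<tau>(1) by (simp add: e_def)
    qed
    then have "0 \<notin> {y. e - y \<in> span H}" by simp
    moreover have "closedin X {y. e - y \<in> span H}"
    proof -
      have "continuous_map X X (\<lambda>y. e - y)" by (intro cont_diff) auto
      from closedin_continuous_map_preimage[OF this closed_span[OF H]] show ?thesis by simp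
    qed
    ultimately obtain U where "znhd X U" "abscon U" "closedin X U" "U \<inter> {y. e - y \<in> span H} = {}"
      using zero_separated[of "{y. e - y \<in> span H}"] by metis
    moreover have "e - g \<notin> U" if "g \<in> span H" for g
      using \<open>U \<inter> _ = {}\<close> that by auto
    ultimately show ?thesis using \<open>e \<in> Kp\<close> \<open>e \<in> T\<close> unfolding okU_def by blast
  qed
  define P where "P n s \<longleftrightarrow> (case s of (e, U, T, H) \<Rightarrow> e \<in> Kp \<and> e \<in> T \<and> okU U \<and> okU T \<and> finite H \<and> v 0 \<in> H \<and> (\<forall>g\<in>span H. e - g \<notin> U))"
    for n :: nat and s :: "'a \<times> 'a set \<times> 'a set \<times> 'a set"
  \<comment> \<open>T collects the smallness conditions for the next vector; halving it at each
    stage produces the factor \<open>2^(i - j)\<close>.\<close>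
  define Q where "Q n s s' \<longleftrightarrow> (case s of (e, U, T, H) \<Rightarrow> case s' of (e', U', T', H') \<Rightarrow>
      T' = (*\<^sub>R) (1/2) ` (T \<inter> U) \<and> H' = insert e (insert (v (Suc n)) H))" for n and s s' :: "'a \<times> 'a set \<times> 'a set \<times> 'a set"
  have okUNIV: "okU UNIV" unfolding okU_def using znhd_UNIV closedin_topspace[of X] by (simp add: abscon_def)
  have okhalf: "okU ((*\<^sub>R) (1/2) ` (T \<inter> U))" if "okU T" "okU U" for T U
  proof -
    have "closedin X {x. 2 *\<^sub>R x \<in> T \<inter> U}"
    proof -
      have "continuous_map X X (\<lambda>y. 2 *\<^sub>R y)" by (intro cont_scale_const) auto
      moreover have "closedin X (T \<inter> U)" using that by (auto simp: okU_def)
      ultimately show ?thesis using closedin_continuous_map_preimage by fastforce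
    qed
    moreover have "{x. 2 *\<^sub>R x \<in> T \<inter> U} = (*\<^sub>R) (1/2) ` (T \<inter> U)"
    proof (intro equalityI subsetI)
      fix x assume "x \<in> {x. 2 *\<^sub>R x \<in> T \<inter> U}"
      then have "2 *\<^sub>R x \<in> T \<inter> U" "x = (1/2) *\<^sub>R (2 *\<^sub>R x)" by auto
      then show "x \<in> (*\<^sub>R) (1/2) ` (T \<inter> U)" by blast
    qed auto
    ultimately show ?thesis using that unfolding okU_def by (auto intro: znhd_scaled znhd_Int abscon_scaled abscon_Int)
  qed
  obtain s where s: "\<And>n. P n (s n)" "\<And>n. Q n (s n) (s (Suc n))"
  proof (rule dependent_nat_choice[of P Q, THEN exE])
    obtain e U where "e \<in> Kp" "e \<in> UNIV" "okU U" "\<forall>g\<in>span {v 0}. e - g \<notin> U" using step[OF _ okUNIV, of "{v 0}"] by auto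
    then have "P 0 (e, U, UNIV, {v 0})" using okUNIV by (simp add: P_def)
    then show "\<exists>x. P 0 x" ..
  next
    fix x n assume "P n x"
    then obtain e U T H where x: "x = (e, U, T, H)" "okU U" "okU T" "finite H" "v 0 \<in> H" by (auto simp: P_def)
    define H' where "H' = insert e (insert (v (Suc n)) H)"
    have "finite H'" using x by (simp add: H'_def)
    from step[OF this okhalf[OF x(3,2)]] obtain e' U' where
      "e' \<in> Kp" "e' \<in> (*\<^sub>R) (1/2) ` (T \<inter> U)" "okU U'" "\<forall>g\<in>span H'. e' - g \<notin> U'" by blast
    then have "P (Suc n) (e', U', (*\<^sub>R) (1/2) ` (T \<inter> U), H') \<and> Q n x (e', U', (*\<^sub>R) (1/2) ` (T \<inter> U), H')"
      using okhalf[OF x(3,2)] \<open>finite H'\<close> x(5) by (simp add: P_def Q_def x(1) H'_def)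
    then show "\<exists>y. P (Suc n) y \<and> Q n x y" ..
  qed blast
  define e where "e n = fst (s n)" for n
  define U where "U n = fst (snd (s n))" for n
  define T where "T n = fst (snd (snd (s n)))" for n
  define H where "H n = snd (snd (snd (s n)))" for n
  have P: "e n \<in> Kp" "e n \<in> T n" "okU (U n)" "okU (T n)" "v 0 \<in> H n" "\<forall>g\<in>span (H n). e n - g \<notin> U n" for n
    using s(1)[of n] by (auto simp: P_def e_def U_def T_def H_def split: prod.splits)
  have Q: "T (Suc n) = (*\<^sub>R) (1/2) ` (T n \<inter> U n)" "H (Suc n) = insert (e n) (insert (v (Suc n)) (H n))" for n
    using s(2)[of n] by (auto simp: Q_def e_def U_def T_def H_def split: prod.splits)
  have Hsub: "v ` {..n} \<union> e ` {..<n} \<subseteq> H n" for n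
  proof (induction n)
    case 0
    then show ?case using P(5)[of 0] by simp
  next
    case (Suc n)
    then show ?case unfolding Q(2) atMost_Suc lessThan_Suc by auto
  qed
  have TU: "(2^(i - j)) *\<^sub>R x \<in> U j" if "j < i" "x \<in> T i" for i j x
    using that
  proof (induction i arbitrary: x)
    case (Suc i)
    then obtain y where y: "y \<in> T i" "y \<in> U i" "x = (1/2) *\<^sub>R y" unfolding Q(1) by blast
    show ?case
    proof (cases "j = i")
      case True
      then show ?thesis using y by simp
    next
      case False
      then have "j < i" using Suc.prems by simp
      then have "(2^(i - j)) *\<^sub>R y \<in> U j" using Suc.IH y by blast
      moreover have "(2^(Suc i - j)) *\<^sub>R x = (2^(i - j)) *\<^sub>R y"
        using \<open>j < i\<close> by (simp add: y(3) Suc_diff_le)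
      ultimately show ?thesis by simp
    qed
  qed simp
  show thesis
  proof (rule that[of e U])
    show "e j - g \<notin> U j" if "g \<in> span (v ` {..j} \<union> e ` {..<j})" for j g
      using P(6)[of j] span_mono[OF Hsub[of j]] that by blast
  qed (use P TU in \<open>auto simp: okU_def\<close>)
qed

text \<open>Sums \<open>\<Sum>j. c j / 2\<^sup>j \<cdot> e j\<close> with bounded coefficients \<open>c\<close>; the partial sums stay in the compact
  set \<open>2 \<cdot> Kp\<close>, which replaces completeness.\<close>

definition psum :: "(nat \<Rightarrow> 'a) \<Rightarrow> (nat \<Rightarrow> real) \<Rightarrow> nat \<Rightarrow> 'a" where
  "psum e c n = (\<Sum>j<n. (c j * (1/2)^j) *\<^sub>R e j)"

definition wsum :: "(nat \<Rightarrow> 'a) \<Rightarrow> (nat \<Rightarrow> real) \<Rightarrow> 'a" where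
  "wsum e c = (SOME l. limitin X (psum e c) l sequentially)"

lemma psum_tail:
  assumes Kp: "abscon Kp" "\<And>j. e j \<in> Kp" and c: "\<And>j. \<bar>c j\<bar> \<le> 1" and mn: "m \<le> n"
  shows "psum e c n - psum e c m \<in> (*\<^sub>R) (2 * (1/2)^m) ` Kp"
proof -
  define t :: real where "t = 2 * (1/2)^m"
  have t: "t > 0" by (simp add: t_def)
  have "{..<n} = {..<m} \<union> {m..<n}" using mn by auto
  then have "psum e c n = psum e c m + (\<Sum>j=m..<n. (c j * (1/2)^j) *\<^sub>R e j)"
    unfolding psum_def by (simp add: sum.union_disjoint[symmetric] ivl_disj_int)
  then have "psum e c n - psum e c m = t *\<^sub>R (\<Sum>j=m..<n. (c j * (1/2)^j / t) *\<^sub>R e j)"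
    using t by (simp add: scaleR_sum_right)
  moreover have "(\<Sum>j=m..<n. (c j * (1/2)^j / t) *\<^sub>R e j) \<in> Kp"
  proof (rule abscon_sum[OF Kp(1)])
    have "(\<Sum>j=m..<n. \<bar>c j * (1/2)^j / t\<bar>) \<le> (\<Sum>j=m..<n. (1/2)^j / t)"
    proof (rule sum_mono)
      fix j
      have "\<bar>c j\<bar> * (1/2)^j \<le> 1 * (1/2)^j" by (rule mult_right_mono) (simp_all add: c)
      then have "\<bar>c j\<bar> * (1/2)^j / t \<le> (1/2)^j / t" using t by (simp add: divide_right_mono)
      then show "\<bar>c j * (1/2)^j / t\<bar> \<le> (1/2)^j / t" using t by (simp add: abs_mult abs_divide)
    qed
    also have "\<dots> = (2 * (1/2)^m - 2 * (1/2)^n) / t"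
      by (simp add: sum_divide_distrib[symmetric] sum_half_powers[OF mn])
    also have "\<dots> \<le> 1" using t by (simp add: t_def field_simps)
    finally show "(\<Sum>j=m..<n. \<bar>c j * (1/2)^j / t\<bar>) \<le> 1" .
  qed (use Kp in auto)
  ultimately show ?thesis unfolding t_def by blast
qed

lemma small_multiple:
  assumes Kp: "compactin X Kp" "abscon Kp" and V: "znhd X V"
  obtains m where "\<And>n. n \<ge> m \<Longrightarrow> (*\<^sub>R) (2 * (1/2)^n) ` Kp \<subseteq> V"
proof -
  obtain t where t: "t \<ge> 1" "\<And>s. s \<ge> t \<Longrightarrow> Kp \<subseteq> (*\<^sub>R) s ` V" using compact_bounded[OF Kp(1) V] by blast
  obtain m where m: "2 * t < 2^m" using real_arch_pow[of 2 "2 * t"] by auto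
  show thesis
  proof (rule that[of m], rule subsetI)
    fix n x assume "n \<ge> m" "x \<in> (*\<^sub>R) (2 * (1/2)^n) ` Kp"
    then obtain k where k: "k \<in> Kp" "x = (2 * (1/2)^n) *\<^sub>R k" by blast
    have "(2::real)^m \<le> 2^n" using \<open>n \<ge> m\<close> by simp
    then have "2 * t \<le> 2^n" using m by linarith
    then have "t \<le> 2^n / 2" by simp
    then obtain v where v: "v \<in> V" "k = (2^n / 2) *\<^sub>R v" using t(2) k(1) by blast
    have "x = v" unfolding k(2) v(2) by (simp add: power_one_over)
    then show "x \<in> V" using v by simp
  qed
qed

text \<open>A subsequence converges by compactness of 2 Kp, and the geometric tails carry its limit
  over to the whole sequence.\<close>

lemma psum_converges:
  assumes Kp: "compactin X Kp" "abscon Kp" "\<And>j. e j \<in> Kp" and c: "\<And>j. \<bar>c j\<bar> \<le> 1"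
  shows "limitin X (psum e c) (wsum e c) sequentially"
proof -
  have "psum e c n \<in> (*\<^sub>R) 2 ` Kp" for n
    using psum_tail[of Kp e c 0 n, OF Kp(2,3) c] by (simp add: psum_def)
  then obtain r l where r: "strict_mono r" "limitin X (psum e c \<circ> r) l sequentially"
    using compact_seq[OF compact_scaled[OF Kp(1)], of "psum e c" 2] by blast
  have "limitin X (psum e c) l sequentially"
    unfolding limitin_iff_znhd
  proof clarify
    fix V assume "znhd X V"
    then obtain W where W: "znhd X W" "abscon W" "\<And>x y. x \<in> W \<Longrightarrow> y \<in> W \<Longrightarrow> x + y \<in> V"
      using znhd_half by metis
    obtain m where m: "\<And>n. n \<ge> m \<Longrightarrow> (*\<^sub>R) (2 * (1/2)^n) ` Kp \<subseteq> W" using small_multiple[OF Kp(1,2) W(1)] by blast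
    have "\<forall>\<^sub>F k in sequentially. psum e c (r k) - l \<in> W"
      using r(2) W(1) by (auto simp: limitin_iff_znhd o_def)
    then obtain k0 where k0: "\<And>k. k \<ge> k0 \<Longrightarrow> psum e c (r k) - l \<in> W" by (auto simp: eventually_sequentially)
    have "psum e c n - l \<in> V" if n: "n \<ge> m" for n
    proof -
      define k where "k = max n k0"
      have "n \<le> r k" using strict_mono_imp_increasing[OF r(1), of k] by (simp add: k_def)
      then have "psum e c (r k) - psum e c n \<in> W" using psum_tail[of Kp e c n "r k", OF Kp(2,3) c] m[OF n] by blast
      moreover have "psum e c (r k) - l \<in> W" by (rule k0) (simp add: k_def)
      ultimately have "- (psum e c (r k) - psum e c n) + (psum e c (r k) - l) \<in> V"
        using W(3) abscon_minus[OF W(2)] by blast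
      then show ?thesis by simp
    qed
    then show "\<forall>\<^sub>F n in sequentially. psum e c n - l \<in> V" unfolding eventually_sequentially by blast
  qed
  then show ?thesis unfolding wsum_def by (rule someI)
qed

lemma wsum_tail:
  assumes Kp: "compactin X Kp" "abscon Kp" "\<And>j. e j \<in> Kp" and c: "\<And>j. \<bar>c j\<bar> \<le> 1"
  shows "wsum e c - psum e c m \<in> (*\<^sub>R) (2 * (1/2)^m) ` Kp"
proof (rule limitin_closedin)
  show "limitin X (\<lambda>n. psum e c n - psum e c m) (wsum e c - psum e c m) sequentially"
    by (rule lim_diff[OF psum_converges[OF Kp c]]) simp
  show "closedin X ((*\<^sub>R) (2 * (1/2)^m) ` Kp)" by (intro compact_closed compact_scaled Kp)
  show "\<forall>\<^sub>F n in sequentially. psum e c n - psum e c m \<in> (*\<^sub>R) (2 * (1/2)^m) ` Kp"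
    unfolding eventually_sequentially by (intro exI[of _ m] allI impI psum_tail[OF Kp(2,3) c])
qed simp

lemma wsum_bound:
  assumes "compactin X Kp" "abscon Kp" "\<And>j. e j \<in> Kp" "\<And>j. \<bar>c j\<bar> \<le> 1"
  shows "wsum e c \<in> (*\<^sub>R) 2 ` Kp"
  using wsum_tail[of Kp e c 0, OF assms] by (simp add: psum_def)

lemma wsum_diff:
  assumes Kp: "compactin X Kp" "abscon Kp" "\<And>j. e j \<in> Kp"
    and c: "\<And>j. \<bar>c j\<bar> \<le> 1" "\<And>j. \<bar>d j\<bar> \<le> 1" "\<And>j. \<bar>c j - d j\<bar> \<le> 1"
  shows "wsum e (\<lambda>j. c j - d j) = wsum e c - wsum e d"
proof (rule lim_unique)
  show "limitin X (psum e (\<lambda>j. c j - d j)) (wsum e (\<lambda>j. c j - d j)) sequentially"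
    by (rule psum_converges[OF Kp c(3)])
  have "psum e (\<lambda>j. c j - d j) = (\<lambda>n. psum e c n - psum e d n)"
    by (simp add: psum_def fun_eq_iff sum_subtractf[symmetric] left_diff_distrib scaleR_diff_left)
  then show "limitin X (psum e (\<lambda>j. c j - d j)) (wsum e c - wsum e d) sequentially"
    using lim_diff[OF psum_converges[OF Kp c(1)] psum_converges[OF Kp c(2)]] by simp
qed simp

lemma wsum_zero: "wsum e (\<lambda>_. 0) = 0"
proof -
  have "psum e (\<lambda>_. 0) = (\<lambda>_. 0)" by (simp add: psum_def fun_eq_iff)
  then have "limitin X (psum e (\<lambda>_. 0)) 0 sequentially" by simp
  then have "limitin X (psum e (\<lambda>_. 0)) (wsum e (\<lambda>_. 0)) sequentially" unfolding wsum_def by (rule someI)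
  then show ?thesis using \<open>limitin X (psum e (\<lambda>_. 0)) 0 sequentially\<close> lim_unique by fastforce
qed

text \<open>The tails are small uniformly in the coefficients, so coefficientwise convergence
  suffices.\<close>

lemma wsum_continuous:
  assumes Kp: "compactin X Kp" "abscon Kp" "\<And>j. e j \<in> Kp"
    and c: "\<And>k j. \<bar>c k j\<bar> \<le> 1" "\<And>j. \<bar>d j\<bar> \<le> 1" and lim: "\<And>j. (\<lambda>k. c k j) \<longlonglongrightarrow> d j"
  shows "limitin X (\<lambda>k. wsum e (c k)) (wsum e d) sequentially"
  unfolding limitin_iff_znhd
proof clarify
  fix V assume "znhd X V"
  then obtain W where W: "znhd X W" "abscon W" "\<And>x y. x \<in> W \<Longrightarrow> y \<in> W \<Longrightarrow> x + y \<in> V"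
    using znhd_half by metis
  obtain W' where W': "znhd X W'" "abscon W'" "W' \<subseteq> W" "\<And>x y. x \<in> W' \<Longrightarrow> y \<in> W' \<Longrightarrow> x + y \<in> W"
    using W(1) by (rule znhd_half) blast
  obtain m where m: "\<And>n. n \<ge> m \<Longrightarrow> (*\<^sub>R) (2 * (1/2)^n) ` Kp \<subseteq> W'" using small_multiple[OF Kp(1,2) W'(1)] by blast
  have "limitin X (\<lambda>k. psum e (c k) m) (psum e d m) sequentially"
    unfolding psum_def
    by (intro lim_sum lim_scale tendsto_mult lim tendsto_const) auto
  then have "\<forall>\<^sub>F k in sequentially. psum e (c k) m - psum e d m \<in> W"
    using W(1) by (auto simp: limitin_iff_znhd)
  then show "\<forall>\<^sub>F k in sequentially. wsum e (c k) - wsum e d \<in> V"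
  proof eventually_elim
    case (elim k)
    have "wsum e (c k) - psum e (c k) m \<in> W'" using wsum_tail[of Kp e "c k" m, OF Kp c(1)] m[of m] by blast
    moreover have "wsum e d - psum e d m \<in> W'" using wsum_tail[of Kp e d m, OF Kp c(2)] m[of m] by blast
    then have "- (wsum e d - psum e d m) \<in> W'" by (rule abscon_minus[OF W'(2)])
    ultimately have "(wsum e (c k) - psum e (c k) m) + - (wsum e d - psum e d m) \<in> W" by (rule W'(4))
    from W(3)[OF this elim] show ?case by (simp add: algebra_simps)
  qed
qed

text \<open>Take j at least n with |c j| (1/2)^j maximal and divide the series by this term. The
  tail after j then has coefficients at most 1 and lies in U j, while everything before j and the
  sum itself lie in the span from which U j separates e j. Infinitely many nonzero c are required so
  that one occurs beyond n.\<close>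

lemma wsum_injective:
  assumes Kp: "compactin X Kp" "abscon Kp" "\<And>j. e j \<in> Kp"
    and U: "\<And>j. closedin X (U j)" "\<And>j. abscon (U j)"
    and eU: "\<And>i j. j < i \<Longrightarrow> (2^(i - j)) *\<^sub>R e i \<in> U j"
    and indep: "\<And>j g. g \<in> span (v ` {..j} \<union> e ` {..<j}) \<Longrightarrow> e j - g \<notin> U j"
    and c: "\<And>j. \<bar>c j\<bar> \<le> 1" "\<And>N. \<exists>j\<ge>N. c j \<noteq> 0" and sp: "wsum e c \<in> span (v ` {..n})"
  shows False
proof -
  obtain j1 where j1: "j1 \<ge> n" "c j1 \<noteq> 0" using c(2) by blast
  \<comment> \<open>The indices that can compete with j1. There are finitely many, so the maximum
    over all i >= n is attained.\<close>
  define A where "A = {i. n \<le> i \<and> \<bar>c j1\<bar> * (1/2)^j1 \<le> (1/2)^i}"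
  have pos: "\<bar>c j1\<bar> * (1/2)^j1 > 0" using j1 by simp
  obtain N where N: "(1/2::real)^N < \<bar>c j1\<bar> * (1/2)^j1" using real_arch_pow_inv[OF pos, of "1/2"] by auto
  have "A \<subseteq> {..<N}"
  proof
    fix i assume "i \<in> A"
    then have "\<bar>c j1\<bar> * (1/2)^j1 \<le> (1/2)^i" by (simp add: A_def)
    with N have "(1/2::real)^N < (1/2)^i" by linarith
    then show "i \<in> {..<N}" by simp
  qed
  then have fA: "finite A" using finite_subset by blast
  have "j1 \<in> A" using j1 c(1)[of j1] by (simp add: A_def mult_left_le_one_le)
  define m where "m = Max ((\<lambda>i. \<bar>c i\<bar> * (1/2)^i) ` A)"
  have "m \<in> (\<lambda>i. \<bar>c i\<bar> * (1/2)^i) ` A" unfolding m_def using fA \<open>j1 \<in> A\<close> by (intro Max_in) auto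
  then obtain j where j: "j \<in> A" "m = \<bar>c j\<bar> * (1/2)^j" by blast
  have mA: "\<bar>c i\<bar> * (1/2)^i \<le> m" if "i \<in> A" for i unfolding m_def using fA that by (intro Max_ge) auto
  have m1: "m > 0" using mA[OF \<open>j1 \<in> A\<close>] pos by linarith
  have mall: "\<bar>c i\<bar> * (1/2)^i \<le> m" if "i \<ge> n" for i
  proof (cases "i \<in> A")
    case False
    have "\<bar>c i\<bar> * (1/2)^i \<le> 1 * (1/2)^i" using c(1) by (intro mult_right_mono) auto
    also have "\<dots> \<le> \<bar>c j1\<bar> * (1/2)^j1" using False that by (simp add: A_def)
    also have "\<dots> \<le> m" by (rule mA[OF \<open>j1 \<in> A\<close>])
    finally show ?thesis .
  qed (rule mA)
  define d where "d = c j * (1/2)^j"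
  have dm: "\<bar>d\<bar> = m" using j(2) by (simp add: d_def abs_mult)
  have d0: "d \<noteq> 0" using dm m1 by auto
  have jn: "n \<le> j" using j(1) by (simp add: A_def)
  \<comment> \<open>The part of the k-th partial sum strictly after the dominant term, divided by
    the coefficient of that term.\<close>
  define u where "u k = (1/d) *\<^sub>R (psum e c k - psum e c j) - e j" for k
  have uU: "u k \<in> U j" if k: "k > j" for k
  proof -
    have "{..<k} = {..<j} \<union> insert j {Suc j..<k}" using k by auto
    then have "psum e c k = (\<Sum>i\<in>{..<j} \<union> insert j {Suc j..<k}. (c i * (1/2)^i) *\<^sub>R e i)"
      by (simp only: psum_def)
    also have "\<dots> = psum e c j + (\<Sum>i\<in>insert j {Suc j..<k}. (c i * (1/2)^i) *\<^sub>R e i)"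
      unfolding psum_def by (rule sum.union_disjoint) auto
    also have "(\<Sum>i\<in>insert j {Suc j..<k}. (c i * (1/2)^i) *\<^sub>R e i) = d *\<^sub>R e j + (\<Sum>i=Suc j..<k. (c i * (1/2)^i) *\<^sub>R e i)"
      by (simp add: d_def)
    finally have "psum e c k = psum e c j + (d *\<^sub>R e j + (\<Sum>i=Suc j..<k. (c i * (1/2)^i) *\<^sub>R e i))" .
    then have "u k = (\<Sum>i=Suc j..<k. ((c i * (1/2)^i) / d) *\<^sub>R e i)"
      using d0 by (simp add: u_def scaleR_add_right scaleR_sum_right)
    also have "\<dots> = (\<Sum>i=Suc j..<k. ((c i * (1/2)^i) / d * (1/2)^(i - j)) *\<^sub>R ((2^(i - j)) *\<^sub>R e i))"
      by (intro sum.cong refl) (simp add: power_one_over)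
    also have "\<dots> \<in> U j"
    proof (rule abscon_sum[OF U(2)])
      have "(\<Sum>i=Suc j..<k. \<bar>(c i * (1/2)^i) / d * (1/2)^(i - j)\<bar>) \<le> (\<Sum>i=Suc j..<k. 2^j * (1/2)^i)"
      proof (rule sum_mono)
        fix i assume i: "i \<in> {Suc j..<k}"
        have "\<bar>c i\<bar> * (1/2)^i \<le> \<bar>d\<bar>" using mall[of i] i jn dm by simp
        then have "\<bar>(c i * (1/2)^i) / d\<bar> \<le> 1" using d0 by (simp add: abs_mult abs_divide)
        then have "\<bar>(c i * (1/2)^i) / d\<bar> * (1/2)^(i - j) \<le> 1 * (1/2)^(i - j)" by (intro mult_right_mono) auto
        also have "\<dots> = 2^j * (1/2)^i" using i by (simp add: power_one_over power_diff)
        finally show "\<bar>(c i * (1/2)^i) / d * (1/2)^(i - j)\<bar> \<le> 2^j * (1/2)^i" by (simp add: abs_mult)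
      qed
      also have "\<dots> = 2^j * (2 * (1/2)^(Suc j) - 2 * (1/2)^k)"
        using sum_half_powers[of "Suc j" k] k by (simp add: sum_distrib_left[symmetric])
      also have "\<dots> \<le> 2^j * (2 * (1/2)^(Suc j))" by (intro mult_left_mono) auto
      also have "\<dots> = 1" by (simp add: power_one_over)
      finally show "(\<Sum>i=Suc j..<k. \<bar>(c i * (1/2)^i) / d * (1/2)^(i - j)\<bar>) \<le> 1" .
    qed (use eU in auto)
    finally show ?thesis .
  qed
  define g where "g = (1/d) *\<^sub>R (wsum e c - psum e c j)"
  have "limitin X u (g - e j) sequentially"
    unfolding u_def g_def
    by (intro lim_diff lim_scale tendsto_const psum_converges[OF Kp c(1)]) auto
  moreover have "\<forall>\<^sub>F k in sequentially. u k \<in> U j"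
    unfolding eventually_sequentially using uU by (intro exI[of _ "Suc j"]) auto
  ultimately have "g - e j \<in> U j" using limitin_closedin[OF _ U(1)] by fastforce
  then have "e j - g \<in> U j" using abscon_minus[OF U(2), of "g - e j"] by simp
  moreover have "g \<in> span (v ` {..j} \<union> e ` {..<j})"
    unfolding g_def
  proof (intro span_scale span_diff)
    show "wsum e c \<in> span (v ` {..j} \<union> e ` {..<j})"
      by (rule subsetD[OF span_mono sp]) (use jn in auto)
    show "psum e c j \<in> span (v ` {..j} \<union> e ` {..<j})"
      unfolding psum_def by (intro span_sum span_scale span_base) auto
  qed
  ultimately show False using indep by blast
qed

end

section \<open>Extension of embeddings\<close>

lemma span_range_finite:
  fixes v :: "nat \<Rightarrow> 'a::real_vector"
  assumes "x \<in> span (range v)"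
  obtains n where "x \<in> span (v ` {..n})"
proof -
  obtain T r where T: "finite T" "T \<subseteq> range v" "x = (\<Sum>a\<in>T. r a *\<^sub>R a)"
    using assms unfolding span_explicit by blast
  obtain I where I: "finite I" "T = v ` I" using finite_subset_image[OF T(1,2)] by blast
  have "I \<subseteq> {..Max (insert 0 I)}" using I(1) by auto
  then have "T \<subseteq> v ` {..Max (insert 0 I)}" using I(2) by blast
  then have "x \<in> span (v ` {..Max (insert 0 I)})"
    unfolding T(3) by (intro span_sum span_scale span_base) blast
  then show thesis by (rule that)
qed

section \<open>Nets, separating sequences and distance functions\<close>

lemma (in Metric_space) finite_net:
  assumes "compactin mtopology S" "e > 0"
  shows "\<exists>N. finite N \<and> N \<subseteq> S \<and> (\<forall>x\<in>S. \<exists>y\<in>N. d x y < e)"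
proof -
  have "\<exists>N. finite N \<and> N \<subseteq> S \<and> S \<subseteq> (\<Union>x\<in>N. mball x e)"
    using compactin_imp_mtotally_bounded[OF assms(1)] assms(2) by (simp add: mtotally_bounded_def)
  then obtain N where N: "finite N" "N \<subseteq> S" "S \<subseteq> (\<Union>x\<in>N. mball x e)" by blast
  have "\<exists>y\<in>N. d x y < e" if "x \<in> S" for x
  proof -
    obtain y where "y \<in> N" "x \<in> mball y e" using N(3) \<open>x \<in> S\<close> by blast
    then show ?thesis using commute[of x y] by (intro bexI[of _ y]) simp_all
  qed
  then show ?thesis using N(1,2) by blast
qed

lemma (in Metric_space) continuous_map_sequentially:
  assumes top: "\<And>x. x \<in> M \<Longrightarrow> h x \<in> topspace X"
    and seq: "\<And>x a. (\<And>k::nat. x k \<in> M) \<Longrightarrow> a \<in> M \<Longrightarrow> (\<lambda>k. d (x k) a) \<longlonglongrightarrow> 0 \<Longrightarrow> limitin X (\<lambda>k. h (x k)) (h a) sequentially"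
  shows "continuous_map mtopology X h"
  unfolding continuous_map_def
proof (intro conjI allI impI)
  fix U assume U: "openin X U"
  show "openin mtopology {x \<in> topspace mtopology. h x \<in> U}"
    unfolding openin_mtopology
  proof (intro conjI allI impI)
    fix a assume a: "a \<in> {x \<in> topspace mtopology. h x \<in> U}"
    show "\<exists>r>0. mball a r \<subseteq> {x \<in> topspace mtopology. h x \<in> U}"
    proof (rule ccontr)
      assume no: "\<not> ?thesis"
      have "\<forall>k. \<exists>x. x \<in> M \<and> d a x < inverse (real (Suc k)) \<and> h x \<notin> U"
      proof
        fix k
        have "0 < inverse (real (Suc k))" by simp
        then have "\<not> mball a (inverse (real (Suc k))) \<subseteq> {x \<in> topspace mtopology. h x \<in> U}" using no by blast
        then show "\<exists>x. x \<in> M \<and> d a x < inverse (real (Suc k)) \<and> h x \<notin> U" by auto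
      qed
      from choice[OF this] obtain x where x: "\<And>k. x k \<in> M" "\<And>k. d a (x k) < inverse (real (Suc k))" "\<And>k. h (x k) \<notin> U"
        by blast
      have "(\<lambda>k. d (x k) a) \<longlonglongrightarrow> 0"
      proof (rule tendsto_sandwich[OF _ _ tendsto_const LIMSEQ_inverse_real_of_nat])
        show "\<forall>\<^sub>F k in sequentially. d (x k) a \<le> inverse (real (Suc k))"
        proof (rule always_eventually, rule allI)
          fix k show "d (x k) a \<le> inverse (real (Suc k))" using x(2)[of k] commute[of "x k" a] by simp
        qed
      qed simp
      from seq[OF x(1) _ this] a have "limitin X (\<lambda>k. h (x k)) (h a) sequentially" by simp
      then have "\<forall>\<^sub>F k in sequentially. h (x k) \<in> U" using a U by (simp add: limitin_def)
      then show False using x(3) by (auto simp: eventually_sequentially)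
    qed
  qed auto
qed (use top in auto)

text \<open>The distances to the points of a countable dense set determine a point.\<close>

lemma (in Metric_space) separating_sequence:
  assumes cM: "compactin mtopology M" and ne: "M \<noteq> {}"
  obtains z :: "nat \<Rightarrow> 'a" where
    "\<And>a a'. a \<in> M \<Longrightarrow> a' \<in> M \<Longrightarrow> (\<And>i. d a (z i) = d a' (z i)) \<Longrightarrow> a = a'"
proof -
  have "\<forall>n. \<exists>S. finite S \<and> S \<subseteq> M \<and> (\<forall>x\<in>M. \<exists>y\<in>S. d x y < inverse (real (Suc n)))"
    by (intro allI finite_net[OF cM]) simp
  from choice[OF this] obtain S where
    "\<forall>n. finite (S n) \<and> S n \<subseteq> M \<and> (\<forall>x\<in>M. \<exists>y\<in>S n. d x y < inverse (real (Suc n)))" ..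
  then have S: "\<And>n. finite (S n)" "\<And>n. S n \<subseteq> M"
    "\<And>n x. x \<in> M \<Longrightarrow> \<exists>y\<in>S n. d x y < inverse (real (Suc n))" by simp_all
  have Sne: "(\<Union>n. S n) \<noteq> {}"
  proof -
    obtain b where "b \<in> M" using ne by blast
    then show ?thesis using S(3)[of b 0] by auto
  qed
  have "countable (\<Union>n. S n)" by (rule countable_UN) (simp_all add: countable_finite S(1))
  then have zr: "range (from_nat_into (\<Union>n. S n)) = (\<Union>n. S n)" using Sne by (intro range_from_nat_into)
  show thesis
  proof (rule that[of "from_nat_into (\<Union>n. S n)"], rule ccontr)
    fix a a' assume a: "a \<in> M" "a' \<in> M"
      and eq: "\<And>i. d a (from_nat_into (\<Union>n. S n) i) = d a' (from_nat_into (\<Union>n. S n) i)" and "a \<noteq> a'"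
    have "d a a' / 2 > 0" using a \<open>a \<noteq> a'\<close> by simp
    then obtain n where n: "inverse (real (Suc n)) < d a a' / 2" using reals_Archimedean by blast
    obtain y where y: "y \<in> S n" "d a y < inverse (real (Suc n))" using S(3)[OF a(1), of n] by blast
    have yM: "y \<in> M" using y(1) S(2) by blast
    have "y \<in> range (from_nat_into (\<Union>n. S n))" using y(1) zr by blast
    then have "d a' y = d a y" using eq by auto
    then show False using y(2) n triangle[OF a(1) yM a(2)] commute[of y a'] by simp
  qed
qed

lemma (in Metric_space) distance_to_set:
  assumes B: "B \<subseteq> M" "B \<noteq> {}"
  obtains D where "\<And>a b. b \<in> B \<Longrightarrow> D a \<le> d a b" "\<And>a. 0 \<le> D a" "\<And>b. b \<in> B \<Longrightarrow> D b = 0"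
    "\<And>a t. D a < t \<Longrightarrow> \<exists>b\<in>B. d a b < t"
    "\<And>x a. a \<in> M \<Longrightarrow> (\<And>k::nat. x k \<in> M) \<Longrightarrow> (\<lambda>k. d (x k) a) \<longlonglongrightarrow> 0 \<Longrightarrow> (\<lambda>k. D (x k)) \<longlonglongrightarrow> D a"
proof -
  define D where "D a = Inf (d a ` B)" for a
  have bd: "bdd_below (d a ` B)" for a by (rule bdd_belowI[of _ 0]) auto
  have dle: "D a \<le> d a b" if "b \<in> B" for a b unfolding D_def using that by (intro cInf_lower bd) auto
  have dge: "0 \<le> D a" for a unfolding D_def using B by (intro cInf_greatest) auto
  have dex: "\<exists>b\<in>B. d a b < t" if "D a < t" for a t
    using cInf_lessD[of "d a ` B" t] that B by (auto simp: D_def)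
  have dlip: "D a \<le> d a a' + D a'" if "a \<in> M" "a' \<in> M" for a a'
  proof (rule field_le_epsilon)
    fix e :: real assume "e > 0"
    then obtain b where b: "b \<in> B" "d a' b < D a' + e" using dex[of a' "D a' + e"] by auto
    then show "D a \<le> d a a' + D a' + e" using dle[OF b(1), of a] triangle[OF that, of b] B by auto
  qed
  show thesis
  proof (rule that[of D])
    show "D b = 0" if "b \<in> B" for b using dle[OF that, of b] dge[of b] B that by auto
    fix x :: "nat \<Rightarrow> 'a" and a assume x: "a \<in> M" "\<And>k. x k \<in> M" "(\<lambda>k. d (x k) a) \<longlonglongrightarrow> 0"
    show "(\<lambda>k. D (x k)) \<longlonglongrightarrow> D a"
    proof (rule LIM_zero_cancel, rule Lim_null_comparison[OF _ x(3)])
      show "\<forall>\<^sub>F k in sequentially. norm (D (x k) - D a) \<le> d (x k) a"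
      proof (rule always_eventually, rule allI)
        fix k show "norm (D (x k) - D a) \<le> d (x k) a"
          using dlip[OF x(2,1), of k] dlip[OF x(1,2), of k] commute[of a "x k"] by (simp add: abs_le_iff)
      qed
    qed
  qed (use dle dge dex in auto)
qed

lemma (in Metric_space) distance_pos:
  fixes D :: "'a \<Rightarrow> real"
  assumes "closedin mtopology B" "a \<in> M" "a \<notin> B" and near: "\<And>t. D a < t \<Longrightarrow> \<exists>b\<in>B. d a b < t"
  shows "D a > 0"
proof -
  have "openin mtopology (M - B)" using assms(1) by (simp add: closedin_def)
  then obtain r where r: "r > 0" "mball a r \<subseteq> M - B" using assms(2,3) unfolding openin_mtopology by blast
  have "\<not> D a < r"
  proof
    assume "D a < r"
    then obtain b where "b \<in> B" "d a b < r" using near by blast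
    moreover have "b \<in> M" using \<open>b \<in> B\<close> closedin_subset[OF assms(1)] by auto
    ultimately have "b \<in> mball a r" using assms(2) by simp
    then show False using r(2) \<open>b \<in> B\<close> by blast
  qed
  then show ?thesis using r(1) by simp
qed

lemma (in Metric_space) distance_limit:
  assumes "a \<in> M" "b \<in> M" "\<And>k::nat. x k \<in> M" "(\<lambda>k. d (x k) a) \<longlonglongrightarrow> 0"
  shows "(\<lambda>k. d (x k) b) \<longlonglongrightarrow> d a b"
proof (rule LIM_zero_cancel, rule Lim_null_comparison[OF _ assms(4)])
  show "\<forall>\<^sub>F k in sequentially. norm (d (x k) b - d a b) \<le> d (x k) a"
  proof (rule always_eventually, rule allI)
    fix k show "norm (d (x k) b - d a b) \<le> d (x k) a"
      using triangle[OF assms(3,1,2), of k] triangle[OF assms(1,3,2), of k] commute[of a "x k"] by (simp add: abs_le_iff)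
  qed
qed

text \<open>The weight functions of a Dugundji-type extension: level \<open>n\<close> is active at distance \<open>t\<close> from the
  closed set iff \<open>1/(n+2) < t < 1/n\<close>, so at most two consecutive levels are active.\<close>

definition bump :: "nat \<Rightarrow> real \<Rightarrow> real" where
  "bump n t = max 0 (1 / real n - t) * max 0 (t - 1 / real (n + 2))"

lemma bump_nonneg: "0 \<le> bump n t"
  by (simp add: bump_def)

lemma bump_pos_iff: "bump n t > 0 \<longleftrightarrow> t < 1 / real n \<and> 1 / real (n + 2) < t"
  by (auto simp: bump_def zero_less_mult_iff max_def)

text \<open>Because \<open>1 / 0 = 0\<close>, level 0 is never active and the levels start at
  1.\<close>

lemma bump_zero: "t \<ge> 0 \<Longrightarrow> bump 0 t = 0"
  by (simp add: bump_def)

text \<open>If k is the ceiling of 1/t, then level k - 1 is active and at most k - 2 besides it; t <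
  1 gives k >= 2.\<close>

lemma bump_levels:
  assumes "0 < t" "t < 1"
  obtains m where "bump (Suc m) t > 0" "\<And>n. bump n t > 0 \<Longrightarrow> n = m \<or> n = Suc m"
proof -
  define k where "k = nat \<lceil>1/t\<rceil>"
  define q where "q = real_of_int \<lceil>1/t\<rceil>"
  have c: "q - 1 < 1/t" "1/t \<le> q" unfolding q_def by linarith+
  have "1/t > 1" using assms by simp
  then have ce: "\<lceil>1/t\<rceil> \<ge> 2" using c unfolding q_def by linarith
  then have rk: "real k = q" by (simp add: k_def q_def)
  have "nat 2 \<le> k" unfolding k_def by (rule nat_mono[OF ce])
  then have k2: "k \<ge> 2" by simp
  define m where "m = k - 2"
  have km: "k = Suc (Suc m)" using k2 by (simp add: m_def)
  have act: "bump n t > 0 \<longleftrightarrow> real n * t < 1 \<and> 1 < real (n + 2) * t" if "n > 0" for n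
    unfolding bump_pos_iff using assms that by (simp add: field_simps)
  have l: "(real k - 1) * t < 1" "1 \<le> real k * t"
    using c assms unfolding rk by (simp_all add: field_simps)
  show thesis
  proof (rule that[of m])
    have "1 < real (Suc m + 2) * t" using l(2) assms by (simp add: km algebra_simps)
    moreover have "real (Suc m) * t < 1" using l(1) by (simp add: km)
    ultimately show "bump (Suc m) t > 0" by (subst act) simp_all
    fix n assume n: "bump n t > 0"
    have "n > 0" using n bump_zero[of t] assms by (cases n) auto
    then have "real n * t < 1" "1 < real (n + 2) * t" using n act by auto
    then have "real n * t < real k * t" "(real k - 1) * t < real (n + 2) * t" using l by linarith+
    then have "real n < real k" "real k - 1 < real (n + 2)" using assms by (auto simp: mult_less_cancel_right)
    then have "n < k" "k < n + 3" by linarith+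
    then show "n = m \<or> n = Suc m" by (auto simp: km)
  qed
qed

section \<open>Extending embeddings into a space with an infinite-dimensional compact set\<close>

context kw
begin

text \<open>The metric \<delta> need only have open balls in Y; it then gives the topology of the
  compact set C. The map \<open>h = h1 + wsum e c\<close> is injective for three different reasons:
  on B by g, between B and its complement by the push along P, and off B by the coefficients
  c.\<close>

theorem embedding_extension:
  fixes Y :: "'b topology"
  assumes Kp: "compactin X Kp" "abscon Kp" and inf: "\<And>F. finite F \<Longrightarrow> \<not> Kp \<subseteq> span F"
    and \<delta>: "Metric_space UNIV \<delta>" "\<And>x y. \<delta> x y < 1" "\<And>x e. openin Y {y \<in> topspace Y. \<delta> x y < e}"
  shows "embeddings_extend Y X"
  unfolding embeddings_extend_def
proof (intro allI impI, elim conjE)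
  fix B C and g :: "'b \<Rightarrow> 'a"
  assume C: "compactin Y C" and B: "closedin Y B" and BC: "B \<subseteq> C" and Bne: "B \<noteq> {}"
    and g: "continuous_map (subtopology Y B) X g" "inj_on g B"
  interpret U: Metric_space UNIV \<delta> by (rule \<delta>(1))
  interpret M: Metric_space C \<delta> by (rule U.subspace) simp
  have topC: "subtopology Y C = M.mtopology" by (rule subtopology_compact_metric[OF \<delta>(1,3) C])
  have cC: "compactin M.mtopology C" using C by (simp add: topC[symmetric] compactin_subtopology)
  have clB: "closedin M.mtopology B"
    unfolding topC[symmetric] using B BC by (simp add: closedin_subset_topspace)
  have cB: "compactin M.mtopology B" using closed_compactin[OF cC BC clB] .
  have cBY: "compactin Y B" using closed_compactin[OF C BC B] .
  have gB: "continuous_map (subtopology M.mtopology B) X g"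
    using g(1) by (simp add: topC[symmetric] subtopology_subtopology Int_absorb1[OF BC])

  obtain d where dle: "\<And>a b. b \<in> B \<Longrightarrow> d a \<le> \<delta> a b" and dge: "\<And>a. 0 \<le> d a" and dB: "\<And>b. b \<in> B \<Longrightarrow> d b = 0"
    and dex: "\<And>a t. d a < t \<Longrightarrow> \<exists>b\<in>B. \<delta> a b < t"
    and dlim: "\<And>x a. (\<lambda>k::nat. \<delta> (x k) a) \<longlonglongrightarrow> 0 \<Longrightarrow> (\<lambda>k. d (x k)) \<longlonglongrightarrow> d a"
    by (rule U.distance_to_set[OF _ Bne]) auto
  have d1: "d a < 1" for a using Bne dle \<delta>(2) by (meson all_not_in_conv le_less_trans)
  have dpos: "d a > 0" if "a \<in> C" "a \<notin> B" for a
    using M.distance_pos[OF clB that dex] .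
  have \<delta>lim: "(\<lambda>k. \<delta> (x k) b) \<longlonglongrightarrow> \<delta> a b" if "(\<lambda>k. \<delta> (x k) a) \<longlonglongrightarrow> 0" for x :: "nat \<Rightarrow> 'b" and a b
    by (rule U.distance_limit) (use that in auto)

  \<comment> \<open>The mesh is the lower end of the active interval of level n. So a net point of
    an active level lies within twice the distance to B, which makes the total weight
    positive.\<close>
  have "\<forall>n. \<exists>N. finite N \<and> N \<subseteq> B \<and> (\<forall>x\<in>B. \<exists>y\<in>N. \<delta> x y < 1 / real (n + 2))"
    by (intro allI M.finite_net[OF cB]) simp
  from choice[OF this] obtain N where
    "\<forall>n. finite (N n) \<and> N n \<subseteq> B \<and> (\<forall>x\<in>B. \<exists>y\<in>N n. \<delta> x y < 1 / real (n + 2))" ..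
  then have N: "\<And>n. finite (N n)" "\<And>n. N n \<subseteq> B"
    "\<And>n x. x \<in> B \<Longrightarrow> \<exists>y\<in>N n. \<delta> x y < 1 / real (n + 2)" by simp_all
  obtain z :: "nat \<Rightarrow> 'b" where
    zsep: "\<And>a a'. a \<in> C \<Longrightarrow> a' \<in> C \<Longrightarrow> (\<And>i. \<delta> a (z i) = \<delta> a' (z i)) \<Longrightarrow> a = a'"
    by (rule M.separating_sequence[OF cC]) (use Bne BC in auto)

  have "compactin X (g ` B)"
  proof (rule image_compactin[OF _ g(1)])
    show "compactin (subtopology Y B) B" using cBY by (simp add: compactin_subtopology)
  qed
  then obtain Kc where Kc: "compactin X Kc" "abscon Kc" "g ` B \<subseteq> Kc" by (rule compact_abscon_hull)
  obtain L where L: "compactin X L" "abscon L"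
    "{x - y |x y. x \<in> {x - y |x y. x \<in> Kc \<and> y \<in> Kc} \<and> y \<in> (*\<^sub>R) 2 ` Kp} \<subseteq> L"
    using compact_abscon_hull[OF compact_minus[OF compact_minus[OF Kc(1) Kc(1)] compact_scaled[OF Kp(1), of 2]]] by blast
  obtain P where P: "limitin X P 0 sequentially"
    "\<And>n s. 0 \<le> s \<Longrightarrow> s \<le> 1 \<Longrightarrow> (1 - s) *\<^sub>R P n + s *\<^sub>R P (Suc n) \<notin> L"
    using null_path_outside[OF L(1,2)] by blast

  define u where "u p = g (snd p) + P (fst p)" for p :: "nat \<times> 'b"
  \<comment> \<open>The second factor admits only net points within twice the distance to B, as
    continuity at points of B requires.\<close>
  define lam where "lam p a = bump (fst p) (d a) * max 0 (2 * d a - \<delta> a (snd p))" for p :: "nat \<times> 'b" and a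
  define J where "J a = {p. snd p \<in> N (fst p) \<and> lam p a > 0}" for a
  define w where "w a = (\<Sum>p\<in>J a. lam p a)" for a
  define h0 where "h0 a = (\<Sum>p\<in>J a. (lam p a / w a) *\<^sub>R u p)" for a
  have lam0: "0 \<le> lam p a" for p a by (simp add: lam_def bump_nonneg)
  have lamD: "bump (fst p) (d a) > 0" "\<delta> a (snd p) < 2 * d a" if "lam p a > 0" for p a
    using that bump_nonneg[of "fst p" "d a"] by (auto simp: lam_def zero_less_mult_iff max_def split: if_splits)
  define I where "I m = (SIGMA n:{..<m}. N n)" for m
  have finI: "finite (I m)" for m unfolding I_def using N(1) by simp
  have JI: "J a \<subseteq> I m" if "real m * d a \<ge> 1" for a m
  proof
    fix p assume p: "p \<in> J a"
    then have b: "bump (fst p) (d a) > 0" using lamD by (simp add: J_def)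
    have "fst p < m"
    proof (rule ccontr)
      assume "\<not> fst p < m"
      then have "real m * d a \<le> real (fst p) * d a" using dge[of a] by (intro mult_right_mono) auto
      then have le: "1 \<le> real (fst p) * d a" using that by simp
      have "fst p \<noteq> 0" using le by (cases "fst p = 0") auto
      then have "real (fst p) * d a < 1" using b unfolding bump_pos_iff by (simp add: field_simps)
      then show False using le by simp
    qed
    then show "p \<in> I m" using p by (cases p) (simp add: I_def J_def)
  qed
  have exm: "\<exists>m. \<forall>a'. d a' \<ge> t \<longrightarrow> real m * d a' \<ge> 1" if t: "t > 0" for t
  proof -
    obtain m where "1 / t < real m" using reals_Archimedean2 by blast
    then have "1 < real m * t" using t by (simp add: field_simps)
    then have "real m * d a' \<ge> 1" if "d a' \<ge> t" for a'
      using mult_left_mono[OF that, of "real m"] by simp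
    then show ?thesis by blast
  qed
  have finJ: "finite (J a)" if "d a > 0" for a
    using exm[OF that] JI finI finite_subset by (metis order_refl)
  have wpos: "w a > 0" and wJ: "\<exists>m. \<forall>p\<in>J a. fst p = m \<or> fst p = Suc m" if a: "d a > 0" for a
  proof -
    obtain m where m: "bump (Suc m) (d a) > 0" "\<And>n. bump n (d a) > 0 \<Longrightarrow> n = m \<or> n = Suc m"
      using bump_levels[OF a d1] by blast
    have t: "1 / real (Suc m + 2) < d a" using m(1) unfolding bump_pos_iff by simp
    then obtain b0 where b0: "b0 \<in> B" "\<delta> a b0 < 2 * d a - 1 / real (Suc m + 2)" using dex[of a] by force
    obtain b where b: "b \<in> N (Suc m)" "\<delta> b0 b < 1 / real (Suc m + 2)" using N(3)[OF b0(1)] by blast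
    have "\<delta> a b < 2 * d a" using U.triangle[of a b0 b] b0(2) b(2) by simp
    then have "lam (Suc m, b) a > 0" using m(1) by (simp add: lam_def)
    then have p: "(Suc m, b) \<in> J a" using b(1) by (simp add: J_def)
    then have "lam (Suc m, b) a \<le> w a" unfolding w_def using finJ[OF a] lam0 by (intro member_le_sum) auto
    then show "w a > 0" using \<open>lam (Suc m, b) a > 0\<close> by linarith
    have "fst p = m \<or> fst p = Suc m" if "p \<in> J a" for p
    proof (rule m(2), rule lamD(1))
      show "lam p a > 0" using that by (simp add: J_def)
    qed
    then show "\<exists>m. \<forall>p\<in>J a. fst p = m \<or> fst p = Suc m" by blast
  qed
  have w1: "(\<Sum>p\<in>J a. lam p a / w a) = 1" if "d a > 0" for a
    using wpos[OF that] by (simp add: sum_divide_distrib[symmetric] w_def[symmetric])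
  have conv: "(\<Sum>p\<in>J a. (lam p a / w a) *\<^sub>R x p) \<in> V" if "d a > 0" "convex V" "\<And>p. p \<in> J a \<Longrightarrow> x p \<in> V" for a V x
    by (rule convex_sum[OF finJ[OF that(1)] that(2) w1[OF that(1)]])
      (use lam0 wpos[OF that(1)] that(3) in \<open>auto intro!: divide_nonneg_pos\<close>)
  have split: "\<exists>x y. h0 a = x + y \<and> x \<in> Kc \<and> y \<notin> L" if a: "d a > 0" for a
  proof (intro exI conjI)
    show "h0 a = (\<Sum>p\<in>J a. (lam p a / w a) *\<^sub>R g (snd p)) + (\<Sum>p\<in>J a. (lam p a / w a) *\<^sub>R P (fst p))"
      by (simp add: h0_def u_def scaleR_add_right sum.distrib)
    show "(\<Sum>p\<in>J a. (lam p a / w a) *\<^sub>R g (snd p)) \<in> Kc"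
      by (rule conv[OF a abscon_convex[OF Kc(2)]]) (use Kc(3) N(2) in \<open>auto simp: J_def\<close>)
    obtain m where m: "\<forall>p\<in>J a. fst p = m \<or> fst p = Suc m" using wJ[OF a] by blast
    have "(\<Sum>p\<in>J a. (lam p a / w a) *\<^sub>R P (fst p)) \<in> closed_segment (P m) (P (Suc m))"
      by (rule conv[OF a]) (use m in auto)
    then show "(\<Sum>p\<in>J a. (lam p a / w a) *\<^sub>R P (fst p)) \<notin> L"
      using P(2) by (auto simp: closed_segment_def)
  qed
  \<comment> \<open>All values of h0 lie in the span of this countable set, so the vectors e can
    later be chosen independent of them.\<close>
  define uset where "uset = u ` (SIGMA n:UNIV. N n)"
  have cu: "countable uset" unfolding uset_def
    by (intro countable_image countable_SIGMA) (simp_all add: countable_finite N(1))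
  have une: "uset \<noteq> {}" unfolding uset_def using N(3) Bne by fastforce
  define v where "v = from_nat_into uset"
  have vr: "range v = uset" unfolding v_def by (rule range_from_nat_into[OF une cu])
  have "p \<in> (SIGMA n:UNIV. N n)" if "p \<in> J a" for p a
    using that by (cases p) (simp add: J_def)
  then have h0span: "h0 a \<in> span (range v)" for a
    unfolding h0_def vr uset_def by (intro span_sum span_scale span_base imageI)

  have h0cont: "limitin X (\<lambda>k. h0 (x k)) (h0 a) sequentially"
    if lim: "(\<lambda>k. \<delta> (x k) a) \<longlonglongrightarrow> 0" and a: "d a > 0" for x :: "nat \<Rightarrow> 'b" and a
  proof -
    \<comment> \<open>Where the distance to B is at least half that of a, all active indices lie in
      the fixed finite set I m; so h0 is locally a quotient of finite sums.\<close>
    obtain m where m: "\<And>a'. d a' \<ge> d a / 2 \<Longrightarrow> real m * d a' \<ge> 1" using exm[of "d a / 2"] a by auto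
    have alt: "h0 a' = (1 / (\<Sum>p\<in>I m. lam p a')) *\<^sub>R (\<Sum>p\<in>I m. lam p a' *\<^sub>R u p)" if "d a' \<ge> d a / 2" for a'
    proof -
      have sub: "J a' \<subseteq> I m" by (rule JI[OF m[OF that]])
      have zero: "lam p a' = 0" if "p \<in> I m - J a'" for p
        using that lam0[of p a'] by (auto simp: J_def I_def less_le)
      have "w a' = (\<Sum>p\<in>I m. lam p a')" unfolding w_def
        by (rule sum.mono_neutral_left[OF finI sub]) (use zero in auto)
      moreover have "(\<Sum>p\<in>J a'. lam p a' *\<^sub>R u p) = (\<Sum>p\<in>I m. lam p a' *\<^sub>R u p)"
        by (rule sum.mono_neutral_left[OF finI sub]) (use zero in auto)
      moreover have "h0 a' = (1 / w a') *\<^sub>R (\<Sum>p\<in>J a'. lam p a' *\<^sub>R u p)"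
        by (simp add: h0_def scaleR_sum_right)
      ultimately show ?thesis by simp
    qed
    have laml: "(\<lambda>k. lam p (x k)) \<longlonglongrightarrow> lam p a" for p
      unfolding lam_def bump_def
      by (intro tendsto_intros dlim[OF lim] \<delta>lim[OF lim])
    have "w a = (\<Sum>p\<in>I m. lam p a)" unfolding w_def
      by (rule sum.mono_neutral_left[OF finI JI[OF m]]) (use a lam0 in \<open>auto simp: J_def I_def less_le\<close>)
    then have "(\<Sum>p\<in>I m. lam p a) \<noteq> 0" using wpos[OF a] by simp
    then have 1: "limitin X (\<lambda>k. (1 / (\<Sum>p\<in>I m. lam p (x k))) *\<^sub>R (\<Sum>p\<in>I m. lam p (x k) *\<^sub>R u p))
      ((1 / (\<Sum>p\<in>I m. lam p a)) *\<^sub>R (\<Sum>p\<in>I m. lam p a *\<^sub>R u p)) sequentially"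
      by (intro lim_scale lim_sum finI tendsto_divide tendsto_sum tendsto_const laml) auto
    have "\<forall>\<^sub>F k in sequentially. d (x k) > d a / 2"
      using order_tendstoD(1)[OF dlim[OF lim], of "d a / 2"] a by simp
    then have "\<forall>\<^sub>F k in sequentially. (1 / (\<Sum>p\<in>I m. lam p (x k))) *\<^sub>R (\<Sum>p\<in>I m. lam p (x k) *\<^sub>R u p) = h0 (x k)"
      by eventually_elim (simp add: alt)
    from limitin_transform_eventually[OF this 1] show ?thesis
      using alt[of a] a by simp
  qed
  define h1 where "h1 a = (if a \<in> B then g a else h0 a)" for a
  have h1cont: "limitin X (\<lambda>k. h1 (x k)) (h1 a) sequentially"
    if x: "\<And>k. x k \<in> C" "a \<in> C" "(\<lambda>k. \<delta> (x k) a) \<longlonglongrightarrow> 0" for x :: "nat \<Rightarrow> 'b" and a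
  proof (cases "a \<in> B")
    case False
    have "d a > 0" using dpos x(2) False by blast
    moreover have "\<forall>\<^sub>F k in sequentially. h0 (x k) = h1 (x k)"
      using order_tendstoD(1)[OF dlim[OF x(3)] \<open>d a > 0\<close>]
      by eventually_elim (use dB in \<open>auto simp: h1_def\<close>)
    ultimately show ?thesis
      using limitin_transform_eventually[OF _ h0cont[OF x(3)]] False by (simp add: h1_def)
  next
    case True
    show ?thesis
      unfolding limitin_iff_znhd
    proof clarify
      fix V assume "znhd X V"
      then obtain V1 where V1: "znhd X V1" "abscon V1" "V1 \<subseteq> V" by (rule znhd_abscon)
      obtain W where W: "znhd X W" "abscon W" "W \<subseteq> V1" "\<And>x y. x \<in> W \<Longrightarrow> y \<in> W \<Longrightarrow> x + y \<in> V1"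
        using V1(1) by (rule znhd_half) blast
      have "a \<in> topspace (subtopology M.mtopology B)" using True BC by auto
      with gB[unfolded cont_at_iff] W(1)
      have "\<exists>U. openin (subtopology M.mtopology B) U \<and> a \<in> U \<and> (\<forall>z\<in>U. g z - g a \<in> W)" by simp
      then obtain O1 where O1: "openin (subtopology M.mtopology B) O1" "a \<in> O1" "\<forall>b\<in>O1. g b - g a \<in> W"
        by blast
      obtain O2 where O2: "openin M.mtopology O2" "O1 = O2 \<inter> B" using O1(1) by (auto simp: openin_subtopology)
      obtain \<eta> where \<eta>: "\<eta> > 0" "M.mball a \<eta> \<subseteq> O2" using O2 O1(2) unfolding M.openin_mtopology by blast
      have gnear: "g b - g a \<in> W" if "b \<in> B" "\<delta> a b < \<eta>" for b
      proof -
        have "b \<in> M.mball a \<eta>" using that BC x(2) by auto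
        then have "b \<in> O1" using \<eta>(2) O2(2) that(1) by blast
        then show ?thesis using O1(3) by blast
      qed
      have "\<forall>\<^sub>F n in sequentially. P n - 0 \<in> W" using P(1) W(1) unfolding limitin_iff_znhd by blast
      then obtain n0 where n0: "\<And>n. n \<ge> n0 \<Longrightarrow> P n \<in> W" by (auto simp: eventually_sequentially)
      \<comment> \<open>A net point used at x k is within three times the distance from x k to a,
        hence the third of \<eta>; the other bound forces all active levels to be at least
        n0.\<close>
      define \<rho> where "\<rho> = min (\<eta> / 3) (1 / real (n0 + 2))"
      have "\<rho> > 0" using \<eta>(1) by (simp add: \<rho>_def)
      then have "\<forall>\<^sub>F k in sequentially. \<delta> (x k) a < \<rho>" using order_tendstoD(2)[OF x(3)] by blast
      then show "\<forall>\<^sub>F k in sequentially. h1 (x k) - h1 a \<in> V"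
      proof eventually_elim
        case (elim k)
        show ?case
        proof (cases "x k \<in> B")
          case xB: True
          have "g (x k) - g a \<in> W"
            by (rule gnear[OF xB]) (use elim U.commute[of a "x k"] \<eta>(1) in \<open>simp add: \<rho>_def\<close>)
          then show ?thesis using True xB W(3) V1(3) by (auto simp: h1_def)
        next
          case xB: False
          have dp: "d (x k) > 0" using dpos x(1) xB by blast
          have dk: "d (x k) \<le> \<delta> (x k) a" by (rule dle[OF True])
          have mem: "u p - g a \<in> V1" if p: "p \<in> J (x k)" for p
          proof -
            have l: "lam p (x k) > 0" "snd p \<in> N (fst p)" using p by (auto simp: J_def)
            have "\<delta> a (snd p) \<le> \<delta> (x k) a + \<delta> (x k) (snd p)"
              using U.triangle[of a "x k" "snd p"] U.commute[of a "x k"] by simp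
            also have "\<dots> < 3 * \<delta> (x k) a" using lamD(2)[OF l(1)] dk by linarith
            also have "\<dots> < \<eta>" using elim by (simp add: \<rho>_def)
            finally have 1: "g (snd p) - g a \<in> W" using gnear l(2) N(2) by blast
            have "1 / real (fst p + 2) < d (x k)" using lamD(1)[OF l(1)] unfolding bump_pos_iff by simp
            also have "\<dots> < 1 / real (n0 + 2)" using dk elim by (simp add: \<rho>_def)
            finally have "n0 \<le> fst p" by (simp add: field_simps)
            then have 2: "P (fst p) \<in> W" by (rule n0)
            from W(4)[OF 1 2] show ?thesis by (simp add: u_def algebra_simps)
          qed
          have "(\<Sum>p\<in>J (x k). (lam p (x k) / w (x k)) *\<^sub>R (u p - g a)) \<in> V1"
            by (rule conv[OF dp abscon_convex[OF V1(2)] mem])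
          moreover have "(\<Sum>p\<in>J (x k). (lam p (x k) / w (x k)) *\<^sub>R (u p - g a)) = h0 (x k) - g a"
            using w1[OF dp] by (simp add: h0_def scaleR_diff_right sum_subtractf scaleR_sum_left[symmetric])
          ultimately show ?thesis using True xB V1(3) by (auto simp: h1_def)
        qed
      qed
    qed
  qed

  obtain e Nh where e: "\<And>j::nat. e j \<in> Kp" "\<And>j. closedin X (Nh j)" "\<And>j. abscon (Nh j)"
    "\<And>i j. j < i \<Longrightarrow> (2^(i - j)) *\<^sub>R e i \<in> Nh j"
    "\<And>j g. g \<in> span (v ` {..j} \<union> e ` {..<j}) \<Longrightarrow> e j - g \<notin> Nh j"
    using independent_null_sequence[OF Kp(2) inf, of v] by blast
  \<comment> \<open>The constant entry 1 makes the products with d a record d a itself; the other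
    entries record the position of a in C.\<close>
  define y where "y a i = (case i of 0 \<Rightarrow> 1 | Suc i' \<Rightarrow> \<delta> a (z i'))" for a and i :: nat
  \<comment> \<open>Through \<open>prod_decode\<close> every entry recurs infinitely often, as
    \<open>wsum_injective\<close> demands, and the factor d a removes the perturbation on B.\<close>
  define c where "c a j = d a * y a (fst (prod_decode j))" for a j
  have y01: "0 \<le> y a i" "y a i \<le> 1" for a i
    using \<delta>(2) by (auto simp: y_def less_imp_le split: nat.splits)
  have c01: "0 \<le> c a j" "c a j \<le> 1" for a j
    unfolding c_def using y01(1) dge mult_le_one[OF less_imp_le[OF d1] y01(1) y01(2)] by simp_all
  have cabs: "\<bar>c a j\<bar> \<le> 1" and cdabs: "\<bar>c a j - c a' j\<bar> \<le> 1" for a a' j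
    using c01[of a j] c01[of a' j] by (auto simp: abs_le_iff)
  define h where "h a = h1 a + wsum e (c a)" for a
  have "continuous_map M.mtopology X h"
  proof (rule M.continuous_map_sequentially)
    fix x :: "nat \<Rightarrow> 'b" and a assume x: "\<And>k. x k \<in> C" "a \<in> C" "(\<lambda>k. \<delta> (x k) a) \<longlonglongrightarrow> 0"
    have "(\<lambda>k. c (x k) j) \<longlonglongrightarrow> c a j" for j
      unfolding c_def y_def
      by (cases "fst (prod_decode j)") (auto intro!: tendsto_intros dlim[OF x(3)] \<delta>lim[OF x(3)])
    then have "limitin X (\<lambda>k. wsum e (c (x k))) (wsum e (c a)) sequentially"
      by (intro wsum_continuous[of Kp e "\<lambda>k. c (x k)" "c a"] Kp e cabs)
    then show "limitin X (\<lambda>k. h (x k)) (h a) sequentially"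
      unfolding h_def by (rule lim_add[OF h1cont[OF x]])
  qed simp
  then have hc: "continuous_map (subtopology Y C) X h" by (simp add: topC)
  have hB: "h b = g b" if "b \<in> B" for b
  proof -
    have "c b = (\<lambda>_. 0)" by (simp add: c_def dB[OF that] fun_eq_iff)
    then show ?thesis using that by (simp add: h_def h1_def wsum_zero)
  qed
  have off: False if "a \<in> B" "a' \<in> C" "a' \<notin> B" "h a = h a'" for a a'
  proof -
    obtain s t where st: "h0 a' = s + t" "s \<in> Kc" "t \<notin> L" using split[OF dpos[OF \<open>a' \<in> C\<close> \<open>a' \<notin> B\<close>]] by blast
    have "g a = s + t + wsum e (c a')" using that hB[of a] st(1) by (simp add: h_def h1_def)
    then have "t = (g a - s) - wsum e (c a')" by (simp add: algebra_simps)
    moreover have "wsum e (c a') \<in> (*\<^sub>R) 2 ` Kp" by (rule wsum_bound[of Kp e "c a'", OF Kp e(1) cabs])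
    moreover have "g a \<in> Kc" using Kc(3) that(1) by blast
    ultimately have "t \<in> L" using st(2) L(3) by blast
    then show False using st(3) by blast
  qed
  have "inj_on h C"
  proof (rule inj_onI, rule ccontr)
    fix a a' assume aa: "a \<in> C" "a' \<in> C" "h a = h a'" "a \<noteq> a'"
    consider "a \<in> B" "a' \<in> B" | "a \<in> B" "a' \<notin> B" | "a \<notin> B" "a' \<in> B" | "a \<notin> B" "a' \<notin> B" by blast
    then show False
    proof cases
      case 1
      then show False using hB aa g(2) by (metis inj_onD)
    next
      case 2
      then show False using off aa by blast
    next
      case 3
      then show False using off[of a' a] aa by simp
    next
      case 4
      have pos: "d a > 0" "d a' > 0" using dpos aa 4 by blast+
      have "h0 a + wsum e (c a) = h0 a' + wsum e (c a')" using aa(3) 4 by (simp add: h_def h1_def)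
      then have "wsum e (c a) - wsum e (c a') = h0 a' - h0 a" by (simp add: algebra_simps)
      then have "wsum e (\<lambda>j. c a j - c a' j) = h0 a' - h0 a"
        using wsum_diff[of Kp e "c a" "c a'", OF Kp e(1) cabs cabs cdabs] by simp
      moreover have "h0 a' - h0 a \<in> span (range v)" by (intro span_diff h0span)
      ultimately obtain n where n: "wsum e (\<lambda>j. c a j - c a' j) \<in> span (v ` {..n})"
        using span_range_finite by metis
      have "\<exists>i. d a * y a i \<noteq> d a' * y a' i"
      proof (rule ccontr)
        assume "\<not> ?thesis"
        then have eq: "\<And>i. d a * y a i = d a' * y a' i" by blast
        from eq[of 0] have dd: "d a = d a'" by (simp add: y_def)
        have "\<delta> a (z i) = \<delta> a' (z i)" for i using eq[of "Suc i"] dd pos by (simp add: y_def)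
        then show False using zsep aa by blast
      qed
      then obtain i where i: "d a * y a i \<noteq> d a' * y a' i" ..
      have many: "\<exists>j\<ge>N. c a j - c a' j \<noteq> 0" for N
      proof (intro exI conjI)
        show "N \<le> prod_encode (i, N)" by (rule le_prod_encode_2)
        show "c a (prod_encode (i, N)) - c a' (prod_encode (i, N)) \<noteq> 0" using i by (simp add: c_def)
      qed
      show False
        by (rule wsum_injective[of Kp e Nh v "\<lambda>j. c a j - c a' j" n, OF Kp e(1-5) cdabs many n])
    qed
  qed
  with hc hB show "\<exists>h. continuous_map (subtopology Y C) X h \<and> inj_on h C \<and> (\<forall>b\<in>B. h b = g b)" by blast
qed

end

section \<open>The space R-infinity and its product with the Hilbert cube\<close>

lemma lookup_scaleR [simp]: "Poly_Mapping.lookup (r *\<^sub>R x) i = r * Poly_Mapping.lookup x i"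
  for x :: "'a \<Rightarrow>\<^sub>0 real"
proof -
  have "finite {i. r *\<^sub>R Poly_Mapping.lookup x i \<noteq> 0}"
    by (rule finite_subset[of _ "Poly_Mapping.keys x"]) (auto simp: in_keys_iff)
  then show ?thesis by (simp add: scaleR_poly_mapping_def)
qed

definition bas :: "nat \<Rightarrow> (nat \<Rightarrow>\<^sub>0 real)" where "bas i = Poly_Mapping.single i 1"

lemma lookup_bas: "Poly_Mapping.lookup (bas i) j = (if i = j then 1 else 0)"
  by (simp add: bas_def lookup_single when_def)

lemma lookup_bas_sum:
  "Poly_Mapping.lookup (\<Sum>i<n. v i *\<^sub>R bas i) j = (if j < n then v j else 0)"
  by (simp add: lookup_sum lookup_bas if_distrib[of "(*) _"] cong: if_cong)

lemma poly_mapping_bas_sum: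
  assumes "\<And>i. i \<ge> n \<Longrightarrow> Poly_Mapping.lookup x i = 0"
  shows "x = (\<Sum>i<n. Poly_Mapping.lookup x i *\<^sub>R bas i)"
  by (rule poly_mapping_eqI) (use assms in \<open>simp add: lookup_bas_sum\<close>)

lemma Abs_bas_sum:
  assumes "v \<in> topspace (Euclidean_space n)"
  shows "Abs_poly_mapping v = (\<Sum>i<n. v i *\<^sub>R bas i)"
proof (rule poly_mapping_eqI)
  fix j
  have v: "\<forall>i\<ge>n. v i = 0" using assms by (simp add: topspace_Euclidean_space)
  have "{i. v i \<noteq> 0} \<subseteq> {..<n}"
  proof (rule subsetI)
    fix i assume "i \<in> {i. v i \<noteq> 0}"
    then show "i \<in> {..<n}" using v by (cases "i < n") auto
  qed
  then have "finite {i. v i \<noteq> 0}" using finite_subset by blast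
  then show "Poly_Mapping.lookup (Abs_poly_mapping v) j = Poly_Mapping.lookup (\<Sum>i<n. v i *\<^sub>R bas i) j"
    using v by (simp add: lookup_bas_sum)
qed

text \<open>The pulled-back topology will be one of those generating
  \<open>R_infinity\<close>.\<close>

lemma locally_convex_pullback:
  fixes \<phi> :: "'a::real_vector \<Rightarrow> 'b::real_vector"
  assumes T: "locally_convex_topology T" and \<phi>: "linear \<phi>"
  shows "locally_convex_topology (pullback_topology UNIV \<phi> T)"
proof -
  let ?P = "pullback_topology UNIV \<phi> T"
  have tT: "topspace T = UNIV" using T by (simp add: locally_convex_topology_def)
  have top: "topspace ?P = UNIV" by (simp add: topspace_pullback_topology tT)
  have c: "continuous_map ?P T \<phi>" using continuous_map_pullback[of T T id UNIV \<phi>] by simp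
  have "continuous_map (prod_topology ?P ?P) T (\<lambda>z. \<phi> (fst z) + \<phi> (snd z))"
  proof -
    have "continuous_map (prod_topology ?P ?P) T (\<lambda>z. \<phi> (fst z))"
      using continuous_map_compose[OF continuous_map_fst[of ?P ?P] c] by (simp add: o_def)
    moreover have "continuous_map (prod_topology ?P ?P) T (\<lambda>z. \<phi> (snd z))"
      using continuous_map_compose[OF continuous_map_snd[of ?P ?P] c] by (simp add: o_def)
    ultimately have "continuous_map (prod_topology ?P ?P) (prod_topology T T) (\<lambda>z. (\<phi> (fst z), \<phi> (snd z)))"
      by (simp add: continuous_map_pairwise o_def)
    moreover have "continuous_map (prod_topology T T) T (\<lambda>(x, y). x + y)"
      using T by (simp add: locally_convex_topology_def)
    ultimately have "continuous_map (prod_topology ?P ?P) T ((\<lambda>(x, y). x + y) \<circ> (\<lambda>z. (\<phi> (fst z), \<phi> (snd z))))"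
      by (rule continuous_map_compose)
    then show ?thesis by (simp add: o_def)
  qed
  then have 1: "continuous_map (prod_topology ?P ?P) ?P (\<lambda>(x, y). x + y)"
    by (intro continuous_map_pullback') (simp_all add: o_def case_prod_unfold linear_add[OF \<phi>])
  have "continuous_map (prod_topology euclideanreal ?P) T (\<lambda>z. fst z *\<^sub>R \<phi> (snd z))"
  proof -
    have "continuous_map (prod_topology euclideanreal ?P) T (\<lambda>z. \<phi> (snd z))"
      using continuous_map_compose[OF continuous_map_snd[of euclideanreal ?P] c] by (simp add: o_def)
    then have "continuous_map (prod_topology euclideanreal ?P) (prod_topology euclideanreal T) (\<lambda>z. (fst z, \<phi> (snd z)))"
      using continuous_map_fst[of euclideanreal ?P] by (simp add: continuous_map_pairwise o_def)
    moreover have "continuous_map (prod_topology euclideanreal T) T (\<lambda>(x, y). x *\<^sub>R y)"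
      using T by (simp add: locally_convex_topology_def)
    ultimately have "continuous_map (prod_topology euclideanreal ?P) T ((\<lambda>(x, y). x *\<^sub>R y) \<circ> (\<lambda>z. (fst z, \<phi> (snd z))))"
      by (rule continuous_map_compose)
    then show ?thesis by (simp add: o_def)
  qed
  then have 2: "continuous_map (prod_topology euclideanreal ?P) ?P (\<lambda>(c, x). c *\<^sub>R x)"
    by (intro continuous_map_pullback') (simp_all add: o_def case_prod_unfold linear_scale[OF \<phi>])
  have "neighbourhood_base_of convex ?P"
    unfolding neighbourhood_base_of
  proof (intro allI impI, elim conjE)
    fix W x assume "openin ?P W" "x \<in> W"
    then obtain W' where W': "openin T W'" "W = \<phi> -` W'" by (auto simp: openin_pullback_topology)
    have "neighbourhood_base_of convex T" using T by (simp add: locally_convex_topology_def)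
    then have "\<exists>U V. openin T U \<and> convex V \<and> \<phi> x \<in> U \<and> U \<subseteq> V \<and> V \<subseteq> W'"
      unfolding neighbourhood_base_of using W' \<open>x \<in> W\<close> by (elim allE[of _ W'] allE[of _ "\<phi> x"]) simp
    then obtain U V where UV: "openin T U" "convex V" "\<phi> x \<in> U" "U \<subseteq> V" "V \<subseteq> W'" by blast
    have "openin ?P (\<phi> -` U)" using UV(1) by (auto simp: openin_pullback_topology)
    moreover have "convex (\<phi> -` V)" by (rule convex_linear_vimage[OF \<phi> UV(2)])
    ultimately show "\<exists>U V. openin ?P U \<and> convex V \<and> x \<in> U \<and> U \<subseteq> V \<and> V \<subseteq> W"
      using UV W'(2) by (intro exI[of _ "\<phi> -` U"] exI[of _ "\<phi> -` V"]) auto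
  qed
  with top 1 2 show ?thesis by (simp add: locally_convex_topology_def)
qed

lemma lcs_normed: "lcs (euclidean :: 'a::real_normed_vector topology)"
proof
  have 1: "continuous_map (prod_topology euclidean euclidean) euclidean (\<lambda>(x, y). x + y :: 'a)"
    by (simp add: case_prod_unfold continuous_intros)
  have 2: "continuous_map (prod_topology euclideanreal euclidean) euclidean (\<lambda>(c, x). c *\<^sub>R x :: 'a)"
    by (simp add: case_prod_unfold continuous_intros)
  have "neighbourhood_base_of convex (euclidean :: 'a topology)"
    unfolding neighbourhood_base_of
  proof (intro allI impI, elim conjE)
    fix W and x :: 'a assume "openin euclidean W" "x \<in> W"
    then obtain e where "e > 0" "ball x e \<subseteq> W" by (auto simp: open_contains_ball)
    then show "\<exists>U V. openin euclidean U \<and> convex V \<and> x \<in> U \<and> U \<subseteq> V \<and> V \<subseteq> W"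
      by (intro exI[of _ "ball x e"]) auto
  qed
  with 1 2 show "locally_convex_topology (euclidean :: 'a topology)" by (simp add: locally_convex_topology_def)
qed (simp add: Hausdorff_space_euclidean)

text \<open>Along any linear map the pullback is a locally convex topology for which the inclusions
  are continuous, since on each Euclidean space the map is a finite sum; so it is coarser than
  \<open>R_infinity\<close>.\<close>

lemma (in lcs) R_infinity_continuous:
  assumes \<phi>: "linear \<phi>"
  shows "continuous_map R_infinity X \<phi>"
proof -
  have "continuous_map (Euclidean_space n) (pullback_topology UNIV \<phi> X) Abs_poly_mapping" for n
  proof (rule continuous_map_pullback')
    have "continuous_map (Euclidean_space n) X (\<lambda>v. \<Sum>i<n. v i *\<^sub>R \<phi> (bas i))"
    proof (intro cont_sum cont_scale)
      fix i show "continuous_map (Euclidean_space n) euclideanreal (\<lambda>v. v i)"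
        unfolding Euclidean_space_def
        by (intro continuous_map_from_subtopology continuous_map_product_projection) simp
    qed auto
    then show "continuous_map (Euclidean_space n) X (\<phi> \<circ> Abs_poly_mapping)"
      by (rule continuous_map_eq) (simp add: Abs_bas_sum linear_sum[OF \<phi>] linear_scale[OF \<phi>])
  qed simp
  moreover have "locally_convex_topology (pullback_topology UNIV \<phi> X)"
    by (rule locally_convex_pullback[OF lc \<phi>])
  ultimately have "openin R_infinity (\<phi> -` U)" if "openin X U" for U
    using that by (intro openin_R_infinityI[where T="pullback_topology UNIV \<phi> X"]) (auto simp: openin_pullback_topology)
  then show ?thesis by (simp add: continuous_map_def vimage_def)
qed

lemma R_infinity_lookup: "continuous_map R_infinity euclideanreal (\<lambda>x. Poly_Mapping.lookup x i)"
  by (rule lcs.R_infinity_continuous[OF lcs_normed]) (auto intro!: linearI simp: lookup_add)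

text \<open>The norm topology is coarser; this gives the Hausdorff property and a continuous
  metric.\<close>

lemma R_infinity_norm: "continuous_map R_infinity euclidean (\<lambda>x. x)"
  by (rule lcs.R_infinity_continuous[OF lcs_normed]) (simp add: linear_iff)

interpretation R: lcs R_infinity
proof
  show "locally_convex_topology R_infinity" by (rule locally_convex_R_infinity)
  show "Hausdorff_space R_infinity"
    by (rule Hausdorff_space_injective_preimage[OF _ R_infinity_norm]) (auto simp: Hausdorff_space_euclidean)
qed

lemma abs_lookup_le_norm: "\<bar>Poly_Mapping.lookup x i\<bar> \<le> norm x" for x :: "nat \<Rightarrow>\<^sub>0 real"
proof (cases "i \<in> Poly_Mapping.keys x")
  case True
  have "\<bar>Poly_Mapping.lookup x i\<bar> = dist (Poly_Mapping.lookup x i) (Poly_Mapping.lookup 0 i)" by simp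
  also have "\<dots> \<le> (\<Sum>n\<in>Poly_Mapping.keys x. dist (Poly_Mapping.lookup x n) (Poly_Mapping.lookup 0 n))"
    by (rule member_le_sum[OF True, of "\<lambda>n. dist (Poly_Mapping.lookup x n) (Poly_Mapping.lookup 0 n)"]) simp_all
  also have "\<dots> = norm x" unfolding norm_poly_mapping_def dist_poly_mapping_def by simp
  finally show ?thesis .
next
  case False
  then show ?thesis by (simp add: in_keys_iff)
qed

text \<open>Dividing coordinate i by \<epsilon> i is linear, hence continuous; the neighbourhood is
  the preimage of a unit ball of the norm.\<close>

lemma R_infinity_box_nhd:
  fixes \<epsilon> :: "nat \<Rightarrow> real"
  assumes \<epsilon>: "\<And>i. \<epsilon> i > 0"
  shows "\<exists>O'. openin R_infinity O' \<and> x \<in> O' \<and> (\<forall>y\<in>O'. \<forall>i. \<bar>Poly_Mapping.lookup (y - x) i\<bar> \<le> \<epsilon> i)"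
proof -
  define \<phi> where "\<phi> y = Abs_poly_mapping (\<lambda>i. Poly_Mapping.lookup y i / \<epsilon> i)" for y :: "nat \<Rightarrow>\<^sub>0 real"
  have l: "Poly_Mapping.lookup (\<phi> y) i = Poly_Mapping.lookup y i / \<epsilon> i" for y i
  proof -
    have "finite {i. Poly_Mapping.lookup y i / \<epsilon> i \<noteq> 0}"
      by (rule finite_subset[of _ "Poly_Mapping.keys y"]) (auto simp: in_keys_iff)
    then show ?thesis by (simp add: \<phi>_def)
  qed
  have lin: "linear \<phi>"
    by (rule linearI; rule poly_mapping_eqI) (simp_all add: l lookup_add add_divide_distrib)
  have "openin R_infinity {y \<in> topspace R_infinity. \<phi> y \<in> ball (\<phi> x) 1}"
    by (rule openin_continuous_map_preimage[OF lcs.R_infinity_continuous[OF lcs_normed lin]]) simp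
  moreover have "\<bar>Poly_Mapping.lookup (y - x) i\<bar> \<le> \<epsilon> i" if "\<phi> y \<in> ball (\<phi> x) 1" for y i
  proof -
    have "norm (\<phi> (y - x)) < 1" using that by (simp add: dist_norm linear_diff[OF lin] norm_minus_commute)
    then have "\<bar>Poly_Mapping.lookup (y - x) i / \<epsilon> i\<bar> < 1" using abs_lookup_le_norm[of "\<phi> (y - x)" i] by (simp add: l)
    then show ?thesis using \<epsilon>[of i] by (simp add: abs_divide)
  qed
  ultimately show ?thesis by (intro exI[of _ "{y. \<phi> y \<in> ball (\<phi> x) 1}"]) simp
qed

section \<open>Boxes, and the tower of the product with the Hilbert cube\<close>

definition cube :: "(nat \<Rightarrow> real) \<Rightarrow> nat \<Rightarrow> (nat \<Rightarrow>\<^sub>0 real) set" where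
  "cube \<epsilon> n = {x. (\<forall>i<n. \<bar>Poly_Mapping.lookup x i\<bar> \<le> \<epsilon> i) \<and> (\<forall>i\<ge>n. Poly_Mapping.lookup x i = 0)}"

lemma cube_0: "cube \<epsilon> 0 = {0}"
  by (auto simp: cube_def intro: poly_mapping_eqI)

lemma cube_Suc: "cube \<epsilon> (Suc n) = {x + y |x y. x \<in> cube \<epsilon> n \<and> y \<in> {c *\<^sub>R z |c z. c \<in> {- \<epsilon> n..\<epsilon> n} \<and> z \<in> {bas n}}}"
proof (intro equalityI subsetI)
  fix z assume z: "z \<in> cube \<epsilon> (Suc n)"
  define y where "y = Poly_Mapping.lookup z n *\<^sub>R bas n"
  have "z - y \<in> cube \<epsilon> n"
    using z by (auto simp: cube_def y_def lookup_minus lookup_bas le_less_Suc_eq not_less_eq_eq[symmetric])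
  moreover have "Poly_Mapping.lookup z n \<in> {- \<epsilon> n..\<epsilon> n}" using z by (auto simp: cube_def abs_le_iff)
  moreover have "z = (z - y) + y" by simp
  ultimately show "z \<in> {x + y |x y. x \<in> cube \<epsilon> n \<and> y \<in> {c *\<^sub>R z |c z. c \<in> {- \<epsilon> n..\<epsilon> n} \<and> z \<in> {bas n}}}"
    unfolding y_def by blast
next
  fix z assume "z \<in> {x + y |x y. x \<in> cube \<epsilon> n \<and> y \<in> {c *\<^sub>R z |c z. c \<in> {- \<epsilon> n..\<epsilon> n} \<and> z \<in> {bas n}}}"
  then obtain x c where "x \<in> cube \<epsilon> n" "c \<in> {- \<epsilon> n..\<epsilon> n}" "z = x + c *\<^sub>R bas n" by blast
  then show "z \<in> cube \<epsilon> (Suc n)"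
    by (auto simp: cube_def lookup_add lookup_bas less_Suc_eq abs_le_iff)
qed

lemma compact_cube: "compactin R_infinity (cube \<epsilon> n)"
proof (induction n)
  case 0
  then show ?case by (simp add: cube_0)
next
  case (Suc n)
  then show ?case unfolding cube_Suc by (intro R.compact_plus R.compact_scaleset) auto
qed

lemma bounded_in_cube:
  obtains N where "(\<lambda>y. x + y) ` cube \<epsilon> n \<subseteq> cube (\<lambda>_. real N) N"
proof -
  define I where "I = Poly_Mapping.keys x \<union> {..<n}"
  have fI: "finite I" by (simp add: I_def)
  define s where "s = (\<Sum>i\<in>I. \<bar>Poly_Mapping.lookup x i\<bar> + \<bar>\<epsilon> i\<bar>)"
  obtain N1 where N1: "s \<le> real N1" using real_arch_simple by blast
  define N where "N = max N1 (Suc (Max (insert 0 I)))"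
  have IN: "i < N" if "i \<in> I" for i
  proof -
    have "i \<le> Max (insert 0 I)" using fI that by (intro Max_ge) auto
    then show ?thesis by (simp add: N_def)
  qed
  have sN: "s \<le> real N" using N1 by (simp add: N_def)
  show thesis
  proof (rule that[of N], clarify)
    fix y assume y: "y \<in> cube \<epsilon> n"
    have "\<bar>Poly_Mapping.lookup (x + y) i\<bar> \<le> real N" if "i \<in> I" for i
    proof -
      have "\<bar>Poly_Mapping.lookup y i\<bar> \<le> \<bar>\<epsilon> i\<bar>" using y by (cases "i < n") (auto simp: cube_def)
      then have "\<bar>Poly_Mapping.lookup (x + y) i\<bar> \<le> \<bar>Poly_Mapping.lookup x i\<bar> + \<bar>\<epsilon> i\<bar>" by (simp add: lookup_add)
      also have "\<dots> \<le> s" unfolding s_def using fI that by (intro member_le_sum[of i I "\<lambda>i. \<bar>Poly_Mapping.lookup x i\<bar> + \<bar>\<epsilon> i\<bar>"]) auto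
      finally show ?thesis using sN by simp
    qed
    moreover have "Poly_Mapping.lookup (x + y) i = 0" if "i \<notin> I" for i
      using that y by (auto simp: I_def cube_def lookup_add in_keys_iff)
    ultimately have 1: "\<bar>Poly_Mapping.lookup (x + y) i\<bar> \<le> real N" and 2: "i \<ge> N \<Longrightarrow> Poly_Mapping.lookup (x + y) i = 0" for i
      using IN[of i] by (cases "i \<in> I"; simp)+
    show "x + y \<in> cube (\<lambda>_. real N) N"
      unfolding cube_def using 1 2 by simp
  qed
qed

lemma topspace_Hilbert_cube: "topspace Hilbert_cube = {f. \<forall>i. f i \<in> {0..1}}"
  by (auto simp: Hilbert_cube_def)

lemma compact_Hilbert_cube: "compact_space Hilbert_cube"
  unfolding Hilbert_cube_def
  by (auto simp: compact_space_product_topology compact_space_subtopology compactin_euclidean_iff)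

lemma Hausdorff_Hilbert_cube: "Hausdorff_space Hilbert_cube"
  unfolding Hilbert_cube_def by (auto simp: Hausdorff_space_product_topology Hausdorff_space_subtopology)

abbreviation RQ where "RQ \<equiv> prod_topology R_infinity Hilbert_cube"

abbreviation qs where "qs \<equiv> topspace Hilbert_cube"

text \<open>Adding t times the next unit vector maps into one tower set, where U is relatively open.
  By compactness a common \<eta> serves all points of the box and of Cq, via Wallace's
  theorem.\<close>

lemma tube_step:
  assumes U: "\<And>n. openin (subtopology RQ (cube (\<lambda>_. real n) n \<times> qs)) (U \<inter> (cube (\<lambda>_. real n) n \<times> qs))"
    and Cq: "compactin Hilbert_cube Cq" and sub: "(\<lambda>y. x + y) ` cube \<epsilon> n \<times> Cq \<subseteq> U"
  obtains \<eta> where "\<eta> > 0" "(\<lambda>y. x + y) ` cube (\<epsilon>(n := \<eta>)) (Suc n) \<times> Cq \<subseteq> U"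
proof -
  define Z where "Z = (\<lambda>y. x + y) ` cube \<epsilon> n"
  obtain N where N: "(\<lambda>y. x + y) ` cube (\<epsilon>(n := 1)) (Suc n) \<subseteq> cube (\<lambda>_. real N) N"
    by (rule bounded_in_cube)
  have ceq: "cube (\<epsilon>(n := e)) n = cube \<epsilon> n" for e by (auto simp: cube_def)
  have ZN: "z + t *\<^sub>R bas n \<in> cube (\<lambda>_. real N) N" if z: "z \<in> Z" and t: "\<bar>t\<bar> \<le> 1" for z t
  proof -
    obtain y where y: "y \<in> cube \<epsilon> n" "z = x + y" using z by (auto simp: Z_def)
    have "y + t *\<^sub>R bas n \<in> cube (\<epsilon>(n := 1)) (Suc n)"
      unfolding cube_Suc ceq using y(1) t by (auto simp: abs_le_iff)
    then show ?thesis using N by (force simp: y(2) add.assoc)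
  qed
  let ?K = "cube (\<lambda>_. real N) N \<times> qs"
  let ?T = "top_of_set {-1..1::real}"
  let ?D = "prod_topology (subtopology RQ (Z \<times> Cq)) ?T"
  let ?m = "\<lambda>p. (fst (fst p) + snd p *\<^sub>R bas n, snd (fst p))"
  have Cqs: "Cq \<subseteq> qs" using Cq by (rule compactin_subset_topspace)
  have cZ: "compactin R_infinity Z"
    unfolding Z_def by (rule image_compactin[OF compact_cube]) (auto intro: R.cont_add)
  have tD: "topspace ?D = (Z \<times> Cq) \<times> {-1..1}" using Cqs by auto
  have f1: "continuous_map ?D RQ (\<lambda>p. fst p)"
    using continuous_map_fst continuous_map_in_subtopology by blast
  have "continuous_map ?D R_infinity (\<lambda>p. fst (fst p) + snd p *\<^sub>R bas n)"
  proof (intro R.cont_add R.cont_scale)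
    show "continuous_map ?D R_infinity (\<lambda>p. fst (fst p))"
      using continuous_map_compose[OF f1 continuous_map_fst] by (simp add: o_def)
    show "continuous_map ?D euclideanreal snd"
      using continuous_map_snd continuous_map_in_subtopology by blast
  qed simp
  moreover have "continuous_map ?D Hilbert_cube (\<lambda>p. snd (fst p))"
    using continuous_map_compose[OF f1 continuous_map_snd] by (simp add: o_def)
  ultimately have "continuous_map ?D RQ ?m" by (simp add: continuous_map_pairwise o_def)
  moreover have "?m \<in> topspace ?D \<rightarrow> ?K" unfolding tD using ZN Cqs by (auto simp: abs_le_iff)
  ultimately have "continuous_map ?D (subtopology RQ ?K) ?m" by (rule continuous_map_into_subtopology)
  from openin_continuous_map_preimage[OF this U[of N]]
  have W: "openin ?D {p \<in> topspace ?D. ?m p \<in> U \<inter> ?K}" .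
  have k1: "compactin (subtopology RQ (Z \<times> Cq)) (Z \<times> Cq)"
    using cZ Cq by (simp add: compactin_subtopology compactin_Times)
  have k2: "compactin ?T {0}" by simp
  have k3: "(Z \<times> Cq) \<times> {0} \<subseteq> {p \<in> topspace ?D. ?m p \<in> U \<inter> ?K}"
    unfolding tD using sub Cqs ZN[of _ 0] by (auto simp: Z_def[symmetric])
  obtain A V where "openin ?T V" "Z \<times> Cq \<subseteq> A" "{0} \<subseteq> V" "A \<times> V \<subseteq> {p \<in> topspace ?D. ?m p \<in> U \<inter> ?K}"
    by (rule Wallace_theorem_prod_topology[OF k1 k2 W k3])
  then have AV: "openin ?T V" "Z \<times> Cq \<subseteq> A" "0 \<in> V" "A \<times> V \<subseteq> {p \<in> topspace ?D. ?m p \<in> U \<inter> ?K}" by blast+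
  obtain V' where V': "open V'" "V = {-1..1} \<inter> V'" using AV(1) by (auto simp: openin_open)
  obtain e where e: "e > 0" "ball 0 e \<subseteq> V'" using V' AV(3) open_contains_ball by blast
  define \<eta> where "\<eta> = min 1 (e / 2)"
  have \<eta>: "\<eta> > 0" "\<eta> \<le> 1" "\<eta> < e" using e by (auto simp: \<eta>_def)
  show thesis
  proof (rule that[OF \<eta>(1)], clarify)
    fix y q assume y: "y \<in> cube (\<epsilon>(n := \<eta>)) (Suc n)" and q: "q \<in> Cq"
    then obtain z t where "z \<in> cube \<epsilon> n" "t \<in> {- \<eta>..\<eta>}" "y = z + t *\<^sub>R bas n"
      unfolding cube_Suc ceq fun_upd_same by blast
    then have z: "z \<in> cube \<epsilon> n" "\<bar>t\<bar> \<le> \<eta>" "y = z + t *\<^sub>R bas n" by (auto simp: abs_le_iff)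
    have "t \<in> V" using z(2) \<eta> e(2) by (auto simp: V'(2) abs_le_iff subset_iff dist_real_def)
    moreover have "(x + z, q) \<in> A" using AV(2) z(1) q by (auto simp: Z_def)
    ultimately have "?m ((x + z, q), t) \<in> U" using AV(4) by blast
    then show "(x + y, q) \<in> U" using z(3) by (simp add: add.assoc)
  qed
qed

text \<open>Starting from x and a compact neighbourhood C of q, \<open>tube_step\<close> adds one
  coordinate at a time. The side lengths found on the way define a box neighbourhood, and each of
  its points has only finitely many nonzero coordinates relative to x.\<close>

lemma RQ_open:
  assumes U: "\<And>n. openin (subtopology RQ (cube (\<lambda>_. real n) n \<times> qs)) (U \<inter> (cube (\<lambda>_. real n) n \<times> qs))"
    and Us: "U \<subseteq> UNIV \<times> qs"
  shows "openin RQ U"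
  unfolding openin_prod_topology_alt
proof (intro allI impI)
  fix x q assume xq: "(x, q) \<in> U"
  then have q: "q \<in> qs" using Us by blast
  define S where "S = {q' \<in> qs. (x, q') \<in> U}"
  obtain N where "(\<lambda>y. x + y) ` cube (\<lambda>_. 1) 0 \<subseteq> cube (\<lambda>_. real N) N" by (rule bounded_in_cube)
  then have xN: "x \<in> cube (\<lambda>_. real N) N" by (simp add: cube_0)
  have "continuous_map Hilbert_cube (subtopology RQ (cube (\<lambda>_. real N) N \<times> qs)) (\<lambda>q. (x, q))"
    by (intro continuous_map_into_subtopology) (use xN in \<open>auto simp: continuous_map_pairwise o_def\<close>)
  from openin_continuous_map_preimage[OF this U[of N]]
  have "openin Hilbert_cube {q' \<in> qs. (x, q') \<in> U \<inter> (cube (\<lambda>_. real N) N \<times> qs)}" .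
  moreover have "{q' \<in> qs. (x, q') \<in> U \<inter> (cube (\<lambda>_. real N) N \<times> qs)} = S" using xN by (auto simp: S_def)
  ultimately have "openin Hilbert_cube S" by simp
  moreover have "neighbourhood_base_of (closedin Hilbert_cube) Hilbert_cube"
    using compact_Hausdorff_imp_regular_space[OF compact_Hilbert_cube Hausdorff_Hilbert_cube]
    by (simp add: neighbourhood_base_of_closedin)
  ultimately have "\<exists>V C. openin Hilbert_cube V \<and> closedin Hilbert_cube C \<and> q \<in> V \<and> V \<subseteq> C \<and> C \<subseteq> S"
    unfolding neighbourhood_base_of using xq q by (elim allE[of _ S] allE[of _ q]) (simp add: S_def)
  then obtain V C where V: "openin Hilbert_cube V" "closedin Hilbert_cube C" "q \<in> V" "V \<subseteq> C" "C \<subseteq> S" by blast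
  have C: "compactin Hilbert_cube C" using closedin_compact_space[OF compact_Hilbert_cube V(2)] .
  define P where "P n \<epsilon> \<longleftrightarrow> (\<forall>i. \<epsilon> i > 0) \<and> (\<lambda>y. x + y) ` cube \<epsilon> n \<times> C \<subseteq> U" for n and \<epsilon> :: "nat \<Rightarrow> real"
  \<comment> \<open>Step n changes coordinate n only, so every coordinate of the successive length
    vectors stabilises.\<close>
  define Q where "Q n \<epsilon> \<epsilon>' \<longleftrightarrow> (\<exists>\<eta>. \<epsilon>' = \<epsilon>(n := \<eta>))" for n :: nat and \<epsilon> \<epsilon>' :: "nat \<Rightarrow> real"
  have start: "\<exists>\<epsilon>. P 0 \<epsilon>"
    unfolding P_def using V(5) by (intro exI[of _ "\<lambda>_. 1"]) (auto simp: cube_0 S_def)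
  have step: "\<exists>\<epsilon>'. P (Suc n) \<epsilon>' \<and> Q n \<epsilon> \<epsilon>'" if P: "P n \<epsilon>" for n \<epsilon>
  proof -
    have "(\<lambda>y. x + y) ` cube \<epsilon> n \<times> C \<subseteq> U" using P by (simp add: P_def)
    then obtain \<eta> where "\<eta> > 0" "(\<lambda>y. x + y) ` cube (\<epsilon>(n := \<eta>)) (Suc n) \<times> C \<subseteq> U"
      by (rule tube_step[OF U C])
    then show ?thesis using P unfolding P_def Q_def by (intro exI[of _ "\<epsilon>(n := \<eta>)"]) auto
  qed
  have "\<exists>E. \<forall>n. P n (E n) \<and> Q n (E n) (E (Suc n))" by (rule dependent_nat_choice[OF start step])
  then obtain E where E: "\<And>n. P n (E n)" "\<And>n. Q n (E n) (E (Suc n))" by blast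
  define \<epsilon> where "\<epsilon> i = E (Suc i) i" for i
  have agree: "E m i = \<epsilon> i" if "i < m" for m i
  proof -
    have "Suc i \<le> m" using that by simp
    then show ?thesis
    proof (induction m rule: dec_induct)
      case base
      show ?case by (simp add: \<epsilon>_def)
    next
      case (step m)
      obtain \<eta> where "E (Suc m) = (E m)(m := \<eta>)" using E(2)[of m] unfolding Q_def by blast
      then show ?case using step by simp
    qed
  qed
  have pos: "\<epsilon> i > 0" for i using E(1)[of "Suc i"] by (simp add: P_def \<epsilon>_def)
  obtain O' where O': "openin R_infinity O'" "x \<in> O'" "\<forall>y\<in>O'. \<forall>i. \<bar>Poly_Mapping.lookup (y - x) i\<bar> \<le> \<epsilon> i"
    using R_infinity_box_nhd[of \<epsilon> x, OF pos] by blast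
  have "O' \<times> V \<subseteq> U"
  proof clarify
    fix y q' assume y: "y \<in> O'" and q': "q' \<in> V"
    define n where "n = Suc (Max (insert 0 (Poly_Mapping.keys (y - x))))"
    have "Poly_Mapping.lookup (y - x) i = 0" if "i \<ge> n" for i
    proof (rule ccontr)
      assume "Poly_Mapping.lookup (y - x) i \<noteq> 0"
      then have "i \<le> Max (insert 0 (Poly_Mapping.keys (y - x)))" by (intro Max_ge) (auto simp: in_keys_iff)
      then show False using that by (simp add: n_def)
    qed
    moreover have "\<bar>Poly_Mapping.lookup (y - x) i\<bar> \<le> E n i" if "i < n" for i
      using O'(3) y agree[OF that] by simp
    ultimately have "y - x \<in> cube (E n) n" by (simp add: cube_def)
    then have "x + (y - x) \<in> (\<lambda>y. x + y) ` cube (E n) n" by (rule imageI)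
    then have "y \<in> (\<lambda>y. x + y) ` cube (E n) n" by simp
    moreover have "q' \<in> C" using q' V(4) by blast
    ultimately show "(y, q') \<in> U" using E(1)[of n] unfolding P_def by blast
  qed
  then show "\<exists>U' V. openin R_infinity U' \<and> openin Hilbert_cube V \<and> x \<in> U' \<and> q \<in> V \<and> U' \<times> V \<subseteq> U"
    using O'(1,2) V(1,3) by blast
qed

lemma Hausdorff_RQ: "Hausdorff_space RQ"
  using R.haus Hausdorff_Hilbert_cube by (simp add: Hausdorff_space_prod_topology)

lemma tower_RQ: "tower RQ (\<lambda>n. cube (\<lambda>_. real n) n \<times> qs)"
  unfolding tower_def
proof (intro conjI allI impI)
  show "Hausdorff_space RQ" by (rule Hausdorff_RQ)
  show "incseq (\<lambda>n. cube (\<lambda>_. real n) n \<times> qs)"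
  proof (rule incseq_SucI, rule Sigma_mono)
    fix n show "cube (\<lambda>_. real n) n \<subseteq> cube (\<lambda>_. real (Suc n)) (Suc n)"
    proof
      fix x assume x: "x \<in> cube (\<lambda>_. real n) n"
      have "\<bar>Poly_Mapping.lookup x i\<bar> \<le> real (Suc n)" for i
        using x by (cases "i < n") (auto simp: cube_def intro: order_trans)
      then show "x \<in> cube (\<lambda>_. real (Suc n)) (Suc n)" using x by (simp add: cube_def)
    qed
  qed simp
  have comp: "compactin RQ (cube (\<lambda>_. real n) n \<times> qs)" for n
    using compact_cube compact_Hilbert_cube by (simp add: compactin_Times compact_space_def)
  then show "compactin RQ (cube (\<lambda>_. real n) n \<times> qs)" for n .
  show "(\<Union>n. cube (\<lambda>_. real n) n \<times> qs) = topspace RQ"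
  proof (intro equalityI subsetI)
    fix p assume "p \<in> topspace RQ"
    then have p: "snd p \<in> qs" by auto
    obtain N where "(\<lambda>y. fst p + y) ` cube (\<lambda>_. 1) 0 \<subseteq> cube (\<lambda>_. real N) N" by (rule bounded_in_cube)
    then have "fst p \<in> cube (\<lambda>_. real N) N" by (simp add: cube_0)
    then show "p \<in> (\<Union>n. cube (\<lambda>_. real n) n \<times> qs)" using p by (cases p) auto
  qed auto
  fix C assume C: "C \<subseteq> topspace RQ \<and> (\<forall>n. closedin RQ (C \<inter> (cube (\<lambda>_. real n) n \<times> qs)))"
  have "openin RQ (topspace RQ - C)"
  proof (rule RQ_open)
    fix n
    let ?K = "cube (\<lambda>_. real n) n \<times> qs"
    have "openin RQ (topspace RQ - C \<inter> ?K)" using C by blast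
    then have "openin (subtopology RQ ?K) (?K \<inter> (topspace RQ - C \<inter> ?K))" by (rule openin_subtopology_Int2)
    moreover have "?K \<inter> (topspace RQ - C \<inter> ?K) = (topspace RQ - C) \<inter> ?K" by blast
    ultimately show "openin (subtopology RQ ?K) ((topspace RQ - C) \<inter> ?K)" by simp
  qed auto
  then show "closedin RQ C" using C by (simp add: closedin_def)
qed

section \<open>The two models\<close>

theorem embedding_extension_RQ:
  fixes Y :: "'b topology"
  assumes \<delta>: "Metric_space UNIV \<delta>" "\<And>x y. \<delta> x y < 1" "\<And>x e. openin Y {y \<in> topspace Y. \<delta> x y < e}"
  shows "embeddings_extend Y RQ"
  unfolding embeddings_extend_def
proof (intro allI impI, elim conjE)
  fix B C and g :: "'b \<Rightarrow> (nat \<Rightarrow>\<^sub>0 real) \<times> (nat \<Rightarrow> real)"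
  assume C: "compactin Y C" and B: "closedin Y B" and BC: "B \<subseteq> C" and Bne: "B \<noteq> {}"
    and g: "continuous_map (subtopology Y B) RQ g" "inj_on g B"
  interpret U: Metric_space UNIV \<delta> by (rule \<delta>(1))
  interpret M: Metric_space C \<delta> by (rule U.subspace) simp
  have topC: "subtopology Y C = M.mtopology" by (rule subtopology_compact_metric[OF \<delta>(1,3) C])
  have cC: "compactin M.mtopology C" using C by (simp add: topC[symmetric] compactin_subtopology)
  have clB: "closedin M.mtopology B"
    unfolding topC[symmetric] using B BC by (simp add: closedin_subset_topspace)
  have cBY: "compactin Y B" using closed_compactin[OF C BC B] .
  have topB: "subtopology M.mtopology B = subtopology Y B"
    by (simp add: topC[symmetric] subtopology_subtopology Int_absorb1[OF BC])
  obtain d where dB: "\<And>b. b \<in> B \<Longrightarrow> d b = 0"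
    and dex: "\<And>a t. d a < t \<Longrightarrow> \<exists>b\<in>B. \<delta> a b < t"
    and dlim: "\<And>x a. (\<lambda>k::nat. \<delta> (x k) a) \<longlonglongrightarrow> 0 \<Longrightarrow> (\<lambda>k. d (x k)) \<longlonglongrightarrow> d a"
    by (rule U.distance_to_set[OF _ Bne]) auto
  have dpos: "d a > 0" if "a \<in> C" "a \<notin> B" for a
    using M.distance_pos[OF clB that dex] .
  obtain z :: "nat \<Rightarrow> 'b" where
    zsep: "\<And>a a'. a \<in> C \<Longrightarrow> a' \<in> C \<Longrightarrow> (\<And>i. \<delta> a (z i) = \<delta> a' (z i)) \<Longrightarrow> a = a'"
    by (rule M.separating_sequence[OF cC]) (use Bne BC in auto)
  have dcont: "continuous_map M.mtopology euclideanreal d"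
    by (rule M.continuous_map_sequentially) (auto intro: dlim)
  have \<delta>cont: "continuous_map M.mtopology euclideanreal (\<lambda>a. \<delta> a (z i))" for i
    by (rule M.continuous_map_sequentially) (auto intro!: U.distance_limit)

  have g1: "continuous_map (subtopology Y B) R_infinity (\<lambda>b. fst (g b))"
    and g2: "continuous_map (subtopology Y B) Hilbert_cube (\<lambda>b. snd (g b))"
    using continuous_map_compose[OF g(1) continuous_map_fst] continuous_map_compose[OF g(1) continuous_map_snd]
    by (simp_all add: o_def)
  have "compactin (subtopology Y B) B" using cBY by (simp add: compactin_subtopology)
  from image_compactin[OF this g(1)] obtain n where n: "g ` B \<subseteq> cube (\<lambda>_. real n) n \<times> qs"
    by (rule tower_compact[OF tower_RQ])
  have normal: "normal_space M.mtopology" by (rule metrizable_imp_normal_space[OF M.metrizable_space_mtopology])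
  have "\<exists>F. continuous_map M.mtopology euclideanreal F \<and> (\<forall>b\<in>B. F b = Poly_Mapping.lookup (fst (g b)) i)" for i
  proof -
    have c: "continuous_map (subtopology M.mtopology B) euclideanreal (\<lambda>b. Poly_Mapping.lookup (fst (g b)) i)"
      unfolding topB using continuous_map_compose[OF g1 R_infinity_lookup[of i]] by (simp add: o_def)
    obtain F where "continuous_map M.mtopology euclideanreal F" "\<And>b. b \<in> B \<Longrightarrow> F b = Poly_Mapping.lookup (fst (g b)) i"
      by (rule Tietze_extension_realinterval[OF normal clB _ _ c, where T=UNIV]) auto
    then show ?thesis by blast
  qed
  then obtain F where F: "\<And>i. continuous_map M.mtopology euclideanreal (F i)"
    "\<And>i b. b \<in> B \<Longrightarrow> F i b = Poly_Mapping.lookup (fst (g b)) i" by metis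
  have "\<exists>G. continuous_map M.mtopology euclideanreal G \<and> G ` C \<subseteq> {0..1} \<and> (\<forall>b\<in>B. G b = snd (g b) j)" for j
  proof -
    have "continuous_map Hilbert_cube (top_of_set {0..1}) (\<lambda>f. f j)"
      unfolding Hilbert_cube_def by (rule continuous_map_product_projection) simp
    then have "continuous_map Hilbert_cube euclideanreal (\<lambda>f. f j)"
      using continuous_map_in_subtopology by blast
    from continuous_map_compose[OF g2 this]
    have c: "continuous_map (subtopology M.mtopology B) euclideanreal (\<lambda>b. snd (g b) j)"
      unfolding topB by (simp add: o_def)
    have i: "(\<lambda>b. snd (g b) j) ` B \<subseteq> {0..1}" using n by (force simp: topspace_Hilbert_cube)
    obtain G where "continuous_map M.mtopology euclideanreal G" "G ` topspace M.mtopology \<subseteq> {0..1}"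
      "\<And>b. b \<in> B \<Longrightarrow> G b = snd (g b) j"
      by (rule Tietze_extension_realinterval[OF normal clB _ _ c i]) auto
    then show ?thesis by auto
  qed
  then obtain G where G: "\<And>j. continuous_map M.mtopology euclideanreal (G j)" "\<And>j. G j ` C \<subseteq> {0..1}"
    "\<And>j b. b \<in> B \<Longrightarrow> G j b = snd (g b) j" by metis

  \<comment> \<open>Zero for j t <= 1 and one for j t >= 2: at fixed distance t > 0 all late
    coordinates are fully overwritten, while on B nothing changes.\<close>
  define \<phi> where "\<phi> j t = max 0 (min 1 (real j * t - 1))" for j :: nat and t :: real
  have \<phi>01: "0 \<le> \<phi> j t" "\<phi> j t \<le> 1" for j t by (auto simp: \<phi>_def)
  have \<phi>0: "\<phi> j 0 = 0" for j by (simp add: \<phi>_def)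
  have \<phi>1: "\<phi> j t = 1" if "real j * t \<ge> 2" for j t using that by (simp add: \<phi>_def)
  have \<phi>cont: "continuous_map M.mtopology euclideanreal (\<lambda>a. \<phi> j (d a))" for j
  proof -
    have "continuous_on UNIV (\<phi> j)" unfolding \<phi>_def by (intro continuous_intros)
    then have "continuous_map euclideanreal euclideanreal (\<phi> j)" by simp
    from continuous_map_compose[OF dcont this] show ?thesis by (simp add: o_def)
  qed
  define y where "y i a = \<delta> a (z i)" for i a
  have y01: "0 \<le> y i a" "y i a \<le> 1" for i a using \<delta>(2) by (auto simp: y_def less_imp_le)
  define h1 where "h1 a = (\<Sum>i<n. F i a *\<^sub>R bas i) + d a *\<^sub>R bas n" for a
  define h2 where "h2 a j = (1 - \<phi> j (d a)) * G j a + \<phi> j (d a) * y (fst (prod_decode j)) a" for a j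
  have "continuous_map M.mtopology R_infinity h1"
    unfolding h1_def by (intro R.cont_add R.cont_sum R.cont_scale F dcont) auto
  moreover have "continuous_map M.mtopology Hilbert_cube h2"
    unfolding Hilbert_cube_def continuous_map_componentwise_UNIV
  proof (intro allI continuous_map_into_subtopology)
    fix j
    show "continuous_map M.mtopology euclideanreal (\<lambda>a. h2 a j)"
      unfolding h2_def y_def
      by (intro continuous_map_add continuous_map_real_mult continuous_map_diff \<phi>cont G \<delta>cont) auto
    show "(\<lambda>a. h2 a j) \<in> topspace M.mtopology \<rightarrow> {0..1}"
    proof
      fix a assume "a \<in> topspace M.mtopology"
      then have Ga: "0 \<le> G j a" "G j a \<le> 1" using G(2)[of j] by auto
      have "(1 - \<phi> j (d a)) * G j a \<le> (1 - \<phi> j (d a)) * 1" using \<phi>01 Ga by (intro mult_left_mono) auto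
      moreover have "\<phi> j (d a) * y (fst (prod_decode j)) a \<le> \<phi> j (d a) * 1" using \<phi>01 y01 by (intro mult_left_mono) auto
      moreover have "0 \<le> (1 - \<phi> j (d a)) * G j a" "0 \<le> \<phi> j (d a) * y (fst (prod_decode j)) a"
        using \<phi>01 y01 Ga by simp_all
      ultimately show "h2 a j \<in> {0..1}" by (simp add: h2_def)
    qed
  qed
  ultimately have "continuous_map M.mtopology RQ (\<lambda>a. (h1 a, h2 a))" by (simp add: continuous_map_pairwise o_def)
  then have hc: "continuous_map (subtopology Y C) RQ (\<lambda>a. (h1 a, h2 a))" by (simp add: topC)
  have hB: "(h1 b, h2 b) = g b" if b: "b \<in> B" for b
  proof (rule prod_eqI)
    have "fst (g b) \<in> cube (\<lambda>_. real n) n" using n b by auto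
    then have "fst (g b) = (\<Sum>i<n. Poly_Mapping.lookup (fst (g b)) i *\<^sub>R bas i)"
      by (intro poly_mapping_bas_sum) (simp add: cube_def)
    then show "fst (h1 b, h2 b) = fst (g b)" using b by (simp add: h1_def F(2) dB)
    show "snd (h1 b, h2 b) = snd (g b)" using b by (simp add: h2_def fun_eq_iff dB \<phi>0 G(3))
  qed
  have "inj_on (\<lambda>a. (h1 a, h2 a)) C"
  proof (rule inj_onI)
    fix a a' assume a: "a \<in> C" "a' \<in> C" and "(h1 a, h2 a) = (h1 a', h2 a')"
    then have eq: "h1 a = h1 a'" "h2 a = h2 a'" by auto
    have "Poly_Mapping.lookup (h1 a) n = d a" for a
      by (simp add: h1_def lookup_add lookup_bas_sum lookup_bas)
    then have dd: "d a = d a'" using eq(1) by metis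
    show "a = a'"
    proof (cases "a \<in> B \<and> a' \<in> B")
      case True
      then have "g a = g a'" using hB[of a] hB[of a'] eq by simp
      then show ?thesis using g(2) True by (auto dest: inj_onD)
    next
      case False
      then have t: "d a > 0" using dpos a dd dB by metis
      have "y i a = y i a'" for i
      proof -
        obtain N where "2 / d a < real N" using reals_Archimedean2 by blast
        then have N: "2 \<le> real N * d a" using t by (simp add: field_simps)
        \<comment> \<open>Entry i is stored at infinitely many positions, so one exists where the
          overwriting is complete.\<close>
        define j where "j = prod_encode (i, N)"
        have "real N \<le> real j" unfolding j_def using le_prod_encode_2[of N i] by simp
        then have "real N * d a \<le> real j * d a" using t by (intro mult_right_mono) auto
        then have "\<phi> j (d a) = 1" using N by (intro \<phi>1) linarith
        then have "h2 a j = y i a" "h2 a' j = y i a'" using dd by (simp_all add: h2_def j_def)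
        then show ?thesis using eq(2) by simp
      qed
      then show ?thesis using zsep a unfolding y_def by blast
    qed
  qed
  with hc hB show "\<exists>h. continuous_map (subtopology Y C) RQ h \<and> inj_on h C \<and> (\<forall>b\<in>B. h b = g b)" by blast
qed

text \<open>The extension theorems ask for distances strictly below 1; capping keeps the small
  balls.\<close>

lemma capped_metric:
  assumes "Metric_space UNIV d"
  shows "Metric_space UNIV (\<lambda>x y. min (1/2) (d x y))"
proof -
  interpret Metric_space UNIV d by (rule assms)
  show ?thesis
  proof
    fix x y z
    have "d x z \<le> d x y + d y z" by (rule triangle) auto
    then show "min (1/2) (d x z) \<le> min (1/2) (d x y) + min (1/2) (d y z)"
      using nonneg[of x y] nonneg[of y z] by linarith
  qed (auto simp: commute min_def)
qed

lemma RQ_metric: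
  "openin RQ {p \<in> topspace RQ. dist x p < e}"
proof -
  have "continuous_map Hilbert_cube (euclidean :: (nat \<Rightarrow> real) topology) (\<lambda>f. f)"
  proof -
    have "continuous_map Hilbert_cube euclideanreal (\<lambda>f. f j)" for j
    proof -
      have "continuous_map Hilbert_cube (top_of_set {0..1}) (\<lambda>f. f j)"
        unfolding Hilbert_cube_def by (rule continuous_map_product_projection) simp
      then show ?thesis using continuous_map_in_subtopology by blast
    qed
    then show ?thesis unfolding euclidean_product_topology[symmetric] continuous_map_componentwise_UNIV by blast
  qed
  from continuous_map_compose[OF continuous_map_snd[of R_infinity Hilbert_cube] this]
    continuous_map_compose[OF continuous_map_fst[of R_infinity Hilbert_cube] R_infinity_norm]
  have "continuous_map RQ (prod_topology euclidean euclidean) (\<lambda>p. (fst p, snd p))"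
    unfolding continuous_map_pairwise by (simp add: o_def)
  then have "continuous_map RQ euclidean (\<lambda>p. p)" by simp
  from openin_continuous_map_preimage[OF this, of "ball x e"] show ?thesis by simp
qed

section \<open>The two homeomorphism types\<close>

context kw
begin

text \<open>The hull of one infinite-dimensional K n supplies the vectors for extending embeddings
  into X; continuous metrics on both spaces let the extension theorems feed the
  back-and-forth.\<close>

theorem homeomorphic_RQ:
  assumes inf: "\<And>F. finite F \<Longrightarrow> \<not> K n \<subseteq> span F"
  shows "X homeomorphic_space RQ"
proof -
  obtain Kp where Kp: "compactin X Kp" "abscon Kp" "K n \<subseteq> Kp" using compact_abscon_hull[OF K_compact] by blast
  have infp: "\<not> Kp \<subseteq> span F" if "finite F" for F using inf[OF that] Kp(3) by blast
  have "Metric_space UNIV (dist :: (nat \<Rightarrow>\<^sub>0 real) \<times> (nat \<Rightarrow> real) \<Rightarrow> _)" by (rule Met_TC.Metric_space_axioms)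
  note mRQ = capped_metric[OF this]
  have capped: "openin T {y \<in> topspace T. min (1/2) (d x y) < e}"
    if op: "\<And>x e. openin T {y \<in> topspace T. d x y < e}" for T :: "'z topology" and d :: "'z \<Rightarrow> 'z \<Rightarrow> real" and x e
  proof (cases "e > 1/2")
    case True
    then have "{y \<in> topspace T. min (1/2) (d x y) < e} = topspace T" by (auto simp: min_def)
    then show ?thesis by simp
  next
    case False
    then have "{y \<in> topspace T. min (1/2) (d x y) < e} = {y \<in> topspace T. d x y < e}" by (auto simp: min_def)
    then show ?thesis using op by simp
  qed
  have 1: "embeddings_extend RQ X"
  proof (rule embedding_extension[OF Kp(1,2) infp mRQ])
    show "openin RQ {y \<in> topspace RQ. min (1/2) (dist x y) < e}" for x e
      by (rule capped) (rule RQ_metric)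
  qed (auto simp: min_def)
  have 2: "embeddings_extend X RQ"
  proof (rule embedding_extension_RQ[OF capped_metric[OF metric]])
    show "openin X {y \<in> topspace X. min (1/2) (D (x - y)) < e}" for x e
      by (rule capped) (use open_ball in simp)
  qed (auto simp: min_def)
  have "(0, \<lambda>_. 0) \<in> topspace RQ" by (simp add: topspace_Hilbert_cube)
  then have "topspace RQ \<noteq> {}" by blast
  then show ?thesis by (intro back_and_forth[OF tw tower_RQ 2 1]) simp_all
qed

text \<open>\<phi> sends the unit vectors to a Hamel basis. It is continuous because it is linear,
  and closed because every K n lies in the image of a compact cube.\<close>

theorem homeomorphic_R_infinity:
  assumes fd: "\<And>n. \<exists>F. finite F \<and> K n \<subseteq> span F"
  shows "X homeomorphic_space R_infinity"
proof -
  obtain F where F: "\<And>n. finite (F n)" "\<And>n. K n \<subseteq> span (F n)" using fd by metis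
  obtain B where B: "B \<subseteq> (\<Union>n. F n)" "independent B" "(\<Union>n. F n) \<subseteq> span B" by (rule maximal_independent_subset)
  have "countable (\<Union>n. F n)" by (rule countable_UN) (simp_all add: countable_finite F(1))
  then have cB: "countable B" using B(1) by (rule countable_subset[rotated])
  have spanB: "span B = UNIV"
  proof -
    have "x \<in> span B" for x
    proof -
      have "x \<in> (\<Union>n. K n)" using tw by (simp add: tower_def)
      then obtain n where "x \<in> K n" by blast
      then have "x \<in> span (F n)" using F(2) by blast
      moreover have "span (F n) \<subseteq> span B" by (rule span_minimal) (use B(3) in auto)
      ultimately show ?thesis by blast
    qed
    then show ?thesis by blast
  qed
  \<comment> \<open>A finite basis would make its box a compact neighbourhood of 0, and X
    metrizable.\<close>
  have "infinite B"
  proof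
    assume fB: "finite B"
    obtain U where U: "znhd X U" "abscon U" "\<And>v. (\<Sum>b\<in>B. v b *\<^sub>R b) \<in> U \<Longrightarrow> \<forall>b\<in>B. \<bar>v b\<bar> \<le> 1"
      by (rule independent_coordinates_bounded[OF fB B(2)]) blast
    have "U \<subseteq> box B"
    proof
      fix x assume x: "x \<in> U"
      have "x \<in> span B" using spanB by simp
      then obtain v where v: "x = (\<Sum>b\<in>B. v b *\<^sub>R b)" unfolding span_finite[OF fB] by auto
      then have "\<forall>b\<in>B. \<bar>v b\<bar> \<le> 1" using U(3) x by blast
      then show "x \<in> box B" unfolding v box_def by blast
    qed
    then have "znhd X (box B)" using U(1) znhd_mono by blast
    then show False using compact_nhd_metrizable[OF compact_box[OF fB]] nm by blast
  qed
  then have bij: "bij_betw (from_nat_into B) UNIV B" using cB by (rule bij_betw_from_nat_into[rotated])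
  define e where "e = from_nat_into B"
  have e: "inj e" "range e = B" using bij by (auto simp: e_def bij_betw_def)
  define \<phi> where "\<phi> x = (\<Sum>i\<in>Poly_Mapping.keys x. Poly_Mapping.lookup x i *\<^sub>R e i)" for x :: "nat \<Rightarrow>\<^sub>0 real"
  have \<phi>_sup: "\<phi> x = (\<Sum>i\<in>A. Poly_Mapping.lookup x i *\<^sub>R e i)" if "finite A" "Poly_Mapping.keys x \<subseteq> A" for x A
    unfolding \<phi>_def using that by (intro sum.mono_neutral_left) (auto simp: in_keys_iff)
  have lin: "linear \<phi>"
  proof (rule linearI)
    fix x y :: "nat \<Rightarrow>\<^sub>0 real"
    let ?A = "Poly_Mapping.keys x \<union> Poly_Mapping.keys y \<union> Poly_Mapping.keys (x + y)"
    show "\<phi> (x + y) = \<phi> x + \<phi> y"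
      using \<phi>_sup[of ?A x] \<phi>_sup[of ?A y] \<phi>_sup[of ?A "x + y"]
      by (simp add: lookup_add scaleR_add_left sum.distrib le_supI1)
  next
    fix c :: real and x :: "nat \<Rightarrow>\<^sub>0 real"
    let ?A = "Poly_Mapping.keys x \<union> Poly_Mapping.keys (c *\<^sub>R x)"
    show "\<phi> (c *\<^sub>R x) = c *\<^sub>R \<phi> x"
      using \<phi>_sup[of ?A x] \<phi>_sup[of ?A "c *\<^sub>R x"] by (simp add: scaleR_sum_right)
  qed
  have \<phi>_bas: "\<phi> (bas i) = e i" for i
    using \<phi>_sup[of "{i}" "bas i"] by (simp add: bas_def)
  have inj: "inj \<phi>"
    unfolding linear_injective_0[OF lin]
  proof (intro allI impI)
    fix x assume x: "\<phi> x = 0"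
    have "Poly_Mapping.lookup x i = 0" if i: "i \<in> Poly_Mapping.keys x" for i
    proof -
      have "(\<Sum>b\<in>e ` Poly_Mapping.keys x. Poly_Mapping.lookup x (inv e b) *\<^sub>R b) = \<phi> x"
        unfolding \<phi>_def using e(1) by (subst sum.reindex) (auto simp: inj_on_def)
      then have s: "(\<Sum>b\<in>e ` Poly_Mapping.keys x. Poly_Mapping.lookup x (inv e b) *\<^sub>R b) = 0" using x by simp
      have "Poly_Mapping.lookup x (inv e (e i)) = 0"
        by (rule independentD[OF B(2) _ _ s]) (use e(2) i in auto)
      then show ?thesis using e(1) by simp
    qed
    then show "x = 0" by (intro poly_mapping_eqI) (metis in_keys_iff lookup_zero)
  qed
  have "subspace (range \<phi>)" by (rule linear_subspace_image[OF lin subspace_UNIV])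
  moreover have "B \<subseteq> range \<phi>" using \<phi>_bas e(2) by (metis image_subset_iff rangeI)
  ultimately have "span B \<subseteq> range \<phi>" by (intro span_minimal)
  then have surj: "range \<phi> = UNIV" using spanB by blast
  have cont: "continuous_map R_infinity X \<phi>" by (rule R_infinity_continuous[OF lin])
  \<comment> \<open>On U the coordinates are at most 1 in modulus, and K n lies in t U, which gives
    the side length t.\<close>
  have K_cube: "\<exists>\<epsilon> m. K n \<subseteq> \<phi> ` cube \<epsilon> m" for n
  proof -
    have ex: "\<exists>m. x \<in> span (e ` {..<m})" for x
    proof -
      obtain w where w: "x = \<phi> w" using surj by blast
      have "Poly_Mapping.keys w \<subseteq> {..<Suc (Max (insert 0 (Poly_Mapping.keys w)))}" by (auto simp: less_Suc_eq_le)
      then have "x \<in> span (e ` {..<Suc (Max (insert 0 (Poly_Mapping.keys w)))})"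
        unfolding w \<phi>_def by (intro span_sum span_scale span_base) blast
      then show ?thesis by blast
    qed
    then obtain \<mu> where \<mu>: "\<And>x. x \<in> span (e ` {..<\<mu> x})" by metis
    define m where "m = Max (insert 0 (\<mu> ` F n))"
    have "F n \<subseteq> span (e ` {..<m})"
    proof
      fix x assume "x \<in> F n"
      then have "\<mu> x \<le> m" unfolding m_def using F(1) by (intro Max_ge) auto
      then show "x \<in> span (e ` {..<m})" using \<mu>[of x] span_mono[of "e ` {..<\<mu> x}" "e ` {..<m}"] by fastforce
    qed
    then have KB: "K n \<subseteq> span (e ` {..<m})" using F(2)[of n] span_minimal[OF _ subspace_span] by blast
    have fin: "finite (e ` {..<m})" by simp
    have ind: "independent (e ` {..<m})" by (rule independent_mono[OF B(2)]) (use e(2) in auto)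
    obtain U where U: "znhd X U" "abscon U" "\<And>v. (\<Sum>b\<in>e ` {..<m}. v b *\<^sub>R b) \<in> U \<Longrightarrow> \<forall>b\<in>e ` {..<m}. \<bar>v b\<bar> \<le> 1"
      by (rule independent_coordinates_bounded[OF fin ind]) blast
    obtain t where t: "t \<ge> 1" "\<And>s. s \<ge> t \<Longrightarrow> K n \<subseteq> (*\<^sub>R) s ` U" by (rule compact_bounded[OF K_compact U(1)]) blast
    have "K n \<subseteq> \<phi> ` cube (\<lambda>_. t) m"
    proof
      fix x assume x: "x \<in> K n"
      then obtain v where v: "x = (\<Sum>b\<in>e ` {..<m}. v b *\<^sub>R b)" using KB unfolding span_finite[OF fin] by auto
      obtain u where u: "u \<in> U" "x = t *\<^sub>R u" using t(2)[of t] x by blast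
      have "(\<Sum>b\<in>e ` {..<m}. (v b / t) *\<^sub>R b) = (1/t) *\<^sub>R x" by (simp add: v scaleR_sum_right)
      also have "\<dots> = u" using u(2) t(1) by simp
      finally have "\<forall>b\<in>e ` {..<m}. \<bar>v b / t\<bar> \<le> 1" using U(3)[of "\<lambda>b. v b / t"] u(1) by simp
      then have vt: "\<bar>v (e i)\<bar> \<le> t" if "i < m" for i using that t(1) by (simp add: abs_divide)
      have "x = (\<Sum>i<m. v (e i) *\<^sub>R e i)" unfolding v using e(1) by (subst sum.reindex) (auto simp: inj_on_def)
      also have "\<dots> = \<phi> (\<Sum>i<m. v (e i) *\<^sub>R bas i)"
        by (simp add: linear_sum[OF lin] linear_scale[OF lin] \<phi>_bas)
      finally show "x \<in> \<phi> ` cube (\<lambda>_. t) m" using vt by (auto simp: cube_def lookup_bas_sum)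
    qed
    then show ?thesis by blast
  qed
  have "closed_map R_infinity X \<phi>"
    unfolding closed_map_def
  proof (intro allI impI)
    fix S assume S: "closedin R_infinity S"
    have "closedin X (\<phi> ` S \<inter> K n)" for n
    proof -
      obtain \<epsilon> m where m: "K n \<subseteq> \<phi> ` cube \<epsilon> m" using K_cube by blast
      have "compactin R_infinity (S \<inter> cube \<epsilon> m)" by (rule closed_Int_compactin[OF S compact_cube])
      then have "closedin X (\<phi> ` (S \<inter> cube \<epsilon> m))" by (intro compact_closed image_compactin[OF _ cont])
      moreover have "closedin X (K n)" by (rule compact_closed[OF K_compact])
      moreover have "\<phi> ` S \<inter> K n = \<phi> ` (S \<inter> cube \<epsilon> m) \<inter> K n"
        using m inj by (auto simp: inj_def image_iff subset_iff)
      ultimately show ?thesis by auto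
    qed
    then show "closedin X (\<phi> ` S)" using tw unfolding tower_def by auto
  qed
  then have "homeomorphic_map R_infinity X \<phi>"
    using cont surj inj by (intro bijective_closed_imp_homeomorphic_map) auto
  then show ?thesis
    using homeomorphic_map_imp_homeomorphic_space homeomorphic_space_sym by blast
qed

end

theorem theorem13p7:
  fixes X :: "'a::real_vector topology"
  assumes "locally_convex_topology X"
    and "Hausdorff_space X"
    and "sequential_space X"
    and "kstar_metrizable_space TYPE('m) X"
    and "\<not> metrizable_space X"
  shows "X homeomorphic_space R_infinity \<or>
         X homeomorphic_space prod_topology R_infinity Hilbert_cube"
proof -
  interpret lcs X by unfold_locales fact+
  obtain K D where KD: "tower X K" "D 0 = (0::real)" "\<And>x. D x = 0 \<Longrightarrow> x = 0" "\<And>x. 0 \<le> D x" "\<And>x. D (- x) = D x"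
    "\<And>x y. D (x + y) \<le> D x + D y" "\<And>e. e > 0 \<Longrightarrow> znhd X {x. D x < e}"
    using kstar_tower[OF assms(3-5)] by blast
  interpret kw X K D by unfold_locales (use KD assms in auto)
  show ?thesis
    using homeomorphic_RQ homeomorphic_R_infinity by metis
qed

end
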